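(* Let $k,m\in\mathbb{N}$ with $k\ge2$, let $\varnothing\neq U\subseteq\mathbb{R}$ be open, and let $f\in C^{k+m+1}(U)$. Define the open set $$\mathcal{H}^2[U] = \{u\in\mathcal{H}^2 : \overline{u((-1,1))}\subset U\}\subseteq\mathcal{H}^2.$$ Then the map $\Phi:\mathcal{H}^k\cap\mathcal{H}^2[U]\to\mathcal{H}^k$ defined by $\Phi(u)=f\circ u$ is well-defined and $C^m$. Moreover, if $m\ge1$, then for $u\in\mathcal{H}^k\cap\mathcal{H}^2[U]$ and $1\le j\le m$ the $j$-th Fréchet derivative $D^j\Phi(u)\in\mathcal{L}^j(\mathcal{H}^k;\mathcal{H}^k)$ is given by $$D^j\Phi(u)(w_1,\dots,w_j) = D^jf(u)\prod_{i=1}^jw_i .$$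
   Context: $\mathbb{N}=\{0,1,2,\dots\}$, $D=d/d\zeta$ on functions of one variable. $AC_{\mathrm{loc}}^{0}((-1,1))$ is the set of functions $(-1,1)\to\mathbb{R}$ that are absolutely continuous on each compact subset of $(-1,1)$, and for $k\ge1$, $AC^k_{\mathrm{loc}}((-1,1)) = \{u \in AC^{k-1}_{\mathrm{loc}}((-1,1)) : D^k u \in AC^0_{\mathrm{loc}}((-1,1))\}$. For $k\ge1$, $$\mathcal{H}^k = \{u \in AC_{\mathrm{loc}}^{k-1}((-1,1)) : \|u\|_{\mathcal{H}^k}<\infty\},\qquad \|u\|_{\mathcal{H}^k}^2 = \sum_{j=0}^k\int_{-1}^1(1-\zeta^2)^j|D^ju(\zeta)|^2\,d\zeta,$$ which is a Hilbert space with the associated inner product. $\mathcal{L}^j(X;X)$ denotes the space of bounded $j$-linear maps $X^j\to X$. $D^jf(u)$ denotes the composition $(D^jf)\circ u$. *)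

theory Defs
  imports "HOL-Analysis.Analysis" "HOL-Library.Function_Algebras"
begin

section \<open>The function spaces\<close>

text \<open>
  Functions on the open interval \<open>(-1,1)\<close> are represented by total functions on the reals.  The
  regularity notions below only look at the values on \<open>(-1,1)\<close>; elements of the Sobolev-type spaces
  are in addition required to vanish outside \<open>(-1,1)\<close>, so that each of them is represented by exactly
  one total function.  Addition, subtraction and scalar multiplication are pointwise; addition and
  subtraction come from \<open>HOL-Library.Function_Algebras\<close>.
\<close>

abbreviation unit_ival :: "real set" where
  "unit_ival \<equiv> {-1<..<1}"

instantiation "fun" :: (type, real_vector) real_vector
begin

definition scaleR_fun :: "real \<Rightarrow> ('a \<Rightarrow> 'b) \<Rightarrow> 'a \<Rightarrow> 'b" where
  "scaleR_fun c u = (\<lambda>x. c *\<^sub>R u x)"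

instance
  by standard (simp_all add: scaleR_fun_def fun_eq_iff scaleR_add_right scaleR_add_left)

end

definition abs_cont_on :: "real set \<Rightarrow> (real \<Rightarrow> real) \<Rightarrow> bool" where
  "abs_cont_on K u \<longleftrightarrow>
     (\<forall>\<epsilon>>0. \<exists>\<delta>>0. \<forall>P :: (real \<times> real) set.
        finite P \<and> (\<forall>(a, b)\<in>P. a \<in> K \<and> b \<in> K \<and> a \<le> b) \<and>
        disjoint_family_on (\<lambda>(a, b). {a<..<b}) P \<and>
        (\<Sum>(a, b)\<in>P. b - a) < \<delta>
        \<longrightarrow> (\<Sum>(a, b)\<in>P. \<bar>u b - u a\<bar>) < \<epsilon>)"

definition AC_loc0 :: "(real \<Rightarrow> real) set" where
  "AC_loc0 = {u. \<forall>K. compact K \<and> K \<subseteq> unit_ival \<longrightarrow> abs_cont_on K u}"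

text \<open>
  \<open>D\<^sup>k u\<close> is \<open>(deriv ^^ k) u\<close>.  As \<^const>\<open>deriv\<close> is total, the existence of the derivative on
  \<open>(-1,1)\<close> is demanded explicitly.
\<close>

primrec AC_loc :: "nat \<Rightarrow> (real \<Rightarrow> real) set" where
  "AC_loc 0 = AC_loc0"
| "AC_loc (Suc k) =
     {u \<in> AC_loc k. (\<forall>x\<in>unit_ival. (deriv ^^ k) u differentiable (at x)) \<and>
                    (deriv ^^ Suc k) u \<in> AC_loc0}"

text \<open>
  The squared norm is extended-valued.  For \<open>u \<in> AC_loc (k - 1)\<close> the derivative \<open>D\<^sup>k u\<close> exists almost
  everywhere only; the arbitrary value of \<^const>\<open>deriv\<close> on the exceptional null set does not affect
  the integral.
\<close>

definition sob_sqnorm :: "nat \<Rightarrow> (real \<Rightarrow> real) \<Rightarrow> ennreal" where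
  "sob_sqnorm k u =
     (\<Sum>j=0..k. \<integral>\<^sup>+x\<in>unit_ival. ennreal ((1 - x\<^sup>2) ^ j * \<bar>(deriv ^^ j) u x\<bar>\<^sup>2) \<partial>lebesgue)"

text \<open>Only meant for \<open>k \<ge> 1\<close>.\<close>

definition sob :: "nat \<Rightarrow> (real \<Rightarrow> real) set" where
  "sob k = {u \<in> AC_loc (k - 1). (\<forall>x. x \<notin> unit_ival \<longrightarrow> u x = 0) \<and> sob_sqnorm k u < \<infinity>}"

definition sob_norm :: "nat \<Rightarrow> (real \<Rightarrow> real) \<Rightarrow> real" where
  "sob_norm k u = sqrt (enn2real (sob_sqnorm k u))"

definition sob2_in :: "real set \<Rightarrow> (real \<Rightarrow> real) set" where
  "sob2_in U = {u \<in> sob 2. closure (u ` unit_ival) \<subseteq> U}"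

definition superpos :: "(real \<Rightarrow> real) \<Rightarrow> (real \<Rightarrow> real) \<Rightarrow> real \<Rightarrow> real" where
  "superpos f u = (\<lambda>x. if x \<in> unit_ival then f (u x) else 0)"

definition C_k_on :: "nat \<Rightarrow> real set \<Rightarrow> (real \<Rightarrow> real) \<Rightarrow> bool" where
  "C_k_on n U f \<longleftrightarrow>
     (\<forall>i<n. \<forall>x\<in>U. (deriv ^^ i) f differentiable (at x)) \<and> continuous_on U ((deriv ^^ n) f)"


section \<open>Maps of class \<open>C\<^sup>m\<close> between normed spaces given by carrier sets\<close>

text \<open>
  A normed space is a linear subspace \<open>X\<close> of a real vector space together with a norm \<open>nX\<close> on \<open>X\<close>.
  The spaces \<^const>\<open>sob\<close> depend on a natural number, so they cannot be types and the library's
  type-class based derivative does not apply.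

  A \<open>j\<close>-linear map is applied to the list of its \<open>j\<close> arguments; its values on other lists are
  irrelevant.
\<close>

definition open_in_normed ::
    "'a::real_vector set \<Rightarrow> ('a \<Rightarrow> real) \<Rightarrow> 'a set \<Rightarrow> bool" where
  "open_in_normed X nX S \<longleftrightarrow>
     S \<subseteq> X \<and> (\<forall>u\<in>S. \<exists>\<delta>>0. \<forall>v\<in>X. nX (v - u) < \<delta> \<longrightarrow> v \<in> S)"

definition args :: "'a set \<Rightarrow> nat \<Rightarrow> 'a list set" where
  "args X j = {ws. length ws = j \<and> set ws \<subseteq> X}"

definition bounded_multilinear ::
    "'a::real_vector set \<Rightarrow> ('a \<Rightarrow> real) \<Rightarrow> 'b::real_vector set \<Rightarrow> ('b \<Rightarrow> real) \<Rightarrow>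
     nat \<Rightarrow> ('a list \<Rightarrow> 'b) set" where
  "bounded_multilinear X nX Y nY j =
     {A. (\<forall>ws\<in>args X j. A ws \<in> Y) \<and>
         (\<forall>ws\<in>args X j. \<forall>i<j. \<forall>v\<in>X. \<forall>w\<in>X. A (ws[i := v + w]) = A (ws[i := v]) + A (ws[i := w])) \<and>
         (\<forall>ws\<in>args X j. \<forall>i<j. \<forall>c. \<forall>w\<in>X. A (ws[i := c *\<^sub>R w]) = c *\<^sub>R A (ws[i := w])) \<and>
         (\<exists>C. \<forall>ws\<in>args X j. nY (A ws) \<le> C * (\<Prod>w\<leftarrow>ws. nX w))}"

definition multilinear_norm ::
    "'a set \<Rightarrow> ('a \<Rightarrow> real) \<Rightarrow> ('b \<Rightarrow> real) \<Rightarrow> nat \<Rightarrow> ('a list \<Rightarrow> 'b) \<Rightarrow> real" where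
  "multilinear_norm X nX nY j A =
     (SUP ws\<in>{ws \<in> args X j. \<forall>w\<in>set ws. nX w \<le> 1}. nY (A ws))"

text \<open>
  \<open>D 0, \<dots>, D m\<close> are the successive Frechet derivatives on \<open>S\<close> of \<open>\<Phi>\<close>, and they are continuous:
  \<open>D j\<close> maps \<open>S\<close> into the bounded \<open>j\<close>-linear maps with the operator norm, and \<open>D (Suc j)\<close> is
  the Frechet derivative of \<open>D j\<close>, where the bounded linear maps from \<open>X\<close> into the bounded
  \<open>j\<close>-linear maps are identified with the bounded \<open>(j+1)\<close>-linear maps, the increment \<open>v - u\<close> being
  the first argument.
\<close>

definition frechet_derivs ::
    "'a::real_vector set \<Rightarrow> ('a \<Rightarrow> real) \<Rightarrow> 'b::real_vector set \<Rightarrow> ('b \<Rightarrow> real) \<Rightarrow>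
     'a set \<Rightarrow> nat \<Rightarrow> ('a \<Rightarrow> 'b) \<Rightarrow> (nat \<Rightarrow> 'a \<Rightarrow> 'a list \<Rightarrow> 'b) \<Rightarrow> bool" where
  "frechet_derivs X nX Y nY S m \<Phi> D \<longleftrightarrow>
     (\<forall>u\<in>S. D 0 u [] = \<Phi> u) \<and>
     (\<forall>j\<le>m. \<forall>u\<in>S. D j u \<in> bounded_multilinear X nX Y nY j) \<and>
     (\<forall>j<m. \<forall>u\<in>S. \<forall>\<epsilon>>0. \<exists>\<delta>>0. \<forall>v\<in>S. nX (v - u) < \<delta> \<longrightarrow>
        multilinear_norm X nX nY j (\<lambda>ws. D j v ws - D j u ws - D (Suc j) u ((v - u) # ws))
          \<le> \<epsilon> * nX (v - u)) \<and>
     (\<forall>j\<le>m. \<forall>u\<in>S. \<forall>\<epsilon>>0. \<exists>\<delta>>0. \<forall>v\<in>S. nX (v - u) < \<delta> \<longrightarrow>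
        multilinear_norm X nX nY j (\<lambda>ws. D j v ws - D j u ws) < \<epsilon>)"

definition C_m_map ::
    "'a::real_vector set \<Rightarrow> ('a \<Rightarrow> real) \<Rightarrow> 'b::real_vector set \<Rightarrow> ('b \<Rightarrow> real) \<Rightarrow>
     'a set \<Rightarrow> nat \<Rightarrow> ('a \<Rightarrow> 'b) \<Rightarrow> bool" where
  "C_m_map X nX Y nY S m \<Phi> \<longleftrightarrow>
     open_in_normed X nX S \<and> (\<exists>D. frechet_derivs X nX Y nY S m \<Phi> D)"

end

theory Submission
  imports Defs
begin

text \<open>
  A locally absolutely continuous function is differentiable almost everywhere (Vitali covering) and
  satisfies the fundamental theorem of calculus, so weighted \<open>L\<^sup>2\<close> bounds on \<open>D\<^sup>j u\<close> turn into the
  pointwise bounds \<open>\<bar>D\<^sup>i u\<bar> \<le> C (1 - x\<^sup>2)\<^sup>-\<^sup>i\<^sup>/\<^sup>2\<close> for \<open>i < k\<close>. By induction on the order these make the space an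
  algebra and give \<open>O(\<parallel>h\<parallel>)\<close> and \<open>O(\<parallel>h\<parallel>\<^sup>2)\<close> estimates for \<open>g(u + h) - g(u)\<close> and
  \<open>g(u + h) - g(u) - g'(u) h\<close>. Applied to \<open>g = D\<^sup>j f\<close> they exhibit the derivatives of the superposition
  operator, which are unique.
\<close>

section \<open>Absolutely continuous functions\<close>

subsection \<open>Vitali coverings by intervals\<close>

text \<open>The top derivative of an element of \<open>sob k\<close> exists only almost everywhere
  and is only square integrable, so at the last order no pointwise estimate is available. The
  induction survives because each Leibniz term contains at most one factor of top order, while the
  others have pointwise bounds whose powers of \<open>rho\<close> multiply to the weight required of
  the term. The bound on u itself is special and is where k >= 2 enters: square integrability of rho
  * u' does not bound u, since 1 / rho^2 is not integrable, but a pointwise bound on rho * u' does,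
  since 1 / rho has the bounded antiderivative \<open>arcsin\<close>. The k + m + 1 derivatives of f
  are spent as follows: composition at order k takes k of them, a difference one more, a Taylor
  remainder two more. Continuity of the m-th derivative needs the difference estimate for D^m f;
  differentiability of the j-th needs the remainder estimate only for j < m. The formula is claimed
  for every family satisfying \<open>frechet_derivs\<close>, so exhibiting one family has to be
  complemented by uniqueness.\<close>

lemma vitali_finite:
  fixes P :: "real \<Rightarrow> real \<Rightarrow> bool"
  assumes E: "E \<in> lmeasurable" and G: "open G" "E \<subseteq> G" and \<eta>: "\<eta> > 0"
    and P: "\<And>x d. x \<in> E \<Longrightarrow> d > 0 \<Longrightarrow> \<exists>p q. p < x \<and> x < q \<and> q - p < d \<and> P p q"
  obtains F where "finite F" "\<And>p q. (p, q) \<in> F \<Longrightarrow> p < q \<and> P p q \<and> {p..q} \<subseteq> G"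
    "disjoint_family_on (\<lambda>(p, q). {p..q}) F"
    "measure lebesgue E - \<eta> < (\<Sum>(p, q)\<in>F. measure lebesgue (E \<inter> {p..q}))"
proof -
  define K where "K = {(p, q). p < q \<and> P p q \<and> {p..q} \<subseteq> G}"
  \<comment> \<open>Midpoint and half-length turn the intervals into closed balls, the form in which
    the Vitali covering theorem applies; \<open>fine\<close> checks that arbitrarily small ones
    surround every point of \<open>E\<close>.\<close>
  define a where "a = (\<lambda>i::real\<times>real. (fst i + snd i) / 2)"
  define r where "r = (\<lambda>i::real\<times>real. (snd i - fst i) / 2)"
  have cb: "cball (a i) (r i) = {fst i..snd i}" for i
    unfolding cball_eq_atLeastAtMost a_def r_def by (auto simp: field_simps)
  have fine: "\<exists>i. i \<in> K \<and> x \<in> cball (a i) (r i) \<and> r i < d" if x: "x \<in> E" and d: "0 < d" for x d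
  proof -
    from x G obtain e where e: "e > 0" "ball x e \<subseteq> G"
      using open_contains_ball by blast
    obtain p q where pq: "p < x" "x < q" "q - p < min d e" "P p q"
      using P[OF x, of "min d e"] d e by auto
    have "{p..q} \<subseteq> ball x e"
      using pq by (auto simp: dist_real_def)
    then have "{p..q} \<subseteq> G" using e by blast
    then have "(p, q) \<in> K"
      using pq by (simp add: K_def)
    moreover have "x \<in> cball (a (p, q)) (r (p, q))" "r (p, q) < d"
      using pq d unfolding cb by (auto simp: r_def)
    ultimately show ?thesis by blast
  qed
  have pos: "0 < r i" if "i \<in> K" for i
    using that by (auto simp: K_def r_def)
  obtain C where C: "countable C" "C \<subseteq> K"
     "pairwise (\<lambda>i j. disjnt (cball (a i) (r i)) (cball (a j) (r j))) C"
     "negligible (E - (\<Union>i \<in> C. cball (a i) (r i)))"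
    by (rule Vitali_covering_theorem_cballs[of K r E a, OF pos fine])
  define A where "A = (\<lambda>i::real\<times>real. E \<inter> {fst i..snd i})"
  have Am: "A i \<in> lmeasurable" for i
    using E unfolding A_def by (simp add: fmeasurable_Int_fmeasurable)
  have UE: "measure lebesgue (\<Union>(A ` C)) = measure lebesgue E"
  proof -
    have "E - (\<Union>i \<in> C. cball (a i) (r i)) = E - \<Union>(A ` C)"
      by (auto simp: A_def cb)
    then have "negligible (E - \<Union>(A ` C))" using C by simp
    moreover have "\<Union>(A ` C) - E = {}" by (auto simp: A_def)
    ultimately show ?thesis
      by (metis sup_bot.left_neutral sup_bot.right_neutral measure_negligible_symdiff E fmeasurableD)
  qed
  \<comment> \<open>The covering family is only countable; finite subfamilies exhaust its measure up
    to \<open>\<eta>\<close>.\<close>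
  obtain D where D: "D \<subseteq> A ` C" "finite D" "measure lebesgue (\<Union>(A ` C)) - \<eta> < measure lebesgue (\<Union>D)"
  proof (rule measure_countable_Union_approachable[of "A ` C" \<eta> "measure lebesgue E"])
    show "countable (A ` C)" using C by simp
    show "d \<in> lmeasurable" if "d \<in> A ` C" for d using that Am by auto
    show "measure lebesgue (\<Union>D') \<le> measure lebesgue E" if "D' \<subseteq> A ` C" "finite D'" for D'
      using that Am E by (intro measure_mono_fmeasurable) (auto simp: A_def intro!: sets.finite_Union)
  qed (use \<eta> in auto)
  obtain F where F: "F \<subseteq> C" "finite F" "D = A ` F"
    using D finite_subset_image by metis
  show thesis
  proof
    show "finite F" by fact
    show "p < q \<and> P p q \<and> {p..q} \<subseteq> G" if "(p, q) \<in> F" for p q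
      using that F C by (auto simp: K_def)
    have disj: "disjoint_family_on (\<lambda>i. {fst i..snd i}) F"
      using C(3) F unfolding pairwise_def disjoint_family_on_def disjnt_def cb by blast
    then show "disjoint_family_on (\<lambda>(p, q). {p..q}) F"
      by (simp add: case_prod_unfold)
    have "measure lebesgue (\<Union>D) \<le> (\<Sum>i\<in>F. measure lebesgue (A i))"
      unfolding F using F(2) Am by (intro measure_UNION_le) auto
    then show "measure lebesgue E - \<eta> < (\<Sum>(p, q)\<in>F. measure lebesgue (E \<inter> {p..q}))"
      using D UE by (simp add: A_def case_prod_unfold)
  qed
qed

section \<open>Finite families of intervals and their gaps\<close>

abbreviation len_sum :: "(real \<times> real) set \<Rightarrow> real" where
  "len_sum P \<equiv> (\<Sum>(p, q)\<in>P. q - p)"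

abbreviation inc_sum :: "(real \<times> real) set \<Rightarrow> (real \<Rightarrow> real) \<Rightarrow> real" where
  "inc_sum P u \<equiv> (\<Sum>(p, q)\<in>P. u q - u p)"

abbreviation osc_sum :: "(real \<times> real) set \<Rightarrow> (real \<Rightarrow> real) \<Rightarrow> real" where
  "osc_sum P u \<equiv> (\<Sum>(p, q)\<in>P. \<bar>u q - u p\<bar>)"

definition intervals_in :: "real set \<Rightarrow> (real \<times> real) set \<Rightarrow> bool" where
  "intervals_in K P \<longleftrightarrow> finite P \<and> (\<forall>(a, b)\<in>P. a \<in> K \<and> b \<in> K \<and> a \<le> b) \<and>
     disjoint_family_on (\<lambda>(a, b). {a<..<b}) P"

lemma intervals_inI:
  assumes "finite P" "\<And>a b. (a, b) \<in> P \<Longrightarrow> a \<in> K \<and> b \<in> K \<and> a \<le> b"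
    "disjoint_family_on (\<lambda>(a, b). {a<..<b}) P"
  shows "intervals_in K P"
  using assms unfolding intervals_in_def by blast

text \<open>\<open>Q\<close> consists of the gaps left by \<open>F\<close>. The telescoping identity
  is stated for every \<open>g\<close> because it is used with the identity, for lengths, and with
  \<open>u\<close>, for increments. The induction splits off the rightmost interval together with
  the gap to its right and continues on \<open>{c..p0}\<close>.\<close>

lemma interval_gaps:
  fixes c d :: real
  assumes "finite F" and "\<And>p q. (p, q) \<in> F \<Longrightarrow> c \<le> p \<and> p < q \<and> q \<le> d"
    and "disjoint_family_on (\<lambda>(p, q). {p..q}) F" and "c \<le> d"
  shows "\<exists>Q. intervals_in {c..d} Q \<and>
    (\<forall>g::real \<Rightarrow> real. inc_sum F g + inc_sum Q g = g d - g c)"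
  using assms
proof (induction "card F" arbitrary: F d)
  case 0
  then have "F = {}" by simp
  then show ?case using 0 by (intro exI[of _ "{(c, d)}"]) (auto simp: intervals_in_def disjoint_family_on_def)
next
  case (Suc n)
  have "Max (snd ` F) \<in> snd ` F" using Suc by (intro Max_in) auto
  then obtain p0 q0 where m: "(p0, q0) \<in> F" "q0 = Max (snd ` F)" by auto
  let ?F = "F - {(p0, q0)}"
  have pq0: "c \<le> p0" "p0 < q0" "q0 \<le> d" using Suc(4) m by auto
  have lt: "q < p0" if "(p, q) \<in> ?F" for p q
  proof -
    have "q \<in> snd ` F" using that by (metis DiffD1 image_eqI snd_conv)
    then have "q \<le> q0" unfolding m(2) using Suc(3) by (intro Max_ge) simp_all
    moreover have "{p..q} \<inter> {p0..q0} = {}"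
      using disjoint_family_onD[OF Suc(5), of "(p, q)" "(p0, q0)"] that m by auto
    moreover have "p < q" using Suc(4) that by auto
    ultimately show ?thesis using pq0
      by (metis atLeastAtMost_iff disjoint_iff less_eq_real_def linorder_not_le)
  qed
  have "\<exists>Q. intervals_in {c..p0} Q \<and>
    (\<forall>g::real \<Rightarrow> real. inc_sum ?F g + inc_sum Q g = g p0 - g c)"
  proof (rule Suc(1))
    show "n = card ?F" using Suc m by simp
    show "disjoint_family_on (\<lambda>(p, q). {p..q}) ?F"
      using Suc(5) by (rule disjoint_family_on_mono[rotated]) auto
    show "c \<le> p \<and> p < q \<and> q \<le> p0" if "(p, q) \<in> ?F" for p q
      using that lt[OF that] Suc(4)[of p q] by auto
  qed (use Suc pq0 in auto)
  then obtain Q where Qi: "intervals_in {c..p0} Q" and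
    Q4: "\<And>g::real \<Rightarrow> real. inc_sum ?F g + inc_sum Q g = g p0 - g c" by blast
  then have Q: "finite Q" "\<forall>(p, q)\<in>Q. c \<le> p \<and> p \<le> q \<and> q \<le> p0"
    "disjoint_family_on (\<lambda>(p, q). {p<..<q}) Q"
    by (auto simp: intervals_in_def)
  have nin: "(q0, d) \<notin> Q" using Q(2) pq0 by auto
  show ?case
  proof (intro exI[of _ "insert (q0, d) Q"] conjI allI)
    show "intervals_in {c..d} (insert (q0, d) Q)"
    proof (rule intervals_inI)
      show "finite (insert (q0, d) Q)" using Q by simp
      show "p \<in> {c..d} \<and> q \<in> {c..d} \<and> p \<le> q" if "(p, q) \<in> insert (q0, d) Q" for p q
        using that Q(2) pq0 by fastforce
      show "disjoint_family_on (\<lambda>(p, q). {p<..<q}) (insert (q0, d) Q)"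
        using Q(3) Q(2) pq0 nin by (fastforce simp: disjoint_family_on_insert)
    qed
    fix g :: "real \<Rightarrow> real"
    have "inc_sum F g = (g q0 - g p0) + inc_sum ?F g"
      using m Suc(3) by (simp add: sum.remove)
    moreover have "inc_sum (insert (q0, d) Q) g = (g d - g q0) + inc_sum Q g"
      using Q nin by simp
    ultimately show "inc_sum F g + inc_sum (insert (q0, d) Q) g = g d - g c"
      using Q4[of g] by linarith
  qed
qed

text \<open>Slopes over intervals straddling \<open>x\<close> rather than ending in \<open>x\<close> make this set a \<open>G\<^sub>\<delta>\<close>, hence measurable.\<close>

definition steep :: "(real \<Rightarrow> real) \<Rightarrow> real \<Rightarrow> real set" where
  "steep u c = {x. \<forall>d>0. \<exists>p q. p < x \<and> x < q \<and> q - p < d \<and> u q - u p > c * (q - p)}"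

text \<open>Vitali yields disjoint intervals of slope above \<open>s\<close> that cover almost all
  of \<open>E\<close> in \<open>{c<..<d}\<close>. Only their gaps \<open>Q\<close> are returned: the
  steep intervals have total length \<open>(d - c) - len_sum Q\<close>, and the increments over the
  gaps are what absolute continuity will control.\<close>

lemma steep_subintervals:
  fixes u :: "real \<Rightarrow> real"
  assumes E: "E \<in> lmeasurable" and cd: "c < d" and \<eta>: "\<eta> > 0"
    and P: "E \<subseteq> steep u s"
  shows "\<exists>Q. intervals_in {c..d} Q \<and>
    len_sum Q < (d - c) - measure lebesgue (E \<inter> {c..d}) + \<eta> \<and>
    u d - u c \<ge> s * ((d - c) - len_sum Q) + inc_sum Q u"
proof -
  let ?E = "E \<inter> {c<..<d}"
  have Em: "?E \<in> lmeasurable" using E by (simp add: fmeasurable_Int_fmeasurable)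
  have steepD: "\<exists>p q. p < x \<and> x < q \<and> q - p < \<delta> \<and> u q - u p > s * (q - p)" if "x \<in> ?E" "\<delta> > 0" for x \<delta>
    using P that unfolding steep_def by blast
  obtain F where F: "finite F"
    "\<And>p q. (p, q) \<in> F \<Longrightarrow> p < q \<and> u q - u p > s * (q - p) \<and> {p..q} \<subseteq> {c<..<d}"
    "disjoint_family_on (\<lambda>(p, q). {p..q}) F"
    "measure lebesgue ?E - \<eta> < (\<Sum>(p, q)\<in>F. measure lebesgue (?E \<inter> {p..q}))"
    using vitali_finite[OF Em, of "{c<..<d}" \<eta> "\<lambda>p q. u q - u p > s * (q - p)"] steepD \<eta> by auto
  have "c \<le> p \<and> p < q \<and> q \<le> d" if "(p, q) \<in> F" for p q
    using F(2)[OF that] atLeastatMost_subset_iff[of p q c d] greaterThanLessThan_subseteq_atLeastAtMost_iff[of c d c d]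
    by (metis atLeastAtMost_iff greaterThanLessThan_iff less_eq_real_def order_refl subsetD)
  from interval_gaps[OF F(1) this F(3)] cd
  obtain Q where Q: "intervals_in {c..d} Q"
    "\<And>g::real \<Rightarrow> real. inc_sum F g + inc_sum Q g = g d - g c" by auto
  have eq: "measure lebesgue (E \<inter> {c..d}) = measure lebesgue ?E"
  proof (rule measure_negligible_symdiff)
    show "?E \<in> lmeasurable" by fact
    show "negligible (?E - E \<inter> {c..d} \<union> (E \<inter> {c..d} - ?E))"
      by (rule negligible_subset[of "{c, d}"]) auto
  qed
  have le: "(\<Sum>(p, q)\<in>F. measure lebesgue (?E \<inter> {p..q})) \<le> len_sum F"
  proof (rule sum_mono, clarify)
    fix p q assume "(p, q) \<in> F"
    have "measure lebesgue (?E \<inter> {p..q}) \<le> measure lebesgue {p..q}"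
      using Em by (intro measure_mono_fmeasurable) auto
    then show "measure lebesgue (?E \<inter> {p..q}) \<le> q - p"
      using F(2)[OF \<open>(p, q) \<in> F\<close>] by auto
  qed
  have len: "len_sum F = (d - c) - len_sum Q"
    using Q(2)[of "\<lambda>x. x"] by simp
  have "s * len_sum F \<le> inc_sum F u"
    unfolding sum_distrib_left case_prod_unfold using F(2) by (intro sum_mono) fastforce
  then have "u d - u c \<ge> s * ((d - c) - len_sum Q) + inc_sum Q u"
    using Q(2)[of u] unfolding len by linarith
  moreover have "len_sum Q < (d - c) - measure lebesgue (E \<inter> {c..d}) + \<eta>"
    using le len F(4) eq by linarith
  ultimately show ?thesis using Q by blast
qed

subsection \<open>Differentiability almost everywhere\<close>

lemma abs_cont_onD:
  assumes "abs_cont_on K u" "\<epsilon> > 0"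
  obtains \<delta> where "\<delta> > 0"
    "\<And>P. intervals_in K P \<Longrightarrow> len_sum P < \<delta> \<Longrightarrow> osc_sum P u < \<epsilon>"
proof -
  have "\<exists>\<delta>>0. \<forall>P. intervals_in K P \<and> len_sum P < \<delta> \<longrightarrow> osc_sum P u < \<epsilon>"
    using assms unfolding abs_cont_on_def intervals_in_def conj_assoc by simp
  then show thesis using that by blast
qed

lemma abs_cont_onI:
  assumes "\<And>\<epsilon>. \<epsilon> > 0 \<Longrightarrow> \<exists>\<delta>>0. \<forall>P. intervals_in K P \<longrightarrow> len_sum P < \<delta> \<longrightarrow> osc_sum P u < \<epsilon>"
  shows "abs_cont_on K u"
  using assms unfolding abs_cont_on_def intervals_in_def imp_conjL by simp

lemma disjoint_family_onI:
  assumes "\<And>x y. x \<in> I \<Longrightarrow> y \<in> I \<Longrightarrow> x \<noteq> y \<Longrightarrow> A x \<inter> A y = {}"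
  shows "disjoint_family_on A I"
  using assms unfolding disjoint_family_on_def by blast

text \<open>
  Almost all of \<open>E\<close> is covered by disjoint intervals of slope below \<open>r\<close>, and inside these by intervals of
  slope above \<open>s\<close>. The gaps have small total length, so by absolute continuity \<open>u\<close> changes little on them.
\<close>

lemma oscillating_slopes_null:
  fixes u :: "real \<Rightarrow> real"
  assumes ac: "abs_cont_on {a..b} u" and E: "E \<in> lmeasurable" "E \<subseteq> {a<..<b}" and rs: "r < s"
    and lo: "E \<subseteq> steep (\<lambda>x. - u x) (- r)" and up: "E \<subseteq> steep u s"
  shows "measure lebesgue E = 0"
proof (rule ccontr)
  define e where "e = measure lebesgue E"
  assume "measure lebesgue E \<noteq> 0"
  then have e: "e > 0" by (simp add: e_def zero_less_measure_iff)
  \<comment> \<open>The final comparison bounds \<open>(s - r) * (L - N)\<close> above by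
    \<open>2 * \<epsilon>\<close> and below by \<open>(s - r) * (e / 2)\<close>, which is
    \<open>4 * \<epsilon>\<close>.\<close>
  define \<epsilon> where "\<epsilon> = (s - r) * e / 8"
  have \<epsilon>: "\<epsilon> > 0" using e rs by (simp add: \<epsilon>_def)
  obtain \<delta> where \<delta>: "\<delta> > 0" "\<And>P. intervals_in {a..b} P \<Longrightarrow> len_sum P < \<delta> \<Longrightarrow> osc_sum P u < \<epsilon>"
    using abs_cont_onD[OF ac \<epsilon>] by blast
  \<comment> \<open>Three demands: gaps of total length below \<open>\<theta>\<close> are short
    enough for absolute continuity, they leave at least half of the measure \<open>e\<close>, and
    weighting them by the slope \<open>r\<close> costs at most \<open>\<epsilon>\<close>.\<close>
  define \<theta> where "\<theta> = min (\<delta> / 2) (min (e / 4) (\<epsilon> / (\<bar>r\<bar> + 1)))"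
  have \<theta>: "\<theta> > 0" "\<theta> < \<delta>" "\<theta> \<le> e / 4" "\<bar>r\<bar> * \<theta> \<le> \<epsilon>"
  proof -
    show "\<theta> > 0" "\<theta> < \<delta>" using e \<epsilon> \<delta> by (auto simp: \<theta>_def)
    show "\<theta> \<le> e / 4" unfolding \<theta>_def by (metis min.cobounded1 min.cobounded2 order_trans)
    have "\<bar>r\<bar> * \<theta> \<le> (\<bar>r\<bar> + 1) * (\<epsilon> / (\<bar>r\<bar> + 1))"
      using \<open>\<theta> > 0\<close> by (intro mult_mono) (auto simp: \<theta>_def)
    then show "\<bar>r\<bar> * \<theta> \<le> \<epsilon>" by simp
  qed
  obtain G' where G': "open G'" "E \<subseteq> G'" "G' - E \<in> lmeasurable" "emeasure lebesgue (G' - E) < ennreal (\<theta> / 2)"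
    using sets_lebesgue_outer_open[of E "\<theta> / 2"] E \<theta> by auto
  define G where "G = G' \<inter> {a<..<b}"
  have G: "open G" "E \<subseteq> G" "G \<subseteq> {a<..<b}" using G' E by (auto simp: G_def)
  have GE: "G - E \<in> lmeasurable" "measure lebesgue (G - E) < \<theta> / 2"
  proof -
    have Gl: "G \<in> lmeasurable"
      using lmeasurable_open[OF bounded_subset[OF bounded_box[of a b]] G(1)] G(3) by (simp add: box_real)
    then show "G - E \<in> lmeasurable" using E by (intro fmeasurable_Diff) auto
    have "measure lebesgue (G' - E) < \<theta> / 2"
      using G'(3,4) by (simp add: emeasure_eq_measure2 ennreal_less_iff)
    moreover have "measure lebesgue (G - E) \<le> measure lebesgue (G' - E)"
      using G' Gl E by (intro measure_mono_fmeasurable) (auto simp: G_def)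
    ultimately show "measure lebesgue (G - E) < \<theta> / 2" by simp
  qed
  have steepD: "\<exists>p q. p < x \<and> x < q \<and> q - p < d \<and> u q - u p < r * (q - p)" if "x \<in> E" "d > 0" for x d
  proof -
    have "\<exists>p q. p < x \<and> x < q \<and> q - p < d \<and> - u q - - u p > - r * (q - p)"
      using lo that unfolding steep_def by blast
    then show ?thesis by (elim ex_forward) auto
  qed
  obtain F where F: "finite F"
    "\<And>p q. (p, q) \<in> F \<Longrightarrow> p < q \<and> u q - u p < r * (q - p) \<and> {p..q} \<subseteq> G"
    "disjoint_family_on (\<lambda>(p, q). {p..q}) F"
    "e - \<theta> / 4 < (\<Sum>(p, q)\<in>F. measure lebesgue (E \<inter> {p..q}))"
    using vitali_finite[OF E(1) G(1,2), of "\<theta> / 4" "\<lambda>p q. u q - u p < r * (q - p)"] steepD \<theta>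
    unfolding e_def by auto
  \<comment> \<open>One share of the error for each interval of \<open>F\<close>, so that all shares
    sum to at most \<open>\<theta> / 4\<close>.\<close>
  define \<eta> where "\<eta> = \<theta> / 4 / (card F + 1)"
  have \<eta>: "\<eta> > 0" "card F * \<eta> \<le> \<theta> / 4" using \<theta> by (auto simp: \<eta>_def field_simps)
  have "\<exists>Q. intervals_in {fst i..snd i} Q \<and>
    len_sum Q < (snd i - fst i) - measure lebesgue (E \<inter> {fst i..snd i}) + \<eta> \<and>
    u (snd i) - u (fst i) \<ge> s * ((snd i - fst i) - len_sum Q) + inc_sum Q u"
    if "i \<in> F" for i
    using that F(2)[of "fst i" "snd i"] by (intro steep_subintervals E \<eta> up) auto
  then obtain Q where Qall: "intervals_in {fst i..snd i} (Q i)"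
    "len_sum (Q i) < (snd i - fst i) - measure lebesgue (E \<inter> {fst i..snd i}) + \<eta>"
    "u (snd i) - u (fst i) \<ge> s * ((snd i - fst i) - len_sum (Q i)) + inc_sum (Q i) u"
    if "i \<in> F" for i by metis
  have Q: "finite (Q i)" "\<And>p q. (p, q) \<in> Q i \<Longrightarrow> fst i \<le> p \<and> p \<le> q \<and> q \<le> snd i"
    "disjoint_family_on (\<lambda>(p, q). {p<..<q}) (Q i)" if "i \<in> F" for i
    using Qall(1)[OF that] by (auto simp: intervals_in_def)
  have Fdisj: "{fst i..snd i} \<inter> {fst j..snd j} = {}" if "i \<in> F" "j \<in> F" "i \<noteq> j" for i j
    using disjoint_family_onD[OF F(3) that] by (simp add: case_prod_unfold)
  have Qdisj: "Q i \<inter> Q j = {}" if ij: "i \<in> F" "j \<in> F" "i \<noteq> j" for i j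
  proof -
    have False if "(p, q) \<in> Q i" "(p, q) \<in> Q j" for p q
    proof -
      have "p \<in> {fst i..snd i} \<inter> {fst j..snd j}"
        using Q(2)[OF ij(1) that(1)] Q(2)[OF ij(2) that(2)] by auto
      then show False using Fdisj[OF ij] by blast
    qed
    then show ?thesis by auto
  qed
  have sumQ: "(\<Sum>x\<in>(\<Union>i\<in>F. Q i). g x) = (\<Sum>i\<in>F. \<Sum>x\<in>Q i. g x)" for g :: "real \<times> real \<Rightarrow> real"
    using F(1) Q(1) Qdisj by (intro sum.UNION_disjoint) auto
  \<comment> \<open>\<open>L\<close> is the total length of the outer intervals, \<open>M\<close>
    the measure of \<open>E\<close> inside them, and \<open>N\<close> the total length of the gaps
    left by the inner, steep intervals.\<close>
  define L where "L = (\<Sum>i\<in>F. snd i - fst i)"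
  define M where "M = (\<Sum>i\<in>F. measure lebesgue (E \<inter> {fst i..snd i}))"
  define N where "N = (\<Sum>i\<in>F. \<Sum>(p, q)\<in>Q i. q - p)"
  have sub: "{fst i..snd i} \<subseteq> G" if "i \<in> F" for i
    using F(2)[of "fst i" "snd i"] that by simp
  \<comment> \<open>\<open>L - M\<close> measures the part of the outer intervals outside
    \<open>E\<close>, which lies in the small set \<open>G - E\<close>.\<close>
  have LM: "L - M < \<theta> / 2"
  proof -
    have "L - M = (\<Sum>i\<in>F. measure lebesgue ({fst i..snd i} - E))"
      unfolding L_def M_def sum_subtractf[symmetric]
    proof (rule sum.cong)
      fix i assume "i \<in> F"
      then have "fst i < snd i" using F(2)[of "fst i" "snd i"] by simp
      have "{fst i..snd i} - E = {fst i..snd i} - E \<inter> {fst i..snd i}" by blast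
      then have "measure lebesgue ({fst i..snd i} - E) = measure lebesgue {fst i..snd i} - measure lebesgue (E \<inter> {fst i..snd i})"
        by (metis E(1) Int_lower2 fmeasurableD lmeasurable_interval(1) box_real(2) measurable_measure_Diff sets.Int)
      then show "snd i - fst i - measure lebesgue (E \<inter> {fst i..snd i}) = measure lebesgue ({fst i..snd i} - E)"
        using \<open>fst i < snd i\<close> by simp
    qed simp
    also have "\<dots> = measure lebesgue (\<Union>i\<in>F. {fst i..snd i} - E)"
    proof (rule measure_finite_Union[symmetric])
      show "disjoint_family_on (\<lambda>i. {fst i..snd i} - E) F"
        unfolding disjoint_family_on_def using Fdisj by blast
      show "emeasure lebesgue ({fst i..snd i} - E) \<noteq> \<infinity>" for i
        using E fmeasurableD2[OF fmeasurable_Diff[of "{fst i..snd i}" lebesgue E]] by auto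
    qed (use F E in auto)
    also have "\<dots> \<le> measure lebesgue (G - E)"
    proof (rule measure_mono_fmeasurable)
      show "(\<Union>i\<in>F. {fst i..snd i} - E) \<subseteq> G - E" using sub by blast
      show "(\<Union>i\<in>F. {fst i..snd i} - E) \<in> sets lebesgue"
        using F(1) fmeasurableD[OF E(1)] by (intro sets.finite_UN) auto
    qed (rule GE)
    finally show ?thesis using GE by simp
  qed
  have Ml: "M > e - \<theta> / 4" using F(4) by (simp add: M_def case_prod_unfold)
  have NL: "N \<le> L - M + \<theta> / 4"
  proof -
    have "N \<le> (\<Sum>i\<in>F. (snd i - fst i) - measure lebesgue (E \<inter> {fst i..snd i}) + \<eta>)"
      unfolding N_def using Qall(2) by (intro sum_mono) fastforce
    also have "\<dots> = L - M + card F * \<eta>"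
      by (simp add: L_def M_def sum_subtractf sum.distrib)
    finally show ?thesis using \<eta> by simp
  qed
  have Nlt: "N < \<theta>" using NL LM \<theta> by simp
  have "0 \<le> N" unfolding N_def using Q(2) by (intro sum_nonneg) auto
  have gapsmall: "osc_sum (\<Union>i\<in>F. Q i) u < \<epsilon>"
  proof (rule \<delta>(2), rule intervals_inI)
    show "finite (\<Union>i\<in>F. Q i)" using F Q by auto
    show "p \<in> {a..b} \<and> q \<in> {a..b} \<and> p \<le> q" if "(p, q) \<in> (\<Union>i\<in>F. Q i)" for p q
    proof -
      from that obtain i where i: "i \<in> F" "(p, q) \<in> Q i" by auto
      note q = Q(2)[OF i]
      have "p \<in> {fst i..snd i}" "q \<in> {fst i..snd i}" using q by auto
      then have "p \<in> G" "q \<in> G" using sub[OF i(1)] by blast+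
      then show ?thesis using G(3) q by auto
    qed
    show "disjoint_family_on (\<lambda>(p, q). {p<..<q}) (\<Union>i\<in>F. Q i)"
    proof (rule disjoint_family_onI)
      fix x y assume "x \<in> (\<Union>i\<in>F. Q i)" "y \<in> (\<Union>i\<in>F. Q i)" and xy: "x \<noteq> y"
      then obtain i j where ij: "i \<in> F" "j \<in> F" "x \<in> Q i" "y \<in> Q j" by auto
      obtain p q p' q' where pq: "x = (p, q)" "y = (p', q')" by fastforce
      show "(case x of (p, q) \<Rightarrow> {p<..<q}) \<inter> (case y of (p, q) \<Rightarrow> {p<..<q}) = {}"
      proof (cases "i = j")
        case True
        then show ?thesis using disjoint_family_onD[OF Q(3)[OF ij(1)], of x y] ij xy by auto
      next
        case False
        have "{p<..<q} \<subseteq> {fst i..snd i}" "{p'<..<q'} \<subseteq> {fst j..snd j}"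
          using Q(2)[OF ij(1), of p q] Q(2)[OF ij(2), of p' q'] ij pq by auto
        then have "{p<..<q} \<inter> {p'<..<q'} = {}" using Fdisj[OF ij(1,2) False] by blast
        then show ?thesis unfolding pq case_prod_conv .
      qed
    qed
    show "len_sum (\<Union>i\<in>F. Q i) < \<delta>" using Nlt \<theta> by (simp add: sumQ N_def)
  qed
  \<comment> \<open>The increment over the outer intervals is computed twice: the inner slopes force
    it up to nearly \<open>s * (L - N)\<close>, the outer slopes keep it below
    \<open>r * L\<close>.\<close>
  have "s * (L - N) - \<epsilon> \<le> (\<Sum>i\<in>F. u (snd i) - u (fst i))"
  proof -
    have "- \<epsilon> \<le> inc_sum (\<Union>i\<in>F. Q i) u"
    proof -
      have "\<bar>\<Sum>(p, q)\<in>(\<Union>i\<in>F. Q i). u q - u p\<bar> \<le> osc_sum (\<Union>i\<in>F. Q i) u"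
        unfolding case_prod_unfold by (rule sum_abs)
      then show ?thesis using gapsmall by linarith
    qed
    then have "s * (L - N) - \<epsilon> \<le> (\<Sum>i\<in>F. s * ((snd i - fst i) - len_sum (Q i)) + inc_sum (Q i) u)"
      by (simp add: L_def N_def sum.distrib sumQ sum_subtractf flip: sum_distrib_left)
    also have "\<dots> \<le> (\<Sum>i\<in>F. u (snd i) - u (fst i))" using Qall(3) by (intro sum_mono)
    finally show ?thesis .
  qed
  also have "\<dots> \<le> (\<Sum>i\<in>F. r * (snd i - fst i))"
    using F(2) by (intro sum_mono) (metis less_eq_real_def prod.collapse)
  also have "\<dots> = r * L" by (simp add: L_def sum_distrib_left)
  finally have 1: "s * (L - N) - \<epsilon> \<le> r * L" .
  have "r * N \<le> \<bar>r\<bar> * \<theta>" using Nlt \<open>0 \<le> N\<close>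
    by (intro mult_mono) auto
  then have "(s - r) * (L - N) \<le> 2 * \<epsilon>" using 1 \<theta>(4) by (simp add: algebra_simps)
  moreover have "L - N \<ge> M - \<theta> / 4" using NL by simp
  then have "L - N \<ge> e / 2" using Ml \<theta> by linarith
  then have "(s - r) * (L - N) \<ge> (s - r) * (e / 2)" using rs by (intro mult_left_mono) auto
  moreover have "(s - r) * (e / 2) = 4 * \<epsilon>" by (simp add: \<epsilon>_def)
  ultimately show False using \<epsilon> by linarith
qed

text \<open>Disjoint intervals of slope above \<open>n\<close> that keep half of the measure
  \<open>e\<close> of \<open>E\<close> have increments summing to more than
  \<open>n * e / 2\<close>, hence to more than 1 for large \<open>n\<close>. Inside an interval
  shorter than \<open>\<delta>\<close>, absolute continuity forbids this.\<close>

lemma infinite_slopes_null_small: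
  fixes u :: "real \<Rightarrow> real"
  assumes \<delta>: "\<And>P. intervals_in {a..b} P \<Longrightarrow> len_sum P < \<delta> \<Longrightarrow> osc_sum P u < 1"
    and E: "E \<in> lmeasurable" "E \<subseteq> {c<..<d}" "a \<le> c" "c < d" "d \<le> b" "d - c < \<delta>"
    and up: "E \<subseteq> (\<Inter>n::nat. steep u n)"
  shows "measure lebesgue E = 0"
proof (rule ccontr)
  define e where "e = measure lebesgue E"
  assume "measure lebesgue E \<noteq> 0"
  then have e: "e > 0" by (simp add: e_def zero_less_measure_iff)
  obtain n :: nat where n: "real n > 2 / e" using reals_Archimedean2 by blast
  have steepD: "\<exists>p q. p < x \<and> x < q \<and> q - p < d \<and> u q - u p > real n * (q - p)" if "x \<in> E" "d > 0" for x d
    using up that unfolding steep_def by blast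
  obtain F where F: "finite F"
    "\<And>p q. (p, q) \<in> F \<Longrightarrow> p < q \<and> u q - u p > real n * (q - p) \<and> {p..q} \<subseteq> {c<..<d}"
    "disjoint_family_on (\<lambda>(p, q). {p..q}) F"
    "e - e / 2 < (\<Sum>(p, q)\<in>F. measure lebesgue (E \<inter> {p..q}))"
    using vitali_finite[OF E(1) _ E(2), of "e / 2" "\<lambda>p q. u q - u p > real n * (q - p)"] steepD e
    unfolding e_def by auto
  have F2: "c \<le> p \<and> p < q \<and> q \<le> d" if "(p, q) \<in> F" for p q
    using F(2)[OF that] by (metis atLeastAtMost_iff greaterThanLessThan_iff less_eq_real_def order_refl subsetD)
  have "osc_sum F u < 1"
  proof (rule \<delta>, rule intervals_inI)
    show "p \<in> {a..b} \<and> q \<in> {a..b} \<and> p \<le> q" if "(p, q) \<in> F" for p q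
      using F2[OF that] E by auto
    show "disjoint_family_on (\<lambda>(p, q). {p<..<q}) F"
      using F(3) unfolding disjoint_family_on_def by fastforce
    \<comment> \<open>The gaps enter only to show that the lengths in \<open>F\<close> sum to at
      most \<open>d - c\<close>.\<close>
    obtain Q where Q: "intervals_in {c..d} Q"
      "\<And>g::real \<Rightarrow> real. inc_sum F g + inc_sum Q g = g d - g c"
      using interval_gaps[OF F(1) F2 F(3)] E by auto
    have "len_sum Q \<ge> 0" using Q(1) by (intro sum_nonneg) (auto simp: intervals_in_def)
    then show "len_sum F < \<delta>" using Q(2)[of "\<lambda>x. x"] E by linarith
  qed (use F in auto)
  moreover have "osc_sum F u \<ge> n * len_sum F"
    unfolding sum_distrib_left case_prod_unfold using F(2) by (intro sum_mono) fastforce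
  moreover have "(\<Sum>(p, q)\<in>F. measure lebesgue (E \<inter> {p..q})) \<le> len_sum F"
  proof (rule sum_mono, clarify)
    fix p q assume "(p, q) \<in> F"
    have "measure lebesgue (E \<inter> {p..q}) \<le> measure lebesgue {p..q}"
      using E by (intro measure_mono_fmeasurable) auto
    then show "measure lebesgue (E \<inter> {p..q}) \<le> q - p"
      using F2[OF \<open>(p, q) \<in> F\<close>] by auto
  qed
  then have "real n * (e / 2) \<le> real n * len_sum F"
    using F(4) by (intro mult_left_mono) linarith+
  moreover have "real n * (e / 2) > 1" using n e by (simp add: field_simps)
  ultimately show False by linarith
qed

text \<open>The preceding bound works on short intervals, so negligibility is shown in a window of
  length \<open>\<delta> / 2\<close> around each point and then glued.\<close>

lemma infinite_slopes_null:
  fixes u :: "real \<Rightarrow> real"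
  assumes ac: "abs_cont_on {a..b} u" and E: "E \<in> sets lebesgue" "E \<subseteq> {a<..<b}"
    and up: "E \<subseteq> (\<Inter>n::nat. steep u n)"
  shows "negligible E"
proof (cases "a < b")
  case False
  then show ?thesis using E by simp
next
  case ab: True
  obtain \<delta> where \<delta>: "\<delta> > 0" "\<And>P. intervals_in {a..b} P \<Longrightarrow> len_sum P < \<delta> \<Longrightarrow> osc_sum P u < 1"
    using abs_cont_onD[OF ac zero_less_one] by blast
  have loc: "negligible (E \<inter> {c<..<d})" if "c < d" "a \<le> c" "d \<le> b" "d - c < \<delta>" for c d
  proof -
    have lm: "E \<inter> {c<..<d} \<in> lmeasurable"
      using E by (metis fmeasurable_Int_fmeasurable inf_commute lmeasurable_interval(2) box_real(1))
    have "measure lebesgue (E \<inter> {c<..<d}) = 0"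
      by (rule infinite_slopes_null_small[OF \<delta>(2) lm]) (use that up in auto)
    then show ?thesis using lm by (simp add: negligible_iff_measure)
  qed
  have "negligible (E \<inter> {x - \<delta> / 4<..<x + \<delta> / 4})" for x
  proof -
    have "negligible (E \<inter> {max a (x - \<delta> / 4)<..<min b (x + \<delta> / 4)})"
    proof (cases "max a (x - \<delta> / 4) < min b (x + \<delta> / 4)")
      case True
      then show ?thesis using \<delta> by (intro loc) auto
    next
      case False
      then have "{max a (x - \<delta> / 4)<..<min b (x + \<delta> / 4)} = {}"
        by (intro greaterThanLessThan_empty) (simp only: not_less)
      then show ?thesis by (simp only: Int_empty_right negligible_empty)
    qed
    moreover have "E \<inter> {x - \<delta> / 4<..<x + \<delta> / 4} \<subseteq> E \<inter> {max a (x - \<delta> / 4)<..<min b (x + \<delta> / 4)}"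
      using E by auto
    ultimately show ?thesis using negligible_subset by blast
  qed
  moreover have "openin (top_of_set E) (E \<inter> {x - \<delta> / 4<..<x + \<delta> / 4})" for x
    by (intro openin_open_Int) simp
  ultimately have "\<exists>U. openin (top_of_set E) U \<and> x \<in> U \<and> negligible U" if "x \<in> E" for x
    using that \<delta>(1) by (intro exI[of _ "E \<inter> {x - \<delta> / 4<..<x + \<delta> / 4}"]) auto
  then show ?thesis using locally_negligible_alt by blast
qed

lemma steep_borel: "steep u c \<in> sets borel"
proof -
  have "steep u c = (\<Inter>n::nat. \<Union>{{p<..<q} | p q. q - p < 1 / Suc n \<and> u q - u p > c * (q - p)})"
  proof (intro equalityI subsetI)
    fix x assume "x \<in> steep u c"
    then have *: "\<exists>p q. p < x \<and> x < q \<and> q - p < d \<and> u q - u p > c * (q - p)" if "d > 0" for d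
      using that unfolding steep_def by blast
    show "x \<in> (\<Inter>n::nat. \<Union>{{p<..<q} | p q. q - p < 1 / Suc n \<and> u q - u p > c * (q - p)})"
    proof
      fix n :: nat
      obtain p q where "p < x" "x < q" "q - p < 1 / Suc n" "u q - u p > c * (q - p)"
        using *[of "1 / Suc n"] by auto
      then have "x \<in> {p<..<q} \<and> {p<..<q} \<in> {{p<..<q} | p q. q - p < 1 / Suc n \<and> u q - u p > c * (q - p)}"
        by simp blast
      then show "x \<in> \<Union>{{p<..<q} | p q. q - p < 1 / Suc n \<and> u q - u p > c * (q - p)}" by blast
    qed
  next
    fix x assume x: "x \<in> (\<Inter>n::nat. \<Union>{{p<..<q} | p q. q - p < 1 / Suc n \<and> u q - u p > c * (q - p)})"
    show "x \<in> steep u c"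
      unfolding steep_def
    proof (intro CollectI allI impI)
      fix d :: real assume "d > 0"
      then obtain n :: nat where n: "1 / Suc n < d" by (metis nat_approx_posE)
      from x have "x \<in> \<Union>{{p<..<q} | p q. q - p < 1 / Suc n \<and> u q - u p > c * (q - p)}" by blast
      then obtain p q where "x \<in> {p<..<q}" "q - p < 1 / Suc n" "u q - u p > c * (q - p)" by blast
      then show "\<exists>p q. p < x \<and> x < q \<and> q - p < d \<and> u q - u p > c * (q - p)"
        using n by (intro exI[of _ p] exI[of _ q]) auto
    qed
  qed
  moreover have "open (\<Union>{{p<..<q} | p q. q - p < 1 / Suc n \<and> u q - u p > c * (q - p)})" for n
    by (intro open_Union) auto
  ultimately show ?thesis by (auto intro!: borel_open)
qed

lemma steep_antimono:
  assumes "c \<le> c'" "x \<in> steep u c'"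
  shows "x \<in> steep u c"
  unfolding steep_def
proof (intro CollectI allI impI)
  fix d :: real assume "d > 0"
  then obtain p q where pq: "p < x" "x < q" "q - p < d" "u q - u p > c' * (q - p)"
    using assms unfolding steep_def by blast
  moreover have "c * (q - p) \<le> c' * (q - p)" using assms pq by (intro mult_right_mono) auto
  ultimately show "\<exists>p q. p < x \<and> x < q \<and> q - p < d \<and> u q - u p > c * (q - p)"
    using le_less_trans by blast
qed

lemma not_steepD:
  assumes "x \<notin> steep u c"
  shows "\<exists>d>0. \<forall>p q. p < x \<longrightarrow> x < q \<longrightarrow> q - p < d \<longrightarrow> u q - u p \<le> c * (q - p)"
proof -
  have "\<exists>d>0. \<forall>p q. p < x \<longrightarrow> x < q \<longrightarrow> q - p < d \<longrightarrow> \<not> c * (q - p) < u q - u p"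
    using assms unfolding steep_def by blast
  then show ?thesis by (simp only: not_less)
qed

text \<open>The derivative is the upper limit \<open>L\<close> of the slopes over intervals
  straddling \<open>x\<close>. It is finite by \<open>fin\<close>, and by \<open>osc\<close> the
  slopes cannot keep returning below any number less than \<open>L\<close>. Asking this only for
  rational thresholds keeps the exceptional set a countable union.\<close>

lemma differentiable_if_not_steep:
  fixes u :: "real \<Rightarrow> real"
  assumes cont: "isCont u x"
    and fin: "x \<notin> steep u c1" "x \<notin> steep (\<lambda>x. - u x) c2"
    and osc: "\<And>r s. r \<in> \<rat> \<Longrightarrow> s \<in> \<rat> \<Longrightarrow> r < s \<Longrightarrow> x \<in> steep u s \<Longrightarrow> x \<notin> steep (\<lambda>x. - u x) (- r)"
  shows "u differentiable (at x)"
proof -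
  define S where "S = {c. x \<in> steep u c}"
  have ub: "c \<le> c1" if "c \<in> S" for c
    using that fin(1) steep_antimono[of c1 c x u] unfolding S_def by force
  \<comment> \<open>Otherwise the slopes near \<open>x\<close> would be at most
    \<open>- c2 - 1\<close>, while \<open>fin\<close> keeps them at or above \<open>- c2\<close>; a
    symmetric interval around \<open>x\<close> shows the contradiction.\<close>
  have ne: "S \<noteq> {}"
  proof
    assume "S = {}"
    then have "x \<notin> steep u (- c2 - 1)" by (auto simp: S_def)
    then obtain d where d: "d > 0" "\<And>p q. p < x \<Longrightarrow> x < q \<Longrightarrow> q - p < d \<Longrightarrow> u q - u p \<le> (- c2 - 1) * (q - p)"
      using not_steepD by blast
    obtain d' where d': "d' > 0" "\<And>p q. p < x \<Longrightarrow> x < q \<Longrightarrow> q - p < d' \<Longrightarrow> - u q - - u p \<le> c2 * (q - p)"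
      using not_steepD[OF fin(2)] by blast
    define t where "t = min d d' / 4"
    have t: "t > 0" "2 * t < d" "2 * t < d'" using d d' by (auto simp: t_def)
    have "u (x + t) - u (x - t) \<le> (- c2 - 1) * (x + t - (x - t))"
         "- u (x + t) - - u (x - t) \<le> c2 * (x + t - (x - t))"
      using t by (intro d d'; simp)+
    then show False using t by (simp add: algebra_simps)
  qed
  have bdd: "bdd_above S" using ub by (auto simp: bdd_above_def)
  define L where "L = Sup S"
  have slopes: "\<exists>d>0. \<forall>p q. p < x \<longrightarrow> x < q \<longrightarrow> q - p < d \<longrightarrow> \<bar>u q - u p - L * (q - p)\<bar> \<le> \<epsilon> * (q - p)"
    if \<epsilon>: "\<epsilon> > 0" for \<epsilon>
  proof -
    have "x \<notin> steep u (L + \<epsilon>)"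
      using cSup_upper[OF _ bdd, of "L + \<epsilon>"] \<epsilon> unfolding S_def[symmetric] L_def[symmetric]
      by (auto simp: S_def)
    then obtain d where d: "d > 0" "\<And>p q. p < x \<Longrightarrow> x < q \<Longrightarrow> q - p < d \<Longrightarrow> u q - u p \<le> (L + \<epsilon>) * (q - p)"
      using not_steepD by blast
    \<comment> \<open>Slopes above \<open>s\<close> recur. Two rationals between
      \<open>L - \<epsilon>\<close> and \<open>s\<close> feed \<open>osc\<close>, which then gives
      the lower bound for all short intervals.\<close>
    obtain s where s: "s \<in> S" "L - \<epsilon> < s"
      using less_cSup_iff[OF ne bdd, of "L - \<epsilon>"] \<epsilon> by (auto simp: L_def)
    obtain r' where r': "r' \<in> \<rat>" "L - \<epsilon> < r'" "r' < s" using Rats_dense_in_real[OF s(2)] by auto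
    obtain s' where s': "s' \<in> \<rat>" "r' < s'" "s' < s" using Rats_dense_in_real[OF r'(3)] by auto
    have "x \<in> steep u s'" using steep_antimono[of s' s x u] s s' by (auto simp: S_def)
    then have "x \<notin> steep (\<lambda>x. - u x) (- r')" using osc r' s' by blast
    then obtain d' where d': "d' > 0" "\<And>p q. p < x \<Longrightarrow> x < q \<Longrightarrow> q - p < d' \<Longrightarrow> - u q - - u p \<le> - r' * (q - p)"
      using not_steepD by blast
    have "\<bar>u q - u p - L * (q - p)\<bar> \<le> \<epsilon> * (q - p)" if "p < x" "x < q" "q - p < min d d'" for p q
    proof -
      have "u q - u p \<le> (L + \<epsilon>) * (q - p)" using d that by auto
      moreover have "- u q - - u p \<le> - r' * (q - p)" using that by (intro d') auto
      moreover have "(L - \<epsilon>) * (q - p) \<le> r' * (q - p)" using r' that by (intro mult_right_mono) auto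
      ultimately show ?thesis by (auto simp: algebra_simps abs_le_iff)
    qed
    then show ?thesis using d(1) d'(1) by (intro exI[of _ "min d d'"]) auto
  qed
  have "(u has_derivative (\<lambda>h. L * h)) (at x)"
    unfolding has_derivative_at_alt
  proof (intro conjI allI impI)
    show "bounded_linear ((*) L)" by (rule bounded_linear_mult_right)
    fix \<epsilon> :: real assume \<epsilon>: "0 < \<epsilon>"
    obtain d where d: "d > 0" "\<And>p q. p < x \<Longrightarrow> x < q \<Longrightarrow> q - p < d \<Longrightarrow> \<bar>u q - u p - L * (q - p)\<bar> \<le> \<epsilon> * (q - p)"
      using slopes[OF \<epsilon>] by blast
    have tl: "(u \<longlongrightarrow> u x) (at x within A)" for A
      using cont at_le[of A UNIV x] tendsto_mono unfolding isCont_def by blast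
    \<comment> \<open>Letting the left endpoint of a straddling interval tend to \<open>x\<close>,
      continuity turns straddling slopes into difference quotients at \<open>x\<close>.\<close>
    have right: "\<bar>u q - u x - L * (q - x)\<bar> \<le> \<epsilon> * (q - x)" if q: "x < q" "q - x < d / 2" for q
    proof -
      have "((\<lambda>p. \<epsilon> * (q - p) - \<bar>u q - u p - L * (q - p)\<bar>) \<longlongrightarrow> \<epsilon> * (q - x) - \<bar>u q - u x - L * (q - x)\<bar>) (at_left x)"
        by (intro tendsto_intros tl)
      moreover have "\<forall>\<^sub>F p in at_left x. x - d / 2 < p" using d by (intro eventually_at_leftI[of "x - d/2"]) auto
      then have "\<forall>\<^sub>F p in at_left x. 0 \<le> \<epsilon> * (q - p) - \<bar>u q - u p - L * (q - p)\<bar>"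
        using eventually_at_leftI[of "x - 1" x "\<lambda>p. p < x", simplified]
      proof eventually_elim
        case (elim p)
        then show ?case using d(2)[of p q] q by auto
      qed
      ultimately have "0 \<le> \<epsilon> * (q - x) - \<bar>u q - u x - L * (q - x)\<bar>"
        by (intro tendsto_lowerbound) auto
      then show ?thesis by simp
    qed
    have left: "\<bar>u x - u p - L * (x - p)\<bar> \<le> \<epsilon> * (x - p)" if p: "p < x" "x - p < d / 2" for p
    proof -
      have "((\<lambda>q. \<epsilon> * (q - p) - \<bar>u q - u p - L * (q - p)\<bar>) \<longlongrightarrow> \<epsilon> * (x - p) - \<bar>u x - u p - L * (x - p)\<bar>) (at_right x)"
        by (intro tendsto_intros tl)
      moreover have "\<forall>\<^sub>F q in at_right x. q < x + d / 2" using d by (intro eventually_at_rightI[of _ "x + d/2"]) auto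
      then have "\<forall>\<^sub>F q in at_right x. 0 \<le> \<epsilon> * (q - p) - \<bar>u q - u p - L * (q - p)\<bar>"
        using eventually_at_right_less[of x]
      proof eventually_elim
        case (elim q)
        then show ?case using d(2)[of p q] p by auto
      qed
      ultimately have "0 \<le> \<epsilon> * (x - p) - \<bar>u x - u p - L * (x - p)\<bar>"
        by (intro tendsto_lowerbound) auto
      then show ?thesis by simp
    qed
    have "norm (u y - u x - L * (y - x)) \<le> \<epsilon> * norm (y - x)" if "norm (y - x) < d / 2" for y
    proof (cases y x rule: linorder_cases)
      case less
      have "norm (u y - u x - L * (y - x)) = \<bar>u x - u y - L * (x - y)\<bar>" by (simp add: algebra_simps abs_minus_commute)
      then show ?thesis using less left[of y] that by auto
    next
      case greater
      then show ?thesis using right[of y] that by auto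
    qed auto
    then show "\<exists>d>0. \<forall>y. norm (y - x) < d \<longrightarrow> norm (u y - u x - L * (y - x)) \<le> \<epsilon> * norm (y - x)"
      using d(1) by (intro exI[of _ "d / 2"]) auto
  qed
  then show ?thesis unfolding differentiable_def by blast
qed

lemma abs_cont_on_imp_continuous_on:
  assumes "abs_cont_on K u"
  shows "continuous_on K u"
  unfolding continuous_on_iff
proof (intro ballI allI impI)
  fix x \<epsilon> :: real assume x: "x \<in> K" and \<epsilon>: "\<epsilon> > 0"
  obtain \<delta> where \<delta>: "\<delta> > 0"
    "\<And>P. intervals_in K P \<Longrightarrow> len_sum P < \<delta> \<Longrightarrow> osc_sum P u < \<epsilon>"
    using abs_cont_onD[OF assms \<epsilon>] by blast
  have "dist (u y) (u x) < \<epsilon>" if "y \<in> K" "dist y x < \<delta>" for y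
  proof (cases "x \<le> y")
    case True
    then show ?thesis using \<delta>(2)[of "{(x, y)}"] x that
      by (simp add: intervals_in_def disjoint_family_on_def dist_real_def)
  next
    case False
    then show ?thesis using \<delta>(2)[of "{(y, x)}"] x that
      by (simp add: intervals_in_def disjoint_family_on_def dist_real_def abs_minus_commute)
  qed
  then show "\<exists>d>0. \<forall>y\<in>K. dist y x < d \<longrightarrow> dist (u y) (u x) < \<epsilon>" using \<delta>(1) by blast
qed

lemma abs_cont_on_uminus: "abs_cont_on K (\<lambda>x. - u x) = abs_cont_on K u"
  by (simp add: abs_cont_on_def abs_minus_commute)

text \<open>At an interior point differentiability can fail only because slopes oscillate across a
  rational gap (\<open>A\<close>) or are unbounded above (\<open>B u\<close>) or below
  (\<open>B\<close> for \<open>- u\<close>). Each of these sets is null by one of the two Vitali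
  arguments.\<close>

lemma abs_cont_on_differentiable_ae:
  assumes ac: "abs_cont_on {a..b} u"
  shows "negligible {x \<in> {a..b}. \<not> u differentiable (at x)}"
proof -
  let ?v = "\<lambda>x. - u x"
  have acv: "abs_cont_on {a..b} ?v" using ac by (simp add: abs_cont_on_uminus)
  let ?I = "{a<..<b}"
  define A where "A = (\<Union>(r, s)\<in>\<rat> \<times> \<rat>. if r < s then ?I \<inter> steep u s \<inter> steep ?v (- r) else {})"
  define B where "B = (\<lambda>w. ?I \<inter> (\<Inter>n::nat. steep w (real n)))"
  have lb: "steep w c \<in> sets lebesgue" for w c
    using steep_borel by (simp add: sets_completionI_sets)
  have nA: "negligible A"
    unfolding A_def
  proof (rule negligible_countable_Union)
    show "countable ((\<lambda>(r, s). if r < s then ?I \<inter> steep u s \<inter> steep ?v (- r) else {}) ` (\<rat> \<times> \<rat>))"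
      by (intro countable_image countable_SIGMA countable_rat)
    fix T assume "T \<in> (\<lambda>(r, s). if r < s then ?I \<inter> steep u s \<inter> steep ?v (- r) else {}) ` (\<rat> \<times> \<rat>)"
    then obtain r s where T: "T = (if r < s then ?I \<inter> steep u s \<inter> steep ?v (- r) else {})" by auto
    show "negligible T"
    proof (cases "r < s")
      case True
      have lm: "?I \<inter> (steep u s \<inter> steep ?v (- r)) \<in> lmeasurable"
        using lb by (intro fmeasurable_Int_fmeasurable sets.Int) auto
      have "measure lebesgue (?I \<inter> (steep u s \<inter> steep ?v (- r))) = 0"
      by (rule oscillating_slopes_null[OF ac lm _ True]) auto
      then show ?thesis using lm True unfolding T negligible_iff_measure by (simp add: Int_assoc)
    qed (simp add: T)
  qed
  have nB: "negligible (B w)" if "abs_cont_on {a..b} w" for w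
  proof (rule infinite_slopes_null[OF that])
    show "B w \<in> sets lebesgue" unfolding B_def using lb by (intro sets.Int sets.countable_INT) auto
    show "B w \<subseteq> {a<..<b}" by (auto simp: B_def)
    show "B w \<subseteq> (\<Inter>n::nat. steep w n)" by (auto simp: B_def)
  qed
  have cover: "x \<in> A \<union> B u \<union> B ?v \<union> {a, b}" if x: "x \<in> {a..b}" "\<not> u differentiable (at x)" for x
  proof (rule ccontr)
    assume c: "x \<notin> A \<union> B u \<union> B ?v \<union> {a, b}"
    then have xI: "x \<in> ?I" using x by auto
    have "continuous_on ?I u"
      using abs_cont_on_imp_continuous_on[OF ac] by (rule continuous_on_subset) auto
    then have cont: "isCont u x" using xI by (simp add: continuous_on_eq_continuous_at)
    obtain n1 n2 :: nat where "x \<notin> steep u n1" "x \<notin> steep ?v n2"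
      using c xI unfolding B_def by blast
    moreover have "x \<notin> steep ?v (- r)" if "r \<in> \<rat>" "s \<in> \<rat>" "r < s" "x \<in> steep u s" for r s
    proof
      assume "x \<in> steep ?v (- r)"
      then have "x \<in> A" unfolding A_def using that xI by (intro UN_I[of "(r, s)"]) auto
      then show False using c by blast
    qed
    ultimately show False using differentiable_if_not_steep[OF cont] x by blast
  qed
  have "negligible (A \<union> B u \<union> B ?v \<union> {a, b})"
    by (intro negligible_Un nA nB[OF ac] nB[OF acv] negligible_finite) simp
  then show ?thesis by (rule negligible_subset) (use cover in blast)
qed

subsection \<open>The fundamental theorem of calculus\<close>

text \<open>Made for the tags in a null set: a gauge can force their intervals into an open
  \<open>T\<close> of small measure. The intervals have disjoint interiors, so their lengths sum to
  at most the measure of \<open>T\<close>, and absolute continuity bounds the increments.\<close>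

lemma tagged_null_part_small:
  fixes u :: "real \<Rightarrow> real"
  assumes \<delta>: "\<And>P. intervals_in {a..b} P \<Longrightarrow> len_sum P < \<delta> \<Longrightarrow> osc_sum P u < \<epsilon>"
    and D: "D tagged_division_of {a..b}" and T: "T \<in> lmeasurable" "measure lebesgue T < \<delta>"
    and D': "D' \<subseteq> D" "\<And>x K. (x, K) \<in> D' \<Longrightarrow> K \<subseteq> T"
  shows "(\<Sum>(x, K)\<in>D'. \<bar>u (Sup K) - u (Inf K)\<bar>) < \<epsilon>"
proof -
  define ends where "ends = (\<lambda>(x::real, K::real set). (Inf K, Sup K))"
  \<comment> \<open>Degenerate intervals contribute nothing but may occur with several pairs having
    equal endpoints; without them, \<open>ends\<close> is injective.\<close>
  define C where "C = {z \<in> D'. fst (ends z) < snd (ends z)}"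
  have fin: "finite D" "finite D'" "finite C"
  proof -
    show D: "finite D" using D by auto
    show D': "finite D'" using D D'(1) finite_subset by blast
    then show "finite C" by (simp add: C_def)
  qed
  have K: "K = {Inf K..Sup K} \<and> Inf K \<le> Sup K \<and> K \<subseteq> {a..b}" if xK: "(x, K) \<in> D" for x K
  proof -
    obtain l r where lr: "K = cbox l r" using tagged_division_ofD(4)[OF D xK] by blast
    moreover have "x \<in> K" "K \<subseteq> {a..b}" using tagged_division_ofD(2,3)[OF D xK] by auto
    ultimately show ?thesis by auto
  qed
  have disj: "{Inf K<..<Sup K} \<inter> {Inf K'<..<Sup K'} = {}" if "(x, K) \<in> D" "(x', K') \<in> D" "(x, K) \<noteq> (x', K')" for x K x' K'
  proof -
    have "interior {Inf K..Sup K} \<inter> interior {Inf K'..Sup K'} = {}"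
      using tagged_division_ofD(5)[OF D that] K[OF that(1)] K[OF that(2)] by metis
    then show ?thesis by simp
  qed
  have inj: "inj_on ends C"
  proof (rule inj_onI)
    fix z z' assume zz: "z \<in> C" "z' \<in> C" "ends z = ends z'"
    obtain x K x' K' where z: "z = (x, K)" "z' = (x', K')" by fastforce
    show "z = z'"
    proof (rule ccontr)
      assume "z \<noteq> z'"
      then have "{Inf K<..<Sup K} \<inter> {Inf K'<..<Sup K'} = {}"
        using zz z D'(1) by (intro disj[of x K x' K']) (auto simp: C_def)
      moreover have "Inf K = Inf K'" "Sup K = Sup K'" "Inf K < Sup K" using zz z by (auto simp: ends_def C_def)
      ultimately show False by simp
    qed
  qed
  have mem: "\<exists>x K. (x, K) \<in> D \<and> p = Inf K \<and> q = Sup K \<and> K \<subseteq> T \<and> p < q" if "(p, q) \<in> ends ` C" for p q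
  proof -
    from that obtain z where z: "z \<in> C" "ends z = (p, q)" by auto
    obtain x K where xK: "z = (x, K)" by fastforce
    then have "(x, K) \<in> D'" "p = Inf K" "q = Sup K" "p < q" using z by (simp_all add: ends_def C_def)
    then show ?thesis using D' by blast
  qed
  have dis: "disjoint_family_on (\<lambda>(p, q). {p<..<q}) (ends ` C)"
  proof (rule disjoint_family_onI)
    fix y y' assume y: "y \<in> ends ` C" "y' \<in> ends ` C" "y \<noteq> y'"
    obtain p q p' q' where pq: "y = (p, q)" "y' = (p', q')" by fastforce
    obtain x K x' K' where "(x, K) \<in> D" "p = Inf K" "q = Sup K" "(x', K') \<in> D" "p' = Inf K'" "q' = Sup K'"
      using y pq mem by metis
    then show "(case y of (p, q) \<Rightarrow> {p<..<q}) \<inter> (case y' of (p, q) \<Rightarrow> {p<..<q}) = {}"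
      using disj[of x K x' K'] y pq by auto
  qed
  have "osc_sum (ends ` C) u < \<epsilon>"
  proof (rule \<delta>, rule intervals_inI)
    show "finite (ends ` C)" using fin by simp
    show "p \<in> {a..b} \<and> q \<in> {a..b} \<and> p \<le> q" if pq: "(p, q) \<in> ends ` C" for p q
    proof -
      obtain x K where xK: "(x, K) \<in> D" "p = Inf K" "q = Sup K" "p < q" using mem[OF pq] by blast
      then have "p \<in> K" "q \<in> K" using K[OF xK(1)] by (metis atLeastAtMost_iff order_refl)+
      then show ?thesis using K[OF xK(1)] xK by auto
    qed
    show "disjoint_family_on (\<lambda>(p, q). {p<..<q}) (ends ` C)" by fact
    have "len_sum (ends ` C) = (\<Sum>i\<in>ends ` C. measure lebesgue (case i of (p, q) \<Rightarrow> {p<..<q}))"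
      using mem by (intro sum.cong) force+
    also have "\<dots> = measure lebesgue (\<Union>i\<in>ends ` C. case i of (p, q) \<Rightarrow> {p<..<q})"
    proof (rule measure_finite_Union[symmetric])
      show "emeasure lebesgue (case i of (p, q) \<Rightarrow> {p<..<q}) \<noteq> \<infinity>" for i :: "real \<times> real"
        using fmeasurableD2[OF lmeasurable_interval(2)[of "fst i" "snd i"]] by (simp add: box_real case_prod_unfold)
    qed (use fin dis in \<open>auto simp: case_prod_unfold\<close>)
    also have "\<dots> \<le> measure lebesgue T"
    proof (rule measure_mono_fmeasurable)
      have "{p<..<q} \<subseteq> T" if pq: "(p, q) \<in> ends ` C" for p q
      proof -
        obtain x K where xK: "(x, K) \<in> D" "p = Inf K" "q = Sup K" "K \<subseteq> T" using mem[OF pq] by blast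
        then have "{p<..<q} \<subseteq> K" using K[OF xK(1)] by (metis greaterThanLessThan_subseteq_atLeastAtMost_iff order_refl)
        then show ?thesis using xK by blast
      qed
      then show "(\<Union>i\<in>ends ` C. case i of (p, q) \<Rightarrow> {p<..<q}) \<subseteq> T"
        by (intro UN_least) (metis case_prod_conv surj_pair)
    qed (use T fin in \<open>auto simp: case_prod_unfold\<close>)
    finally show "len_sum (ends ` C) < \<delta>" using T by simp
  qed
  moreover have "osc_sum (ends ` C) u = (\<Sum>(x, K)\<in>C. \<bar>u (Sup K) - u (Inf K)\<bar>)"
    using inj by (simp add: sum.reindex case_prod_unfold ends_def)
  moreover have "(\<Sum>(x, K)\<in>C. \<bar>u (Sup K) - u (Inf K)\<bar>) = (\<Sum>(x, K)\<in>D'. \<bar>u (Sup K) - u (Inf K)\<bar>)"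
  proof (rule sum.mono_neutral_left)
    show "\<forall>i\<in>D' - C. (case i of (x, K) \<Rightarrow> \<bar>u (Sup K) - u (Inf K)\<bar>) = 0"
    proof
      fix i assume i: "i \<in> D' - C"
      obtain x K where xK: "i = (x, K)" by fastforce
      then have "Inf K = Sup K" using i K[of x K] D'(1) by (auto simp: C_def ends_def)
      then show "(case i of (x, K) \<Rightarrow> \<bar>u (Sup K) - u (Inf K)\<bar>) = 0" using xK by simp
    qed
  qed (use fin in \<open>auto simp: C_def\<close>)
  ultimately show ?thesis by simp
qed

text \<open>The gauge integral delivers integrability and value at once. At points of
  nondifferentiability the gauge is an open set of small measure, elsewhere a ball on which the
  derivative approximates increments with relative error \<open>\<epsilon>\<close>; Riemann sums are
  then compared with the telescoping sum of increments.\<close>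

theorem abs_cont_on_ftc:
  fixes u :: "real \<Rightarrow> real"
  assumes ac: "abs_cont_on {a..b} u" and ab: "a \<le> b"
  shows "(deriv u has_integral (u b - u a)) {a..b}"
proof -
  define N where "N = {x \<in> {a..b}. \<not> u differentiable (at x)}"
  have N: "negligible N" unfolding N_def by (rule abs_cont_on_differentiable_ae[OF ac])
  define f where "f = (\<lambda>x. if x \<in> N then 0 else deriv u x)"
  have "(f has_integral (u b - u a)) {a..b}"
    unfolding has_integral_real
  proof (intro allI impI)
    fix e :: real assume e: "e > 0"
    \<comment> \<open>Half of \<open>e\<close> is spent on the tags outside \<open>N\<close>, where
      the errors sum to \<open>\<epsilon> * (b - a)\<close>; adding 1 keeps the quotient defined for
      \<open>a = b\<close>.\<close>
    define \<epsilon> where "\<epsilon> = e / (2 * (b - a + 1))"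
    have \<epsilon>: "\<epsilon> > 0" "\<epsilon> * (b - a) \<le> e / 2" using e ab by (auto simp: \<epsilon>_def field_simps)
    obtain \<delta> where \<delta>: "\<delta> > 0"
      "\<And>P. intervals_in {a..b} P \<Longrightarrow> len_sum P < \<delta> \<Longrightarrow> osc_sum P u < e / 2"
      using abs_cont_onD[OF ac, of "e / 2"] e by auto
    obtain T where T: "open T" "N \<subseteq> T" "T \<in> lmeasurable" "measure lebesgue T < \<delta>"
    proof -
      obtain T where T: "open T" "N \<subseteq> T" "T - N \<in> lmeasurable" "emeasure lebesgue (T - N) < ennreal \<delta>"
        using sets_lebesgue_outer_open[of N \<delta>] N \<delta> by (metis negligible_imp_sets)
      have "T = (T - N) \<union> N" using T by auto
      then have "T \<in> lmeasurable"
        using T(3) N by (metis fmeasurable.Un negligible_imp_measurable)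
      moreover have "measure lebesgue T = measure lebesgue (T - N)"
        using N T by (simp add: measure_Diff_null_set negligible_iff_null_sets lmeasurable_iff_indicator_has_integral fmeasurableD)
      moreover have "measure lebesgue (T - N) < \<delta>"
        using T(3,4) by (simp add: emeasure_eq_measure2 ennreal_less_iff)
      ultimately show thesis using T that by auto
    qed
    have "\<exists>d>0. \<forall>y. \<bar>y - x\<bar> < d \<longrightarrow> \<bar>u y - u x - f x * (y - x)\<bar> \<le> \<epsilon> * \<bar>y - x\<bar>" if "x \<in> {a..b} - N" for x
    proof -
      have "u differentiable (at x)" "f x = deriv u x" using that by (auto simp: N_def f_def)
      then have "(u has_derivative (\<lambda>h. f x * h)) (at x)"
        by (metis DERIV_deriv_iff_real_differentiable has_field_derivative_def)
      then show ?thesis unfolding has_derivative_at_alt using \<epsilon>(1) by (simp only: real_norm_def)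
    qed
    then obtain d where d: "\<And>x. x \<in> {a..b} - N \<Longrightarrow> d x > 0"
      "\<And>x y. x \<in> {a..b} - N \<Longrightarrow> \<bar>y - x\<bar> < d x \<Longrightarrow> \<bar>u y - u x - f x * (y - x)\<bar> \<le> \<epsilon> * \<bar>y - x\<bar>"
      using bchoice[of "{a..b} - N" "\<lambda>x d. d > 0 \<and> (\<forall>y. \<bar>y - x\<bar> < d \<longrightarrow> \<bar>u y - u x - f x * (y - x)\<bar> \<le> \<epsilon> * \<bar>y - x\<bar>)"]
      by blast
    define \<gamma> where "\<gamma> = (\<lambda>x. if x \<in> N then T else if x \<in> {a..b} then ball x (d x) else ball x 1)"
    have "gauge \<gamma>" unfolding gauge_def \<gamma>_def using T d by auto
    moreover have "norm ((\<Sum>(x, K)\<in>D. measure lborel K *\<^sub>R f x) - (u b - u a)) < e"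
      if D: "D tagged_division_of {a..b}" "\<gamma> fine D" for D
    proof -
      have fin: "finite D" using D by auto
      define DN where "DN = {z \<in> D. fst z \<in> N}"
      have K: "K = {Inf K..Sup K} \<and> x \<in> K \<and> Inf K \<le> Sup K \<and> K \<subseteq> {a..b} \<and> measure lborel K = Sup K - Inf K" if xK: "(x, K) \<in> D" for x K
      proof -
        obtain l r where lr: "K = cbox l r" using tagged_division_ofD(4)[OF D(1) xK] by blast
        moreover have "x \<in> K" "K \<subseteq> {a..b}" using tagged_division_ofD(2,3)[OF D(1) xK] by auto
        ultimately show ?thesis by auto
      qed
      have tel: "(\<Sum>(x, K)\<in>D. g (Sup K) - g (Inf K)) = g b - g a" for g :: "real \<Rightarrow> real"
        using additive_tagged_division_1[OF ab D(1)] by blast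
      have 1: "(\<Sum>(x, K)\<in>DN. \<bar>u (Sup K) - u (Inf K)\<bar>) < e / 2"
      proof (rule tagged_null_part_small[OF \<delta>(2) D(1) T(3,4)])
        show "K \<subseteq> T" if "(x, K) \<in> DN" for x K
          using fineD[OF D(2), of x K] that by (auto simp: DN_def \<gamma>_def)
      qed (auto simp: DN_def)
      \<comment> \<open>The tag lies between the endpoints of \<open>K\<close>, so the two one-sided
        errors add up to \<open>\<epsilon>\<close> times the length of \<open>K\<close>.\<close>
      have 2: "\<bar>measure lborel K * f x - (u (Sup K) - u (Inf K))\<bar> \<le> \<epsilon> * (Sup K - Inf K)" if xK: "(x, K) \<in> D - DN" for x K
      proof -
        have kk: "K = {Inf K..Sup K}" "x \<in> K" "Inf K \<le> Sup K" "K \<subseteq> {a..b}" "measure lborel K = Sup K - Inf K"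
          using K[of x K] xK by auto
        have x: "x \<in> {a..b} - N" using kk xK by (auto simp: DN_def)
        have "K \<subseteq> ball x (d x)" using fineD[OF D(2), of x K] xK x by (auto simp: \<gamma>_def)
        moreover have "Inf K \<in> K" "Sup K \<in> K" using kk by (metis atLeastAtMost_iff order_refl)+
        ultimately have "\<bar>Inf K - x\<bar> < d x" "\<bar>Sup K - x\<bar> < d x"
          by (auto simp: dist_real_def abs_minus_commute)
        from d(2)[OF x this(1)] d(2)[OF x this(2)]
        have "\<bar>u (Inf K) - u x - f x * (Inf K - x)\<bar> \<le> \<epsilon> * \<bar>Inf K - x\<bar>"
          "\<bar>u (Sup K) - u x - f x * (Sup K - x)\<bar> \<le> \<epsilon> * \<bar>Sup K - x\<bar>" by auto
        moreover have "Inf K \<le> x" "x \<le> Sup K" using kk by (metis atLeastAtMost_iff)+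
        ultimately show ?thesis unfolding kk(5) by (auto simp: algebra_simps abs_le_iff)
      qed
      have "\<bar>(\<Sum>(x, K)\<in>D. measure lborel K * f x) - (u b - u a)\<bar> = \<bar>\<Sum>(x, K)\<in>D. measure lborel K * f x - (u (Sup K) - u (Inf K))\<bar>"
        by (simp add: tel[of u, symmetric] sum_subtractf case_prod_unfold)
      also have "\<dots> \<le> (\<Sum>(x, K)\<in>D. \<bar>measure lborel K * f x - (u (Sup K) - u (Inf K))\<bar>)"
        unfolding case_prod_unfold by (rule sum_abs)
      also have "\<dots> = (\<Sum>(x, K)\<in>D - DN. \<bar>measure lborel K * f x - (u (Sup K) - u (Inf K))\<bar>)
          + (\<Sum>(x, K)\<in>DN. \<bar>measure lborel K * f x - (u (Sup K) - u (Inf K))\<bar>)"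
        using fin by (intro sum.subset_diff) (auto simp: DN_def)
      also have "(\<Sum>(x, K)\<in>DN. \<bar>measure lborel K * f x - (u (Sup K) - u (Inf K))\<bar>) = (\<Sum>(x, K)\<in>DN. \<bar>u (Sup K) - u (Inf K)\<bar>)"
        by (intro sum.cong) (auto simp: DN_def f_def abs_minus_commute)
      also have "(\<Sum>(x, K)\<in>D - DN. \<bar>measure lborel K * f x - (u (Sup K) - u (Inf K))\<bar>) \<le> (\<Sum>(x, K)\<in>D - DN. \<epsilon> * (Sup K - Inf K))"
        using 2 by (intro sum_mono) auto
      also have "\<dots> \<le> (\<Sum>(x, K)\<in>D. \<epsilon> * (Sup K - Inf K))"
      proof (rule sum_mono2)
        show "0 \<le> (case z of (x, K) \<Rightarrow> \<epsilon> * (Sup K - Inf K))" if z: "z \<in> D - (D - DN)" for z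
        proof -
          obtain x K where xK: "z = (x, K)" by fastforce
          then have "Inf K \<le> Sup K" using z K[of x K] by blast
          then show ?thesis using \<epsilon>(1) xK by simp
        qed
      qed (use fin in auto)
      also have "\<dots> = \<epsilon> * (b - a)" using tel[of "\<lambda>x. \<epsilon> * x"] by (simp add: algebra_simps)
      finally show ?thesis using 1 \<epsilon>(2) by simp
    qed
    ultimately show "\<exists>\<gamma>. gauge \<gamma> \<and> (\<forall>D. D tagged_division_of {a..b} \<and> \<gamma> fine D \<longrightarrow>
       norm ((\<Sum>(x, K)\<in>D. measure lborel K *\<^sub>R f x) - (u b - u a)) < e)"
      by (intro exI[of _ \<gamma>] conjI allI impI) auto
  qed
  then show ?thesis
    by (rule has_integral_spike[OF N, rotated]) (auto simp: f_def)
qed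

subsection \<open>Locally absolutely continuous functions\<close>

text \<open>Common source of closure under sums, products and Lipschitz composition: each of them
  only has to supply an increment bound.\<close>

lemma abs_cont_on_dominated:
  assumes u: "abs_cont_on K u" and v: "abs_cont_on K v" and L: "L \<ge> 0"
    and w: "\<And>a b. a \<in> K \<Longrightarrow> b \<in> K \<Longrightarrow> \<bar>w b - w a\<bar> \<le> L * (\<bar>u b - u a\<bar> + \<bar>v b - v a\<bar>)"
  shows "abs_cont_on K w"
proof (rule abs_cont_onI)
  fix \<epsilon> :: real assume \<epsilon>: "\<epsilon> > 0"
  define e where "e = \<epsilon> / (2 * (L + 1))"
  have e: "e > 0" "2 * (L * e) \<le> \<epsilon>" using \<epsilon> L by (auto simp: e_def field_simps)
  obtain d1 where d1: "d1 > 0"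
    "\<And>P. intervals_in K P \<Longrightarrow> len_sum P < d1 \<Longrightarrow> osc_sum P u < e"
    using abs_cont_onD[OF u e(1)] by blast
  obtain d2 where d2: "d2 > 0"
    "\<And>P. intervals_in K P \<Longrightarrow> len_sum P < d2 \<Longrightarrow> osc_sum P v < e"
    using abs_cont_onD[OF v e(1)] by blast
  have "osc_sum P w < \<epsilon>" if P: "intervals_in K P" "len_sum P < min d1 d2" for P
  proof -
    have "osc_sum P w \<le> (\<Sum>(a, b)\<in>P. L * (\<bar>u b - u a\<bar> + \<bar>v b - v a\<bar>))"
    proof (rule sum_mono)
      fix z assume z: "z \<in> P"
      obtain a b where ab: "z = (a, b)" by fastforce
      then have "a \<in> K" "b \<in> K" using P(1) z unfolding intervals_in_def by auto
      then show "(case z of (a, b) \<Rightarrow> \<bar>w b - w a\<bar>) \<le> (case z of (a, b) \<Rightarrow> L * (\<bar>u b - u a\<bar> + \<bar>v b - v a\<bar>))"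
        using w ab by simp
    qed
    also have "\<dots> = L * (osc_sum P u + osc_sum P v)"
      by (simp add: case_prod_unfold sum.distrib flip: sum_distrib_left)
    finally have *: "osc_sum P w \<le> L * (osc_sum P u + osc_sum P v)" .
    have s: "osc_sum P u + osc_sum P v < 2 * e"
      using d1(2)[OF P(1)] d2(2)[OF P(1)] P(2) by simp
    show ?thesis
    proof (cases "L = 0")
      case True
      then show ?thesis using * \<epsilon> by simp
    next
      case False
      then have "L * (osc_sum P u + osc_sum P v) < L * (2 * e)"
        using s L by (intro mult_strict_left_mono) auto
      then show ?thesis using * e by linarith
    qed
  qed
  then show "\<exists>\<delta>>0. \<forall>P. intervals_in K P \<longrightarrow> len_sum P < \<delta> \<longrightarrow> osc_sum P w < \<epsilon>"
    using d1(1) d2(1) by (intro exI[of _ "min d1 d2"] conjI allI impI) auto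
qed

lemma abs_cont_on_subset:
  assumes "abs_cont_on K u" "K' \<subseteq> K"
  shows "abs_cont_on K' u"
proof (rule abs_cont_onI)
  fix \<epsilon> :: real assume \<epsilon>: "\<epsilon> > 0"
  obtain \<delta> where \<delta>: "\<delta> > 0"
    "\<And>P. intervals_in K P \<Longrightarrow> len_sum P < \<delta> \<Longrightarrow> osc_sum P u < \<epsilon>"
    using abs_cont_onD[OF assms(1) \<epsilon>] by blast
  have "intervals_in K P" if "intervals_in K' P" for P
    using that assms(2) unfolding intervals_in_def by fast
  then show "\<exists>\<delta>>0. \<forall>P. intervals_in K' P \<longrightarrow> len_sum P < \<delta> \<longrightarrow> osc_sum P u < \<epsilon>"
    using \<delta> by blast
qed

lemma AC_loc0D:
  assumes "u \<in> AC_loc0" "-1 < a" "b < 1"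
  shows "abs_cont_on {a..b} u"
proof -
  have "compact {a..b}" "{a..b} \<subseteq> unit_ival" using assms by auto
  then show ?thesis using assms(1) unfolding AC_loc0_def by blast
qed

lemma AC_loc0I:
  assumes "\<And>a b. -1 < a \<Longrightarrow> a \<le> b \<Longrightarrow> b < 1 \<Longrightarrow> abs_cont_on {a..b} u"
  shows "u \<in> AC_loc0"
  unfolding AC_loc0_def
proof (intro CollectI allI impI)
  fix K :: "real set" assume K: "compact K \<and> K \<subseteq> unit_ival"
  show "abs_cont_on K u"
  proof (cases "K = {}")
    case True
    then show ?thesis using abs_cont_on_subset[OF assms[of 0 0]] by auto
  next
    case False
    obtain a where a: "a \<in> K" "\<And>x. x \<in> K \<Longrightarrow> a \<le> x" using compact_attains_inf[of K] K False by blast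
    obtain b where b: "b \<in> K" "\<And>x. x \<in> K \<Longrightarrow> x \<le> b" using compact_attains_sup[of K] K False by blast
    have "abs_cont_on {a..b} u" using a b K by (intro assms) auto
    then show ?thesis by (rule abs_cont_on_subset) (use a b in auto)
  qed
qed

lemma AC_loc0_dominated:
  assumes u: "u \<in> AC_loc0" and v: "v \<in> AC_loc0"
    and w: "\<And>a b. -1 < a \<Longrightarrow> a \<le> b \<Longrightarrow> b < 1 \<Longrightarrow>
      \<exists>L. \<forall>x\<in>{a..b}. \<forall>y\<in>{a..b}. \<bar>w y - w x\<bar> \<le> L * (\<bar>u y - u x\<bar> + \<bar>v y - v x\<bar>)"
  shows "w \<in> AC_loc0"
proof (rule AC_loc0I)
  fix a b :: real assume ab: "-1 < a" "a \<le> b" "b < 1"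
  obtain L where L: "\<And>x y. x \<in> {a..b} \<Longrightarrow> y \<in> {a..b} \<Longrightarrow> \<bar>w y - w x\<bar> \<le> L * (\<bar>u y - u x\<bar> + \<bar>v y - v x\<bar>)"
    using w[OF ab] by blast
  show "abs_cont_on {a..b} w"
  proof (rule abs_cont_on_dominated)
    show "abs_cont_on {a..b} u" "abs_cont_on {a..b} v" using u v ab by (auto intro: AC_loc0D)
    show "0 \<le> \<bar>L\<bar>" by simp
    fix x y assume "x \<in> {a..b}" "y \<in> {a..b}"
    then have "\<bar>w y - w x\<bar> \<le> L * (\<bar>u y - u x\<bar> + \<bar>v y - v x\<bar>)" by (rule L)
    also have "\<dots> \<le> \<bar>L\<bar> * (\<bar>u y - u x\<bar> + \<bar>v y - v x\<bar>)" by (intro mult_right_mono) auto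
    finally show "\<bar>w y - w x\<bar> \<le> \<bar>L\<bar> * (\<bar>u y - u x\<bar> + \<bar>v y - v x\<bar>)" .
  qed
qed

lemma AC_loc0_lipschitz:
  assumes u: "u \<in> AC_loc0" and w: "\<And>x y. x \<in> unit_ival \<Longrightarrow> y \<in> unit_ival \<Longrightarrow> \<bar>w y - w x\<bar> \<le> L * \<bar>u y - u x\<bar>"
  shows "w \<in> AC_loc0"
proof (rule AC_loc0_dominated[OF u u])
  fix a b :: real assume ab: "-1 < a" "a \<le> b" "b < 1"
  \<comment> \<open>\<open>u\<close> takes the place of both dominating functions, so the constant
    is halved.\<close>
  have "\<bar>w y - w x\<bar> \<le> (L / 2) * (\<bar>u y - u x\<bar> + \<bar>u y - u x\<bar>)" if "x \<in> {a..b}" "y \<in> {a..b}" for x y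
    using w[of x y] that ab by (simp add: field_simps)
  then show "\<exists>L. \<forall>x\<in>{a..b}. \<forall>y\<in>{a..b}. \<bar>w y - w x\<bar> \<le> L * (\<bar>u y - u x\<bar> + \<bar>u y - u x\<bar>)" by blast
qed

lemma AC_loc0_cong:
  assumes "\<And>x. x \<in> unit_ival \<Longrightarrow> u x = v x"
  shows "u \<in> AC_loc0 \<longleftrightarrow> v \<in> AC_loc0"
  using AC_loc0_lipschitz[of u v 1] AC_loc0_lipschitz[of v u 1] assms by force

lemma AC_loc0_continuous_on:
  assumes "u \<in> AC_loc0"
  shows "continuous_on unit_ival u"
proof (rule continuous_at_imp_continuous_on, rule ballI)
  fix x :: real assume x: "x \<in> unit_ival"
  have "continuous_on {(x - 1) / 2<..<(x + 1) / 2} u"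
    using abs_cont_on_imp_continuous_on[OF AC_loc0D[OF assms, of "(x - 1) / 2" "(x + 1) / 2"]] x
    by (auto intro: continuous_on_subset)
  then show "isCont u x"
    using x by (subst (asm) continuous_on_eq_continuous_at) auto
qed

lemma AC_loc0_add:
  assumes "u \<in> AC_loc0" "v \<in> AC_loc0"
  shows "(\<lambda>x. u x + v x) \<in> AC_loc0"
  by (rule AC_loc0_dominated[OF assms], rule exI[of _ 1]) auto

lemma AC_loc0_const: "(\<lambda>x. c) \<in> AC_loc0"
  by (auto simp: AC_loc0_def abs_cont_on_def intro: exI[of _ 1])

lemma AC_loc0_mult:
  assumes u: "u \<in> AC_loc0" and v: "v \<in> AC_loc0"
  shows "(\<lambda>x. u x * v x) \<in> AC_loc0"
proof (rule AC_loc0_dominated[OF u v])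
  fix a b :: real assume ab: "-1 < a" "a \<le> b" "b < 1"
  have bdd: "\<exists>B\<ge>0. \<forall>x\<in>{a..b}. \<bar>w x\<bar> \<le> B" if "w \<in> AC_loc0" for w
  proof -
    have "continuous_on {a..b} w"
      using abs_cont_on_imp_continuous_on[OF AC_loc0D[OF that]] ab by simp
    then have "bounded (w ` {a..b})" by (intro compact_imp_bounded compact_continuous_image) auto
    then obtain B where "\<forall>x\<in>{a..b}. \<bar>w x\<bar> \<le> B" unfolding bounded_iff by auto
    then show ?thesis using ab by (intro exI[of _ B]) (auto intro: order_trans[OF abs_ge_zero])
  qed
  obtain B1 B2 where B: "B1 \<ge> 0" "\<And>x. x \<in> {a..b} \<Longrightarrow> \<bar>u x\<bar> \<le> B1" "B2 \<ge> 0" "\<And>x. x \<in> {a..b} \<Longrightarrow> \<bar>v x\<bar> \<le> B2"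
    using bdd[OF u] bdd[OF v] by metis
  have "\<bar>u y * v y - u x * v x\<bar> \<le> (B1 + B2) * (\<bar>u y - u x\<bar> + \<bar>v y - v x\<bar>)" if xy: "x \<in> {a..b}" "y \<in> {a..b}" for x y
  proof -
    have "u y * v y - u x * v x = u y * (v y - v x) + v x * (u y - u x)" by (simp add: algebra_simps)
    then have "\<bar>u y * v y - u x * v x\<bar> \<le> \<bar>u y\<bar> * \<bar>v y - v x\<bar> + \<bar>v x\<bar> * \<bar>u y - u x\<bar>"
      by (metis abs_mult abs_triangle_ineq)
    also have "\<dots> \<le> (B1 + B2) * \<bar>v y - v x\<bar> + (B1 + B2) * \<bar>u y - u x\<bar>"
      using B(2)[OF xy(2)] B(4)[OF xy(1)] B(1,3) by (intro add_mono mult_right_mono) auto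
    finally show ?thesis by (simp add: algebra_simps)
  qed
  then show "\<exists>L. \<forall>x\<in>{a..b}. \<forall>y\<in>{a..b}. \<bar>u y * v y - u x * v x\<bar> \<le> L * (\<bar>u y - u x\<bar> + \<bar>v y - v x\<bar>)"
    by blast
qed

lemma unit_ival_compact_exhaustion:
  fixes x :: real
  assumes "x \<in> unit_ival"
  shows "\<exists>N::nat. \<forall>n\<ge>N. x \<in> {-1 + 1 / Suc n..1 - 1 / Suc n}"
proof -
  obtain N where N: "1 / Suc N < min (1 + x) (1 - x)"
    using assms by (metis greaterThanLessThan_iff min_less_iff_conj nat_approx_posE diff_gt_0_iff_gt add.commute less_diff_eq minus_less_iff neg_less_iff_less real_0_less_add_iff)
  have "1 / Suc n \<le> 1 / Suc N" if "n \<ge> N" for n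
    using that by (intro divide_left_mono) auto
  then show ?thesis using N by (intro exI[of _ N]) (fastforce)
qed

lemma AC_loc0_differentiable_ae:
  assumes "u \<in> AC_loc0"
  shows "negligible {x \<in> unit_ival. \<not> u differentiable (at x)}"
proof -
  let ?J = "\<lambda>n::nat. {-1 + 1 / Suc n..1 - 1 / Suc n}"
  have "negligible {x \<in> ?J n. \<not> u differentiable (at x)}" for n
    using AC_loc0D[OF assms] by (intro abs_cont_on_differentiable_ae) auto
  then have "negligible (\<Union>n. {x \<in> ?J n. \<not> u differentiable (at x)})"
    by (intro negligible_countable_Union) auto
  then show ?thesis
    by (rule negligible_subset) (use unit_ival_compact_exhaustion in blast)
qed

abbreviation ival_measurable :: "(real \<Rightarrow> real) set" where
  "ival_measurable \<equiv> borel_measurable (lebesgue_on unit_ival)"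

lemma AC_loc0_measurable: "u \<in> AC_loc0 \<Longrightarrow> u \<in> ival_measurable"
  using AC_loc0_continuous_on by (intro continuous_imp_measurable_on_sets_lebesgue) auto

text \<open>By the fundamental theorem the derivative is gauge integrable, hence measurable, on
  compact subintervals; extensions by zero converge pointwise. This supplies the measurability of
  the top derivative, which exists only almost everywhere.\<close>

lemma AC_loc0_deriv_measurable:
  assumes "u \<in> AC_loc0"
  shows "deriv u \<in> ival_measurable"
proof -
  let ?J = "\<lambda>n::nat. {-1 + 1 / Suc n..1 - 1 / Suc n}"
  have 1: "(\<lambda>x. if x \<in> ?J n then deriv u x else 0) \<in> borel_measurable lebesgue" for n
  proof (cases "-1 + 1 / Suc n \<le> 1 - 1 / Suc n")
    case True
    have "(deriv u has_integral (u (1 - 1 / Suc n) - u (-1 + 1 / Suc n))) (?J n)"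
      using AC_loc0D[OF assms] True by (intro abs_cont_on_ftc) auto
    then have "deriv u \<in> borel_measurable (lebesgue_on (?J n))"
      by (intro integrable_imp_measurable) auto
    then show ?thesis by (rule borel_measurable_if_I) simp
  next
    case False
    then have "?J n = {}" by simp
    then show ?thesis by simp
  qed
  have "(\<lambda>x. if x \<in> unit_ival then deriv u x else 0) \<in> borel_measurable lebesgue"
  proof (rule borel_measurable_LIMSEQ_real[OF _ 1])
    fix x :: real
    show "(\<lambda>n. if x \<in> ?J n then deriv u x else 0) \<longlonglongrightarrow> (if x \<in> unit_ival then deriv u x else 0)"
    proof (cases "x \<in> unit_ival")
      case True
      then obtain N where "\<forall>n\<ge>N. x \<in> ?J n" using unit_ival_compact_exhaustion by blast
      then have "\<forall>\<^sub>F n in sequentially. (if x \<in> ?J n then deriv u x else 0) = deriv u x"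
        unfolding eventually_sequentially by auto
      then show ?thesis using True by (simp add: tendsto_eventually)
    next
      case False
      have nj: "x \<notin> ?J n" for n
      proof -
        have "0 < 1 / real (Suc n)" by simp
        then show ?thesis using False by (smt (verit) atLeastAtMost_iff greaterThanLessThan_iff)
      qed
      have "(\<lambda>n. if x \<in> ?J n then deriv u x else 0) = (\<lambda>n. 0)"
        by (rule ext) (rule if_not_P[OF nj])
      then show ?thesis by (simp only: if_not_P[OF False] tendsto_const)
    qed
  qed
  then show ?thesis by (rule borel_measurable_if_D)
qed

section \<open>Weighted Lebesgue norms\<close>

text \<open>Square root of the weight: a pointwise bound on
  \<open>rho x ^ s * \<bar>p x\<bar>\<close> has the same scaling as a square integral with weight
  \<open>(1 - x\<^sup>2) ^ s\<close>.\<close>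

definition rho :: "real \<Rightarrow> real" where "rho x = sqrt (1 - x\<^sup>2)"

lemma rho_bounds: "x \<in> unit_ival \<Longrightarrow> 0 < rho x \<and> rho x \<le> 1"
  by (auto simp: rho_def abs_square_less_1)

lemma rho_power: "x \<in> unit_ival \<Longrightarrow> (rho x ^ s)\<^sup>2 = (1 - x\<^sup>2) ^ s"
  by (simp add: rho_def abs_square_less_1 less_imp_le flip: power_mult power_commutes)
     (metis abs_square_less_1 abs_less_iff diff_ge_0_iff_ge greaterThanLessThan_iff less_imp_le mult.commute power_mult real_sqrt_pow2 minus_less_iff)

lemma weight_nonneg: "x \<in> unit_ival \<Longrightarrow> 0 \<le> (1 - x\<^sup>2) ^ s"
  by (metis rho_power zero_le_power2)

definition wsq :: "nat \<Rightarrow> (real \<Rightarrow> real) \<Rightarrow> real \<Rightarrow> ennreal" where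
  "wsq s r x = ennreal ((1 - x\<^sup>2) ^ s * \<bar>r x\<bar>\<^sup>2) * indicator unit_ival x"

text \<open>\<open>M\<close> bounds the norm, not its square. Measurability is included because
  \<open>nn_integral\<close> is defined for every function but is additive only for measurable
  ones.\<close>

definition wL2 :: "nat \<Rightarrow> real \<Rightarrow> (real \<Rightarrow> real) \<Rightarrow> bool" where
  "wL2 s M r \<longleftrightarrow> r \<in> ival_measurable \<and>
     (\<integral>\<^sup>+x. wsq s r x \<partial>lebesgue) \<le> ennreal (M\<^sup>2)"

lemma wsq_measurable:
  assumes "r \<in> ival_measurable"
  shows "wsq s r \<in> borel_measurable lebesgue"
proof -
  have "(\<lambda>x. if x \<in> unit_ival then r x else 0) \<in> borel_measurable lebesgue"
    using assms by (rule borel_measurable_if_I) simp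
  moreover have "(\<lambda>x::real. (1 - x\<^sup>2) ^ s) \<in> borel_measurable lebesgue"
    "(indicator unit_ival :: real \<Rightarrow> ennreal) \<in> borel_measurable lebesgue"
  proof -
    have "(\<lambda>x::real. (1 - x\<^sup>2) ^ s) \<in> borel_measurable borel"
      by (intro borel_measurable_continuous_onI continuous_intros)
    then show "(\<lambda>x::real. (1 - x\<^sup>2) ^ s) \<in> borel_measurable lebesgue"
      by (intro measurable_completion) simp
    show "(indicator unit_ival :: real \<Rightarrow> ennreal) \<in> borel_measurable lebesgue"
      by (intro borel_measurable_indicator) auto
  qed
  ultimately have "(\<lambda>x. ennreal ((1 - x\<^sup>2) ^ s * \<bar>if x \<in> unit_ival then r x else 0\<bar>\<^sup>2) * indicator unit_ival x) \<in> borel_measurable lebesgue"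
    by (intro borel_measurable_times_ennreal measurable_compose[OF borel_measurable_times measurable_ennreal]
        borel_measurable_power[where f="\<lambda>x. \<bar>_ x\<bar>"] borel_measurable_abs)
  also have "(\<lambda>x. ennreal ((1 - x\<^sup>2) ^ s * \<bar>if x \<in> unit_ival then r x else 0\<bar>\<^sup>2) * indicator unit_ival x) = wsq s r"
    by (auto simp: wsq_def fun_eq_iff indicator_def)
  finally show ?thesis .
qed

lemma wL2_mono:
  assumes "wL2 s M r" "0 \<le> M" "M \<le> N"
  shows "wL2 s N r"
  using assms unfolding wL2_def by (meson ennreal_leI order_trans power_mono)

lemma wL2_cong_ae:
  assumes "wL2 s M r" "r' \<in> ival_measurable" "negligible N"
    and "\<And>x. x \<in> unit_ival \<Longrightarrow> x \<notin> N \<Longrightarrow> r x = r' x"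
  shows "wL2 s M r'"
proof -
  have "AE x in lebesgue. x \<notin> N"
    using assms(3) by (metis AE_not_in negligible_iff_null_sets)
  then have "AE x in lebesgue. wsq s r' x = wsq s r x"
    by eventually_elim (use assms(4) in \<open>auto simp: wsq_def indicator_def\<close>)
  then have "(\<integral>\<^sup>+x. wsq s r' x \<partial>lebesgue) = (\<integral>\<^sup>+x. wsq s r x \<partial>lebesgue)"
    by (rule nn_integral_cong_AE)
  then show ?thesis using assms unfolding wL2_def by simp
qed

text \<open>The crude factor 2 comes from \<open>(p + q)^2 <= 2 p^2 + 2 q^2\<close> and spares
  Minkowski's inequality; constants only need to be finite throughout.\<close>

lemma wL2_add:
  assumes p: "wL2 s M p" and q: "wL2 s N q" and "0 \<le> M" "0 \<le> N"
  shows "wL2 s (2 * (M + N)) (\<lambda>x. p x + q x)"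
proof -
  have pq: "p \<in> ival_measurable" "q \<in> ival_measurable"
    using p q by (auto simp: wL2_def)
  have two: "ennreal (2 * A + 2 * B) = 2 * ennreal A + 2 * ennreal B" if "A \<ge> 0" "B \<ge> 0" for A B
    using that by (simp add: ennreal_mult ennreal_plus)
  have "wsq s (\<lambda>x. p x + q x) x \<le> 2 * wsq s p x + 2 * wsq s q x" for x
  proof (cases "x \<in> unit_ival")
    case True
    have "\<bar>p x + q x\<bar>\<^sup>2 \<le> 2 * \<bar>p x\<bar>\<^sup>2 + 2 * \<bar>q x\<bar>\<^sup>2"
      using sum_squares_bound[of "p x" "q x"] by (simp add: power2_sum)
    then have "(1 - x\<^sup>2) ^ s * \<bar>p x + q x\<bar>\<^sup>2 \<le> (1 - x\<^sup>2) ^ s * (2 * \<bar>p x\<bar>\<^sup>2 + 2 * \<bar>q x\<bar>\<^sup>2)"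
      using weight_nonneg[OF True] by (intro mult_left_mono)
    also have "\<dots> = 2 * ((1 - x\<^sup>2) ^ s * \<bar>p x\<bar>\<^sup>2) + 2 * ((1 - x\<^sup>2) ^ s * \<bar>q x\<bar>\<^sup>2)" by (simp add: algebra_simps)
    finally have "ennreal ((1 - x\<^sup>2) ^ s * \<bar>p x + q x\<bar>\<^sup>2) \<le> ennreal (2 * ((1 - x\<^sup>2) ^ s * \<bar>p x\<bar>\<^sup>2) + 2 * ((1 - x\<^sup>2) ^ s * \<bar>q x\<bar>\<^sup>2))"
      by (rule ennreal_leI)
    also have "\<dots> = 2 * ennreal ((1 - x\<^sup>2) ^ s * \<bar>p x\<bar>\<^sup>2) + 2 * ennreal ((1 - x\<^sup>2) ^ s * \<bar>q x\<bar>\<^sup>2)"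
      by (rule two) (simp_all add: weight_nonneg[OF True])
    finally show ?thesis using True by (simp add: wsq_def)
  qed (simp add: wsq_def)
  then have "(\<integral>\<^sup>+x. wsq s (\<lambda>x. p x + q x) x \<partial>lebesgue) \<le> (\<integral>\<^sup>+x. 2 * wsq s p x + 2 * wsq s q x \<partial>lebesgue)"
    by (rule nn_integral_mono)
  also have "\<dots> = 2 * (\<integral>\<^sup>+x. wsq s p x \<partial>lebesgue) + 2 * (\<integral>\<^sup>+x. wsq s q x \<partial>lebesgue)"
    using wsq_measurable[OF pq(1), of s] wsq_measurable[OF pq(2), of s]
    by (subst nn_integral_add) (auto simp: nn_integral_cmult)
  also have "\<dots> \<le> 2 * ennreal (M\<^sup>2) + 2 * ennreal (N\<^sup>2)"
    using p q by (intro add_mono mult_left_mono) (auto simp: wL2_def)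
  also have "\<dots> = ennreal (2 * M\<^sup>2 + 2 * N\<^sup>2)"
    by (simp add: ennreal_mult)
  also have "\<dots> \<le> ennreal ((2 * (M + N))\<^sup>2)"
    using assms(3,4) by (intro ennreal_leI) (auto simp: power2_eq_square algebra_simps)
  finally show ?thesis using pq unfolding wL2_def by auto
qed

text \<open>The weight \<open>rho x ^ t\<close> absorbed by the bounded factor squares to
  \<open>(1 - x\<^sup>2) ^ t\<close>, so the weight exponents add. Every Leibniz term containing a
  top derivative is estimated this way.\<close>

lemma wL2_mult_bounded:
  assumes r: "wL2 s M r" and q: "q \<in> ival_measurable"
    and b: "\<And>x. x \<in> unit_ival \<Longrightarrow> rho x ^ t * \<bar>q x\<bar> \<le> N"
  shows "wL2 (s + t) (N * M) (\<lambda>x. q x * r x)"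
proof -
  have rm: "r \<in> ival_measurable" using r by (auto simp: wL2_def)
  have "wsq (s + t) (\<lambda>x. q x * r x) x \<le> ennreal (N\<^sup>2) * wsq s r x" for x
  proof (cases "x \<in> unit_ival")
    case True
    have "(1 - x\<^sup>2) ^ t * \<bar>q x\<bar>\<^sup>2 = (rho x ^ t * \<bar>q x\<bar>)\<^sup>2" using rho_power[OF True, of t] by (simp add: power_mult_distrib)
    also have "\<dots> \<le> N\<^sup>2" using b[OF True] rho_bounds[OF True] by (intro power_mono) auto
    finally have "((1 - x\<^sup>2) ^ t * \<bar>q x\<bar>\<^sup>2) * ((1 - x\<^sup>2) ^ s * \<bar>r x\<bar>\<^sup>2) \<le> N\<^sup>2 * ((1 - x\<^sup>2) ^ s * \<bar>r x\<bar>\<^sup>2)"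
      using weight_nonneg[OF True] by (intro mult_right_mono) auto
    then have "ennreal ((1 - x\<^sup>2) ^ (s + t) * \<bar>q x * r x\<bar>\<^sup>2) \<le> ennreal (N\<^sup>2 * ((1 - x\<^sup>2) ^ s * \<bar>r x\<bar>\<^sup>2))"
      by (intro ennreal_leI) (simp add: power_add power_mult_distrib abs_mult algebra_simps)
    then show ?thesis using True by (simp add: wsq_def ennreal_mult')
  qed (simp add: wsq_def)
  then have "(\<integral>\<^sup>+x. wsq (s + t) (\<lambda>x. q x * r x) x \<partial>lebesgue) \<le> (\<integral>\<^sup>+x. ennreal (N\<^sup>2) * wsq s r x \<partial>lebesgue)"
    by (rule nn_integral_mono)
  also have "\<dots> = ennreal (N\<^sup>2) * (\<integral>\<^sup>+x. wsq s r x \<partial>lebesgue)"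
    using wsq_measurable[OF rm] by (rule nn_integral_cmult)
  also have "\<dots> \<le> ennreal (N\<^sup>2) * ennreal (M\<^sup>2)"
    using r by (intro mult_left_mono) (auto simp: wL2_def)
  also have "\<dots> = ennreal ((N * M)\<^sup>2)" by (simp add: power_mult_distrib ennreal_mult)
  finally show ?thesis using rm q unfolding wL2_def by auto
qed

text \<open>The constant function 1 has squared norm 2, the length of the interval, which is at most
  \<open>2\<^sup>2\<close>; multiplying it by \<open>q\<close> explains the factor 2.\<close>

lemma wL2_bounded:
  assumes q: "q \<in> ival_measurable"
    and b: "\<And>x. x \<in> unit_ival \<Longrightarrow> rho x ^ t * \<bar>q x\<bar> \<le> N"
  shows "wL2 t (2 * N) q"
proof -
  have "wsq 0 (\<lambda>x. 1) = indicator unit_ival" by (auto simp: wsq_def)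
  then have "(\<integral>\<^sup>+x. wsq 0 (\<lambda>x. 1) x \<partial>lebesgue) \<le> ennreal (2\<^sup>2)"
    by (simp add: nn_integral_indicator)
  then have "wL2 0 2 (\<lambda>x. 1)" unfolding wL2_def by auto
  from wL2_mult_bounded[OF this q b] show ?thesis by (simp add: mult.commute)
qed

section \<open>Weighted bounds on derivatives\<close>

text \<open>
  \<open>wb n s M p\<close> bounds \<open>rho\<^sup>s\<^sup>+\<^sup>i D\<^sup>i p\<close> in the supremum norm for \<open>i < n\<close> (and \<open>i = 0\<close>), and in \<open>L\<^sup>2\<close> for \<open>i = n\<close> if
  \<open>n > 0\<close>. By a Sobolev embedding the unit ball of \<open>sob n\<close> is described by \<open>wb n 0\<close> up to constants, and
  unlike the Sobolev norms these bounds behave well under products.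
\<close>

primrec wb :: "nat \<Rightarrow> nat \<Rightarrow> real \<Rightarrow> (real \<Rightarrow> real) \<Rightarrow> bool" where
  "wb 0 s M p \<longleftrightarrow> continuous_on unit_ival p \<and> (\<forall>x\<in>unit_ival. rho x ^ s * \<bar>p x\<bar> \<le> M)"
| "wb (Suc n) s M p \<longleftrightarrow> p \<in> AC_loc0 \<and> (0 < n \<longrightarrow> (\<forall>x\<in>unit_ival. p differentiable (at x))) \<and>
     (\<forall>x\<in>unit_ival. rho x ^ s * \<bar>p x\<bar> \<le> M) \<and>
     (if n = 0 then wL2 (Suc s) M (deriv p) else wb n (Suc s) M (deriv p))"

text \<open>The requirement on a derivative with \<open>n\<close> orders left. With none left it is
  the top derivative, for which only a square integral bound exists, whereas \<open>wb 0\<close>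
  would ask for continuity and a pointwise bound.\<close>

definition wd :: "nat \<Rightarrow> nat \<Rightarrow> real \<Rightarrow> (real \<Rightarrow> real) \<Rightarrow> bool" where
  "wd n s M r \<longleftrightarrow> (if n = 0 then wL2 s M r else wb n s M r)"

lemma wb_Suc: "wb (Suc n) s M p \<longleftrightarrow> p \<in> AC_loc0 \<and> (0 < n \<longrightarrow> (\<forall>x\<in>unit_ival. p differentiable (at x))) \<and>
    (\<forall>x\<in>unit_ival. rho x ^ s * \<bar>p x\<bar> \<le> M) \<and> wd n (Suc s) M (deriv p)"
  by (simp add: wd_def)

declare wb.simps(2) [simp del]

lemma wb_AC: "wb (Suc n) s M p \<Longrightarrow> p \<in> AC_loc0"
  by (simp add: wb_Suc)

lemma wb_deriv: "wb (Suc n) s M p \<Longrightarrow> wd n (Suc s) M (deriv p)"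
  by (simp add: wb_Suc)

lemma wb_continuous: "wb n s M p \<Longrightarrow> continuous_on unit_ival p"
  by (cases n) (auto simp: wb_Suc AC_loc0_continuous_on)

lemma wb_measurable: "wb n s M p \<Longrightarrow> p \<in> ival_measurable"
  using wb_continuous by (intro continuous_imp_measurable_on_sets_lebesgue) auto

lemma wb_sup: "wb n s M p \<Longrightarrow> x \<in> unit_ival \<Longrightarrow> rho x ^ s * \<bar>p x\<bar> \<le> M"
  by (cases n) (auto simp: wb_Suc)

lemma wb_nonneg: "wb n s M p \<Longrightarrow> 0 \<le> M"
  using wb_sup[of n s M p 0] by (auto simp: rho_def intro: order_trans[OF abs_ge_zero])

lemma wb_mono: "wb n s M p \<Longrightarrow> M \<le> N \<Longrightarrow> wb n s N p"
proof (induction n arbitrary: s p)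
  case 0
  then show ?case by force
next
  case (Suc n)
  have "wd n (Suc s) N (deriv p)"
    using wb_deriv[OF Suc(2)] Suc(1,3) wL2_mono wb_nonneg[OF Suc(2)] by (auto simp: wd_def split: if_splits)
  then show ?case using Suc(2,3) by (force simp: wb_Suc)
qed

lemma wd_mono: "wd n s M r \<Longrightarrow> 0 \<le> M \<Longrightarrow> M \<le> N \<Longrightarrow> wd n s N r"
  by (auto simp: wd_def wb_mono wL2_mono)

section \<open>Dependence on values inside the interval only\<close>

lemma ival_eventually_eq:
  assumes "\<And>x. x \<in> unit_ival \<Longrightarrow> p x = q x" "x \<in> unit_ival"
  shows "\<forall>\<^sub>F y in nhds x. p y = q y"
  using assms by (metis (mono_tags, lifting) eventually_nhds open_greaterThanLessThan)

lemma deriv_ival_cong: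
  assumes "\<And>x. x \<in> unit_ival \<Longrightarrow> p x = q x" "x \<in> unit_ival"
  shows "deriv p x = deriv q x"
  by (rule deriv_cong_ev[OF ival_eventually_eq[OF assms] refl])

lemma DERIV_ival_cong:
  assumes "\<And>x. x \<in> unit_ival \<Longrightarrow> p x = q x" "x \<in> unit_ival"
  shows "(p has_real_derivative d) (at x) \<longleftrightarrow> (q has_real_derivative d) (at x)"
  by (rule DERIV_cong_ev[OF refl ival_eventually_eq[OF assms] refl])

lemma differentiable_ival_cong:
  fixes p q :: "real \<Rightarrow> real"
  assumes "\<And>x. x \<in> unit_ival \<Longrightarrow> p x = q x" "x \<in> unit_ival"
  shows "p differentiable (at x) \<longleftrightarrow> q differentiable (at x)"
  unfolding real_differentiable_def using DERIV_ival_cong[OF assms] by simp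

lemma wsq_cong: "(\<And>x. x \<in> unit_ival \<Longrightarrow> r x = r' x) \<Longrightarrow> wsq s r = wsq s r'"
  by (auto simp: wsq_def fun_eq_iff indicator_def)

lemma wL2_cong:
  assumes "\<And>x. x \<in> unit_ival \<Longrightarrow> r x = r' x"
  shows "wL2 s M r \<longleftrightarrow> wL2 s M r'"
proof -
  have "r \<in> ival_measurable \<longleftrightarrow> r' \<in> ival_measurable"
    by (rule measurable_cong) (use assms in auto)
  moreover have "wsq s r = wsq s r'" by (rule wsq_cong) (rule assms)
  ultimately show ?thesis by (simp add: wL2_def)
qed

lemma wb_cong:
  assumes "\<And>x. x \<in> unit_ival \<Longrightarrow> p x = q x"
  shows "wb n s M p \<longleftrightarrow> wb n s M q"
  using assms
proof (induction n arbitrary: s p q)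
  case 0
  then show ?case using continuous_on_cong[of unit_ival unit_ival p q] by simp
next
  case (Suc n)
  have "wd n (Suc s) M (deriv p) \<longleftrightarrow> wd n (Suc s) M (deriv q)"
    using deriv_ival_cong[OF Suc(2)] Suc(1)[of "deriv p" "deriv q"] wL2_cong[of "deriv p" "deriv q"]
    unfolding wd_def by presburger
  then show ?case using AC_loc0_cong[of p q] differentiable_ival_cong[OF Suc(2)] Suc(2) by (simp add: wb_Suc)
qed

text \<open>Derivatives below the top order exist everywhere, the top one only off a null set; this
  is the role of \<open>A\<close>, which may be nonempty only for \<open>n = 0\<close>. There the
  candidate \<open>q\<close> and \<open>deriv p\<close> agree almost everywhere, and
  \<open>deriv p\<close> is measurable by local absolute continuity of \<open>p\<close>.\<close>

lemma wb_SucI: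
  assumes "p \<in> AC_loc0" "\<And>x. x \<in> unit_ival \<Longrightarrow> rho x ^ s * \<bar>p x\<bar> \<le> M" "negligible A" "0 < n \<longrightarrow> A = {}"
    and D: "\<And>x. x \<in> unit_ival \<Longrightarrow> x \<notin> A \<Longrightarrow> (p has_real_derivative q x) (at x)" and q: "wd n (Suc s) M q"
  shows "wb (Suc n) s M p"
proof -
  have eq: "q x = deriv p x" if "x \<in> unit_ival" "x \<notin> A" for x
    using DERIV_imp_deriv[OF D[OF that]] by simp
  have "wd n (Suc s) M (deriv p)"
  proof (cases "n = 0")
    case True
    then show ?thesis
      using q wL2_cong_ae[OF _ AC_loc0_deriv_measurable[OF assms(1)] assms(3) eq] by (simp add: wd_def)
  next
    case False
    then show ?thesis using q wb_cong[of q "deriv p"] eq assms(4) by (simp add: wd_def)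
  qed
  moreover have "p differentiable (at x)" if "0 < n" "x \<in> unit_ival" for x
    using D[OF that(2)] that(1) assms(4) unfolding real_differentiable_def by blast
  ultimately show ?thesis using assms by (simp add: wb_Suc)
qed

lemma wb_DERIV:
  assumes "wb (Suc n) s M p"
  obtains A where "negligible A" "0 < n \<longrightarrow> A = {}"
    "\<And>x. x \<in> unit_ival \<Longrightarrow> x \<notin> A \<Longrightarrow> (p has_real_derivative deriv p x) (at x)"
proof
  let ?A = "{x \<in> unit_ival. \<not> p differentiable (at x)}"
  show "negligible ?A" by (rule AC_loc0_differentiable_ae[OF wb_AC[OF assms]])
  show "0 < n \<longrightarrow> ?A = {}" using assms by (auto simp: wb_Suc)
  show "(p has_real_derivative deriv p x) (at x)" if "x \<in> unit_ival" "x \<notin> ?A" for x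
    using that by (simp add: DERIV_deriv_iff_real_differentiable)
qed

lemma wb_DERIV2:
  assumes "wb (Suc n) s M p" "wb (Suc n) t N q"
  obtains A where "negligible A" "0 < n \<longrightarrow> A = {}"
    "\<And>x. x \<in> unit_ival \<Longrightarrow> x \<notin> A \<Longrightarrow> (p has_real_derivative deriv p x) (at x)"
    "\<And>x. x \<in> unit_ival \<Longrightarrow> x \<notin> A \<Longrightarrow> (q has_real_derivative deriv q x) (at x)"
proof -
  obtain A where A: "negligible A" "0 < n \<longrightarrow> A = {}"
    "\<And>x. x \<in> unit_ival \<Longrightarrow> x \<notin> A \<Longrightarrow> (p has_real_derivative deriv p x) (at x)"
    using wb_DERIV[OF assms(1)] by blast
  obtain B where B: "negligible B" "0 < n \<longrightarrow> B = {}"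
    "\<And>x. x \<in> unit_ival \<Longrightarrow> x \<notin> B \<Longrightarrow> (q has_real_derivative deriv q x) (at x)"
    using wb_DERIV[OF assms(2)] by blast
  show thesis by (rule that[of "A \<union> B"]) (use A B in auto)
qed

text \<open>The derivative that becomes the top one passes from a pointwise to a square integral
  bound, at the cost of the factor 2 of \<open>wL2_bounded\<close>.\<close>

lemma wb_Suc_imp: "wb (Suc n) s M p \<Longrightarrow> wb n s (2 * M) p"
proof (induction n arbitrary: s p)
  case 0
  then show ?case using wb_nonneg[OF 0] wb_continuous[OF 0] wb_sup[OF 0] by force
next
  case (Suc n)
  have d: "wb (Suc n) (Suc s) M (deriv p)" using wb_deriv[OF Suc(2)] by (simp add: wd_def)
  have "wd n (Suc s) (2 * M) (deriv p)"
    using Suc(1)[OF d] wL2_bounded[OF wb_measurable[OF d] wb_sup[OF d]] by (simp add: wd_def)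
  then show ?case using Suc(2) wb_nonneg[OF Suc(2)] by (force simp: wb_Suc)
qed

lemma wb_add:
  assumes "wb n s M p" "wb n s N q"
  shows "wb n s (2 * (M + N)) (\<lambda>x. p x + q x)"
  using assms
proof (induction n arbitrary: s p q)
  case (0 s p q)
  have "rho x ^ s * \<bar>p x + q x\<bar> \<le> 2 * (M + N)" if x: "x \<in> unit_ival" for x
  proof -
    have "rho x ^ s * \<bar>p x + q x\<bar> \<le> rho x ^ s * (\<bar>p x\<bar> + \<bar>q x\<bar>)"
      using rho_bounds[OF x] by (intro mult_left_mono) auto
    then show ?thesis
      using wb_sup[OF 0(1) x] wb_sup[OF 0(2) x] wb_nonneg[OF 0(1)] wb_nonneg[OF 0(2)] by (simp add: algebra_simps)
  qed
  then show ?case using 0 by (auto intro: continuous_on_add)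
next
  case (Suc n s p q)
  note mn = wb_nonneg[OF Suc(2)] wb_nonneg[OF Suc(3)]
  obtain A where A: "negligible A" "0 < n \<longrightarrow> A = {}"
    "\<And>x. x \<in> unit_ival \<Longrightarrow> x \<notin> A \<Longrightarrow> (p has_real_derivative deriv p x) (at x)"
    "\<And>x. x \<in> unit_ival \<Longrightarrow> x \<notin> A \<Longrightarrow> (q has_real_derivative deriv q x) (at x)"
    using wb_DERIV2[OF Suc(2) Suc(3)] by blast
  show ?case
  proof (rule wb_SucI[OF _ _ A(1,2)])
    show "(\<lambda>x. p x + q x) \<in> AC_loc0" using Suc by (intro AC_loc0_add wb_AC)
    show "rho x ^ s * \<bar>p x + q x\<bar> \<le> 2 * (M + N)" if x: "x \<in> unit_ival" for x
    proof -
      have "rho x ^ s * \<bar>p x + q x\<bar> \<le> rho x ^ s * (\<bar>p x\<bar> + \<bar>q x\<bar>)"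
        using rho_bounds[OF x] by (intro mult_left_mono) auto
      then show ?thesis using wb_sup[OF Suc(2) x] wb_sup[OF Suc(3) x] mn by (simp add: algebra_simps)
    qed
    show "wd n (Suc s) (2 * (M + N)) (\<lambda>x. deriv p x + deriv q x)"
      using wb_deriv[OF Suc(2)] wb_deriv[OF Suc(3)] Suc.IH mn wL2_add by (auto simp: wd_def split: if_splits)
  qed (use A in \<open>auto intro!: DERIV_add\<close>)
qed

lemma wd_add:
  assumes "wd n s M p" "wd n s N q" "0 \<le> M" "0 \<le> N"
  shows "wd n s (2 * (M + N)) (\<lambda>x. p x + q x)"
  using assms wb_add wL2_add by (auto simp: wd_def split: if_splits)

lemma wb_cmult:
  assumes "wb n s M p"
  shows "wb n s (\<bar>c\<bar> * M) (\<lambda>x. c * p x)"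
proof -
  have sup: "rho x ^ s * \<bar>c * p x\<bar> \<le> \<bar>c\<bar> * M" if "wb n s M p" "x \<in> unit_ival" for n s p x
    using mult_left_mono[OF wb_sup[OF that], of "\<bar>c\<bar>"] by (simp add: abs_mult algebra_simps)
  show ?thesis
    using assms
  proof (induction n arbitrary: s p)
    case 0
    then show ?case using sup[OF 0] by (auto intro: continuous_on_mult_left)
  next
    case (Suc n)
    obtain A where A: "negligible A" "0 < n \<longrightarrow> A = {}"
      "\<And>x. x \<in> unit_ival \<Longrightarrow> x \<notin> A \<Longrightarrow> (p has_real_derivative deriv p x) (at x)"
      using wb_DERIV[OF Suc(2)] by blast
    show ?case
    proof (rule wb_SucI[OF _ sup[OF Suc(2)] A(1,2)])
      show "(\<lambda>x. c * p x) \<in> AC_loc0" using Suc by (intro AC_loc0_mult AC_loc0_const wb_AC)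
      show "wd n (Suc s) (\<bar>c\<bar> * M) (\<lambda>x. c * deriv p x)"
        using wb_deriv[OF Suc(2)] Suc.IH wL2_mult_bounded[of "Suc s" M "deriv p" "\<lambda>x. c" 0 "\<bar>c\<bar>"]
        by (auto simp: wd_def split: if_splits)
    qed (use A in \<open>auto intro!: DERIV_cmult\<close>)
  qed
qed

text \<open>In each Leibniz term the undifferentiated factor is used one order lower, where it has a
  pointwise bound, so the other factor may be merely square integrable. Lowering the order costs 2
  in each of the two terms and adding them costs 2 again, which gives 8 per order.\<close>

lemma wb_mult:
  assumes "wb n s M p" "wb n t N q"
  shows "wb n (s + t) (8 ^ n * (M * N)) (\<lambda>x. p x * q x)"
proof -
  have sup: "rho x ^ (s + t) * \<bar>p x * q x\<bar> \<le> 8 ^ n * (M * N)"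
    if p: "wb n s M p" and q: "wb n t N q" and x: "x \<in> unit_ival" for n s t p q x and M N :: real
  proof -
    have "rho x ^ (s + t) * \<bar>p x * q x\<bar> = (rho x ^ s * \<bar>p x\<bar>) * (rho x ^ t * \<bar>q x\<bar>)"
      by (simp add: power_add abs_mult)
    also have "\<dots> \<le> M * N"
      using wb_sup[OF p x] wb_sup[OF q x] wb_nonneg[OF p] rho_bounds[OF x] by (intro mult_mono) auto
    also have "1 * (M * N) \<le> 8 ^ n * (M * N)"
      using wb_nonneg[OF p] wb_nonneg[OF q] by (intro mult_right_mono) auto
    finally show ?thesis by simp
  qed
  show ?thesis
    using assms
  proof (induction n arbitrary: s t p q M N)
    case 0
    then show ?case using sup[OF 0] by (auto intro: continuous_on_mult)
  next
    case (Suc n)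
    note mn = wb_nonneg[OF Suc(2)] wb_nonneg[OF Suc(3)]
    obtain A where A: "negligible A" "0 < n \<longrightarrow> A = {}"
      "\<And>x. x \<in> unit_ival \<Longrightarrow> x \<notin> A \<Longrightarrow> (p has_real_derivative deriv p x) (at x)"
      "\<And>x. x \<in> unit_ival \<Longrightarrow> x \<notin> A \<Longrightarrow> (q has_real_derivative deriv q x) (at x)"
      using wb_DERIV2[OF Suc(2) Suc(3)] by blast
    have wdm: "wd n (s + t) (8 ^ n * (M * N)) (\<lambda>x. p x * q x)" if "wb n s M p" "wd n t N q" for s t p q M N
      using that Suc.IH[OF that(1), of t N q] wL2_mult_bounded[OF _ wb_measurable[OF that(1)] wb_sup[OF that(1)], of t N q]
      by (simp add: wd_def add.commute split: if_splits)
    show ?case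
    proof (rule wb_SucI[OF _ sup[OF Suc(2,3)] A(1,2)])
      show "(\<lambda>x. p x * q x) \<in> AC_loc0" using Suc by (intro AC_loc0_mult wb_AC)
      have "wd n (t + Suc s) (8 ^ n * ((2 * N) * M)) (\<lambda>x. q x * deriv p x)"
        by (intro wdm wb_Suc_imp[OF Suc(3)] wb_deriv[OF Suc(2)])
      moreover have "wd n (s + Suc t) (8 ^ n * ((2 * M) * N)) (\<lambda>x. p x * deriv q x)"
        by (intro wdm wb_Suc_imp[OF Suc(2)] wb_deriv[OF Suc(3)])
      ultimately have "wd n (Suc (s + t)) (2 * (8 ^ n * ((2 * N) * M) + 8 ^ n * ((2 * M) * N))) (\<lambda>x. q x * deriv p x + p x * deriv q x)"
        using mn by (intro wd_add) (auto simp: add.commute)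
      then show "wd n (Suc (s + t)) (8 ^ Suc n * (M * N)) (\<lambda>x. q x * deriv p x + p x * deriv q x)"
        by (simp add: algebra_simps)
      show "((\<lambda>x. p x * q x) has_real_derivative q x * deriv p x + p x * deriv q x) (at x)"
        if "x \<in> unit_ival" "x \<notin> A" for x
        using DERIV_mult[OF A(3)[OF that] A(4)[OF that]] by (simp add: algebra_simps)
    qed
  qed
qed

lemma wd_mult:
  assumes "wb n s M p" "wd n t N q"
  shows "wd n (s + t) (8 ^ n * (M * N)) (\<lambda>x. p x * q x)"
  using assms wb_mult[OF assms(1), of t N q] wL2_mult_bounded[OF _ wb_measurable[OF assms(1)] wb_sup[OF assms(1)], of t N q]
  by (simp add: wd_def add.commute split: if_splits)

section \<open>Superposition with a smooth function\<close>

lemma C_k_on_Suc: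
  assumes "C_k_on (Suc n) U g"
  shows "C_k_on n U (deriv g)" and "x \<in> U \<Longrightarrow> (g has_real_derivative deriv g x) (at x)"
    and "continuous_on U g"
proof -
  have "(deriv ^^ i) (deriv g) = (deriv ^^ Suc i) g" for i by (simp only: funpow_Suc_right o_apply)
  then show "C_k_on n U (deriv g)"
    using assms unfolding C_k_on_def by (metis Suc_less_eq)
  have d: "g differentiable (at x)" if "x \<in> U" for x
    using assms that unfolding C_k_on_def by (metis funpow_0 zero_less_Suc)
  then show "(g has_real_derivative deriv g x) (at x)" if "x \<in> U"
    using that by (simp add: DERIV_deriv_iff_real_differentiable)
  show "continuous_on U g"
    using d by (auto intro!: continuous_at_imp_continuous_on simp: differentiable_imp_continuous_within)
qed

lemma C_k_on_mono:
  assumes "C_k_on n U g" "m \<le> n"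
  shows "C_k_on m U g"
proof (cases "m = n")
  case False
  then have "m < n" using assms by simp
  then have d: "(deriv ^^ m) g differentiable (at x)" if "x \<in> U" for x
    using assms that by (auto simp: C_k_on_def)
  then have "continuous_on U ((deriv ^^ m) g)"
    by (auto intro!: continuous_at_imp_continuous_on simp: differentiable_imp_continuous_within)
  then show ?thesis using assms \<open>m < n\<close> by (auto simp: C_k_on_def)
qed (use assms in simp)

lemma C_k_on_funpow_deriv:
  assumes "C_k_on (n + j) U g"
  shows "C_k_on n U ((deriv ^^ j) g)"
  using assms
proof (induction j arbitrary: g)
  case (Suc j)
  then have "C_k_on n U ((deriv ^^ j) (deriv g))" by (intro Suc(1) C_k_on_Suc(1)) simp
  then show ?case by (simp only: funpow_Suc_right o_apply)
qed simp

section \<open>Mean value estimates on compact intervals\<close>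

lemma C_k_on_bounded:
  assumes "C_k_on n U g" "{\<alpha>..\<beta>} \<subseteq> U"
  obtains B where "B \<ge> 0" "\<And>y. y \<in> {\<alpha>..\<beta>} \<Longrightarrow> \<bar>g y\<bar> \<le> B"
proof -
  have "continuous_on {\<alpha>..\<beta>} g"
    using C_k_on_mono[OF assms(1), of 0] assms(2) by (auto simp: C_k_on_def intro: continuous_on_subset)
  then have "bounded (g ` {\<alpha>..\<beta>})" by (intro compact_imp_bounded compact_continuous_image) auto
  then obtain B where B: "\<forall>y\<in>{\<alpha>..\<beta>}. \<bar>g y\<bar> \<le> B" unfolding bounded_iff by auto
  show thesis by (rule that[of "\<bar>B\<bar>"]) (use B in force)+
qed

lemma C_k_on_lipschitz:
  assumes "C_k_on (Suc n) U g" "{\<alpha>..\<beta>} \<subseteq> U"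
  obtains L where "L \<ge> 0" "\<And>y z. y \<in> {\<alpha>..\<beta>} \<Longrightarrow> z \<in> {\<alpha>..\<beta>} \<Longrightarrow> \<bar>g z - g y\<bar> \<le> L * \<bar>z - y\<bar>"
proof -
  obtain B where B: "B \<ge> 0" "\<And>y. y \<in> {\<alpha>..\<beta>} \<Longrightarrow> \<bar>deriv g y\<bar> \<le> B"
    using C_k_on_bounded[OF C_k_on_Suc(1)[OF assms(1)] assms(2)] by blast
  have "norm (g z - g y) \<le> B * norm (z - y)" if "y \<in> {\<alpha>..\<beta>}" "z \<in> {\<alpha>..\<beta>}" for y z
  proof (rule field_differentiable_bound[of "{\<alpha>..\<beta>}" g "deriv g"])
    show "(g has_field_derivative deriv g x) (at x within {\<alpha>..\<beta>})" if "x \<in> {\<alpha>..\<beta>}" for x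
      using C_k_on_Suc(2)[OF assms(1)] that assms(2) by (blast intro: has_field_derivative_at_within)
  qed (use B that in auto)
  then show thesis using B by (intro that[of B]) auto
qed

text \<open>The mean value bound is applied to \<open>g x - deriv g y * x\<close> between
  \<open>y\<close> and \<open>z\<close>; its slope \<open>deriv g x - deriv g y\<close> is at most
  \<open>L * \<bar>z - y\<bar>\<close> there, since \<open>deriv g\<close> is Lipschitz.\<close>

lemma C_k_on_taylor:
  assumes "C_k_on (Suc (Suc n)) U g" "{\<alpha>..\<beta>} \<subseteq> U"
  obtains L where "L \<ge> 0"
    "\<And>y z. y \<in> {\<alpha>..\<beta>} \<Longrightarrow> z \<in> {\<alpha>..\<beta>} \<Longrightarrow> \<bar>g z - g y - deriv g y * (z - y)\<bar> \<le> L * \<bar>z - y\<bar>\<^sup>2"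
proof -
  obtain L where L: "L \<ge> 0" "\<And>y z. y \<in> {\<alpha>..\<beta>} \<Longrightarrow> z \<in> {\<alpha>..\<beta>} \<Longrightarrow> \<bar>deriv g z - deriv g y\<bar> \<le> L * \<bar>z - y\<bar>"
    using C_k_on_lipschitz[OF C_k_on_Suc(1)[OF assms(1)] assms(2)] by blast
  have "norm ((g z - deriv g y * z) - (g y - deriv g y * y)) \<le> (L * \<bar>z - y\<bar>) * norm (z - y)"
    if yz: "y \<in> {\<alpha>..\<beta>}" "z \<in> {\<alpha>..\<beta>}" for y z
  proof (rule field_differentiable_bound[of "{min y z..max y z}" "\<lambda>x. g x - deriv g y * x" "\<lambda>x. deriv g x - deriv g y"])
    fix x assume x: "x \<in> {min y z..max y z}"
    then have xK: "x \<in> {\<alpha>..\<beta>}" using yz by auto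
    then have "(g has_real_derivative deriv g x) (at x)" using C_k_on_Suc(2)[OF assms(1)] assms(2) by blast
    then have "((\<lambda>x. g x - deriv g y * x) has_real_derivative deriv g x - deriv g y) (at x)"
      by (auto intro!: derivative_eq_intros)
    then show "((\<lambda>x. g x - deriv g y * x) has_field_derivative deriv g x - deriv g y) (at x within {min y z..max y z})"
      by (rule has_field_derivative_at_within)
    have "\<bar>x - y\<bar> \<le> \<bar>z - y\<bar>" using x by auto
    then have "L * \<bar>x - y\<bar> \<le> L * \<bar>z - y\<bar>" using L(1) by (intro mult_left_mono)
    then show "norm (deriv g x - deriv g y) \<le> L * \<bar>z - y\<bar>" using L(2)[OF yz(1) xK] by simp
  qed auto
  moreover have "(g z - deriv g y * z) - (g y - deriv g y * y) = g z - g y - deriv g y * (z - y)" for y z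
    by (simp add: algebra_simps)
  moreover have "L * \<bar>z - y\<bar> * norm (z - y) = L * \<bar>z - y\<bar>\<^sup>2" for y z
    by (simp add: power2_eq_square)
  ultimately have "\<bar>g z - g y - deriv g y * (z - y)\<bar> \<le> L * \<bar>z - y\<bar>\<^sup>2" if "y \<in> {\<alpha>..\<beta>}" "z \<in> {\<alpha>..\<beta>}" for y z
    using that by (metis real_norm_def)
  then show thesis using L(1) that by blast
qed

lemma AC_loc0_diff: "u \<in> AC_loc0 \<Longrightarrow> v \<in> AC_loc0 \<Longrightarrow> (\<lambda>x. u x - v x) \<in> AC_loc0"
  by (rule AC_loc0_dominated[of u v], assumption, assumption, rule exI[of _ 1]) auto

lemma AC_loc0_compose:
  assumes "C_k_on (Suc n) U g" "{\<alpha>..\<beta>} \<subseteq> U" "u \<in> AC_loc0" "u ` unit_ival \<subseteq> {\<alpha>..\<beta>}"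
  shows "(\<lambda>x. g (u x)) \<in> AC_loc0"
proof -
  obtain L where "L \<ge> 0" and L: "\<And>y z. y \<in> {\<alpha>..\<beta>} \<Longrightarrow> z \<in> {\<alpha>..\<beta>} \<Longrightarrow> \<bar>g z - g y\<bar> \<le> L * \<bar>z - y\<bar>"
    using C_k_on_lipschitz[OF assms(1,2)] by blast
  have "\<bar>g (u y) - g (u x)\<bar> \<le> L * \<bar>u y - u x\<bar>" if "x \<in> unit_ival" "y \<in> unit_ival" for x y
    using that assms(4) by (intro L) blast+
  then show ?thesis by (rule AC_loc0_lipschitz[OF assms(3)])
qed

lemma continuous_on_C_k_compose:
  assumes "C_k_on n U g" "{\<alpha>..\<beta>} \<subseteq> U" "continuous_on unit_ival u" "u ` unit_ival \<subseteq> {\<alpha>..\<beta>}"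
  shows "continuous_on unit_ival (\<lambda>x. g (u x))"
proof -
  have "continuous_on U g" using C_k_on_mono[OF assms(1), of 0] by (simp add: C_k_on_def)
  then show ?thesis using assms(2-4) by (intro continuous_on_compose2[of U g unit_ival u]) blast+
qed

lemma DERIV_compose:
  assumes "C_k_on (Suc n) U g" "{\<alpha>..\<beta>} \<subseteq> U" "u x \<in> {\<alpha>..\<beta>}" "(u has_real_derivative u') (at x)"
  shows "((\<lambda>x. g (u x)) has_real_derivative deriv g (u x) * u') (at x)"
  using C_k_on_Suc(2)[OF assms(1), of "u x"] assms DERIV_chain2 by blast

text \<open>By the chain rule the derivative is \<open>deriv g\<close> composed with
  \<open>u\<close>, handled by induction at one order less, times \<open>deriv u\<close>. The bound
  depends on \<open>u\<close> only through \<open>M\<close> and the range; this uniformity is needed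
  when \<open>v\<close> varies near \<open>u\<close>.\<close>

lemma wb_comp:
  assumes "C_k_on n U g" "{\<alpha>..\<beta>} \<subseteq> U" "0 \<le> M"
  shows "\<exists>B\<ge>0. \<forall>u. wb n 0 M u \<longrightarrow> u ` unit_ival \<subseteq> {\<alpha>..\<beta>} \<longrightarrow> wb n 0 B (\<lambda>x. g (u x))"
  using assms
proof (induction n arbitrary: g M)
  case 0
  obtain B where B: "B \<ge> 0" "\<And>y. y \<in> {\<alpha>..\<beta>} \<Longrightarrow> \<bar>g y\<bar> \<le> B"
    using C_k_on_bounded[OF 0(1,2)] by blast
  have "wb 0 0 B (\<lambda>x. g (u x))" if u: "wb 0 0 M u" "u ` unit_ival \<subseteq> {\<alpha>..\<beta>}" for u
    using continuous_on_C_k_compose[OF 0(1,2) wb_continuous[OF u(1)] u(2)] B(2) u(2) by (simp add: image_subset_iff)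
  then show ?case using B(1) by blast
next
  case (Suc n)
  obtain B1 where B1: "B1 \<ge> 0" "\<And>y. y \<in> {\<alpha>..\<beta>} \<Longrightarrow> \<bar>g y\<bar> \<le> B1"
    using C_k_on_bounded[OF Suc(2,3)] by blast
  obtain B2 where B2: "B2 \<ge> 0" "\<And>u. wb n 0 (2 * M) u \<Longrightarrow> u ` unit_ival \<subseteq> {\<alpha>..\<beta>} \<Longrightarrow> wb n 0 B2 (\<lambda>x. deriv g (u x))"
    using Suc(1)[OF C_k_on_Suc(1)[OF Suc(2)] Suc(3), of "2 * M"] Suc(4) by auto
  let ?B = "8 ^ n * (B2 * M)"
  have B: "0 \<le> ?B" using B2 Suc(4) by simp
  have "wb (Suc n) 0 (B1 + ?B) (\<lambda>x. g (u x))" if u: "wb (Suc n) 0 M u" "u ` unit_ival \<subseteq> {\<alpha>..\<beta>}" for u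
  proof -
    obtain A where A: "negligible A" "0 < n \<longrightarrow> A = {}"
      "\<And>x. x \<in> unit_ival \<Longrightarrow> x \<notin> A \<Longrightarrow> (u has_real_derivative deriv u x) (at x)"
      using wb_DERIV[OF u(1)] by blast
    show ?thesis
    proof (rule wb_SucI[OF _ _ A(1,2)])
      show "(\<lambda>x. g (u x)) \<in> AC_loc0" by (intro AC_loc0_compose[OF Suc(2,3) wb_AC[OF u(1)] u(2)])
      show "rho x ^ 0 * \<bar>g (u x)\<bar> \<le> B1 + ?B" if "x \<in> unit_ival" for x
      proof -
        have "\<bar>g (u x)\<bar> \<le> B1" using B1(2) u(2) that by blast
        then have "\<bar>g (u x)\<bar> \<le> B1 + ?B" using B by linarith
        then show ?thesis by simp
      qed
      have "wd n (0 + 1) ?B (\<lambda>x. deriv g (u x) * deriv u x)"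
        using u wb_Suc_imp[OF u(1)] wb_deriv[OF u(1)] by (intro wd_mult B2) auto
      then show "wd n (Suc 0) (B1 + ?B) (\<lambda>x. deriv g (u x) * deriv u x)"
        using B1 B wd_mono by fastforce
      show "((\<lambda>x. g (u x)) has_real_derivative deriv g (u x) * deriv u x) (at x)"
        if "x \<in> unit_ival" "x \<notin> A" for x
        using u(2)[unfolded image_subset_iff] that A(3) by (intro DERIV_compose[OF Suc(2,3)]) auto
    qed
  qed
  moreover have "0 \<le> B1 + ?B" using B1 B by simp
  ultimately show ?case by blast
qed

text \<open>The terms are regrouped so that each has one small factor: the derivative of
  \<open>v - u\<close>, or the difference of \<open>deriv g\<close> at \<open>v\<close> and at
  \<open>u\<close>.\<close>

lemma DERIV_compose_diff:
  assumes g: "C_k_on (Suc n) U g" "{\<alpha>..\<beta>} \<subseteq> U" and r: "u x \<in> {\<alpha>..\<beta>}" "v x \<in> {\<alpha>..\<beta>}"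
    and u: "(u has_real_derivative deriv u x) (at x)" and v: "(v has_real_derivative deriv v x) (at x)"
  shows "((\<lambda>x. g (v x) - g (u x)) has_real_derivative
    deriv g (v x) * deriv (\<lambda>x. v x - u x) x + (deriv g (v x) - deriv g (u x)) * deriv u x) (at x)"
proof -
  have "deriv (\<lambda>x. v x - u x) x = deriv v x - deriv u x"
    by (intro DERIV_imp_deriv DERIV_diff u v)
  moreover have "((\<lambda>x. g (v x) - g (u x)) has_real_derivative deriv g (v x) * deriv v x - deriv g (u x) * deriv u x) (at x)"
    by (intro DERIV_diff DERIV_compose[OF g] r u v)
  moreover have "deriv g (v x) * deriv v x - deriv g (u x) * deriv u x =
      deriv g (v x) * (deriv v x - deriv u x) + (deriv g (v x) - deriv g (u x)) * deriv u x"
    by (simp add: algebra_simps)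
  ultimately show ?thesis by simp
qed

text \<open>Values are estimated by the Lipschitz bound, which explains the extra derivative of
  \<open>g\<close>. Of the two terms of the derivative, one needs the uniform bound for
  \<open>deriv g\<close> composed with \<open>v\<close>, the other the induction hypothesis for
  \<open>deriv g\<close>.\<close>

lemma wb_comp_diff:
  assumes "C_k_on (Suc n) U g" "{\<alpha>..\<beta>} \<subseteq> U" "0 \<le> M"
  shows "\<exists>B\<ge>0. \<forall>u v \<epsilon>. wb n 0 M u \<longrightarrow> wb n 0 M v \<longrightarrow> u ` unit_ival \<subseteq> {\<alpha>..\<beta>} \<longrightarrow>
    v ` unit_ival \<subseteq> {\<alpha>..\<beta>} \<longrightarrow> wb n 0 \<epsilon> (\<lambda>x. v x - u x) \<longrightarrow> wb n 0 (B * \<epsilon>) (\<lambda>x. g (v x) - g (u x))"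
proof -
  have sup: "\<exists>L\<ge>0. \<forall>n u v \<epsilon> x. u ` unit_ival \<subseteq> {\<alpha>..\<beta>} \<longrightarrow> v ` unit_ival \<subseteq> {\<alpha>..\<beta>} \<longrightarrow>
      wb n 0 \<epsilon> (\<lambda>x. v x - u x) \<longrightarrow> x \<in> unit_ival \<longrightarrow> \<bar>g (v x) - g (u x)\<bar> \<le> L * \<epsilon>"
    if g: "C_k_on (Suc n) U g" for n g
  proof -
    obtain L where L: "L \<ge> 0" "\<And>y z. y \<in> {\<alpha>..\<beta>} \<Longrightarrow> z \<in> {\<alpha>..\<beta>} \<Longrightarrow> \<bar>g z - g y\<bar> \<le> L * \<bar>z - y\<bar>"
      using C_k_on_lipschitz[OF g assms(2)] by blast
    have "\<bar>g (v x) - g (u x)\<bar> \<le> L * \<epsilon>"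
      if uv: "u ` unit_ival \<subseteq> {\<alpha>..\<beta>}" "v ` unit_ival \<subseteq> {\<alpha>..\<beta>}" and h: "wb n 0 \<epsilon> (\<lambda>x. v x - u x)"
        and x: "x \<in> unit_ival" for n u v \<epsilon> x
    proof -
      have "\<bar>g (v x) - g (u x)\<bar> \<le> L * \<bar>v x - u x\<bar>" using uv x by (intro L) blast+
      also have "\<dots> \<le> L * \<epsilon>" using L wb_sup[OF h x] by (intro mult_left_mono) auto
      finally show ?thesis .
    qed
    then show ?thesis using L(1) by blast
  qed
  show ?thesis
    using assms
  proof (induction n arbitrary: g M)
    case 0
    obtain L where L: "L \<ge> 0" "\<And>u v \<epsilon> x. u ` unit_ival \<subseteq> {\<alpha>..\<beta>} \<Longrightarrow> v ` unit_ival \<subseteq> {\<alpha>..\<beta>} \<Longrightarrow>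
        wb 0 0 \<epsilon> (\<lambda>x. v x - u x) \<Longrightarrow> x \<in> unit_ival \<Longrightarrow> \<bar>g (v x) - g (u x)\<bar> \<le> L * \<epsilon>"
      using sup[OF 0(1)] by blast
    have "wb 0 0 (L * \<epsilon>) (\<lambda>x. g (v x) - g (u x))"
      if u: "wb 0 0 M u" "u ` unit_ival \<subseteq> {\<alpha>..\<beta>}" and v: "wb 0 0 M v" "v ` unit_ival \<subseteq> {\<alpha>..\<beta>}"
        and h: "wb 0 0 \<epsilon> (\<lambda>x. v x - u x)" for u v \<epsilon>
      using L(2)[OF u(2) v(2) h] continuous_on_C_k_compose[OF 0(1,2) wb_continuous[OF u(1)] u(2)]
        continuous_on_C_k_compose[OF 0(1,2) wb_continuous[OF v(1)] v(2)]
      by (auto intro: continuous_on_diff)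
    then show ?case using L(1) by blast
  next
    case (Suc n)
    note g' = C_k_on_Suc(1)[OF Suc(2)]
    have M2: "0 \<le> 2 * M" using Suc(4) by simp
    obtain L where L: "L \<ge> 0" "\<And>u v \<epsilon> x. u ` unit_ival \<subseteq> {\<alpha>..\<beta>} \<Longrightarrow> v ` unit_ival \<subseteq> {\<alpha>..\<beta>} \<Longrightarrow>
        wb (Suc n) 0 \<epsilon> (\<lambda>x. v x - u x) \<Longrightarrow> x \<in> unit_ival \<Longrightarrow> \<bar>g (v x) - g (u x)\<bar> \<le> L * \<epsilon>"
      using sup[OF Suc(2)] by blast
    obtain L' where L': "L' \<ge> 0" "\<And>u v \<epsilon>. wb n 0 (2 * M) u \<Longrightarrow> wb n 0 (2 * M) v \<Longrightarrow> u ` unit_ival \<subseteq> {\<alpha>..\<beta>} \<Longrightarrow>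
      v ` unit_ival \<subseteq> {\<alpha>..\<beta>} \<Longrightarrow> wb n 0 \<epsilon> (\<lambda>x. v x - u x) \<Longrightarrow> wb n 0 (L' * \<epsilon>) (\<lambda>x. deriv g (v x) - deriv g (u x))"
      using Suc(1)[OF g' Suc(3) M2] by blast
    obtain B2 where B2: "B2 \<ge> 0" "\<And>u. wb n 0 (2 * M) u \<Longrightarrow> u ` unit_ival \<subseteq> {\<alpha>..\<beta>} \<Longrightarrow> wb n 0 B2 (\<lambda>x. deriv g (u x))"
      using wb_comp[OF C_k_on_mono[OF g', of n] Suc(3) M2] by auto
    define K :: real where "K = 8 ^ n"
    have K: "K \<ge> 0" by (simp add: K_def)
    \<comment> \<open>\<open>L\<close> accounts for the values; \<open>K\<close> is the product
      constant, the outer 2 comes from adding the two terms, and the inner 2 from using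
      \<open>v - u\<close> one order lower.\<close>
    define B where "B = L + 2 * (K * B2 + K * (L' * 2 * M))"
    let ?D = "\<lambda>u v x. deriv g (v x) * deriv (\<lambda>x. v x - u x) x + (deriv g (v x) - deriv g (u x)) * deriv u x"
    have "wb (Suc n) 0 (B * \<epsilon>) (\<lambda>x. g (v x) - g (u x))"
      if u: "wb (Suc n) 0 M u" "u ` unit_ival \<subseteq> {\<alpha>..\<beta>}" and v: "wb (Suc n) 0 M v" "v ` unit_ival \<subseteq> {\<alpha>..\<beta>}"
        and h: "wb (Suc n) 0 \<epsilon> (\<lambda>x. v x - u x)" for u v \<epsilon>
    proof -
      have e: "0 \<le> \<epsilon>" by (rule wb_nonneg[OF h])
      have pos: "0 \<le> L * \<epsilon>" "0 \<le> K * (B2 * \<epsilon>)" "0 \<le> K * (L' * (2 * \<epsilon>) * M)" using L L' B2 e K Suc(4) by auto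
      obtain A where A: "negligible A" "0 < n \<longrightarrow> A = {}"
        "\<And>x. x \<in> unit_ival \<Longrightarrow> x \<notin> A \<Longrightarrow> (u has_real_derivative deriv u x) (at x)"
        "\<And>x. x \<in> unit_ival \<Longrightarrow> x \<notin> A \<Longrightarrow> (v has_real_derivative deriv v x) (at x)"
        using wb_DERIV2[OF u(1) v(1)] by blast
      show ?thesis
      proof (rule wb_SucI[OF _ _ A(1,2)])
        show "(\<lambda>x. g (v x) - g (u x)) \<in> AC_loc0"
          by (intro AC_loc0_diff AC_loc0_compose[OF Suc(2,3)] u(2) v(2) wb_AC[OF u(1)] wb_AC[OF v(1)])
        show "rho x ^ 0 * \<bar>g (v x) - g (u x)\<bar> \<le> B * \<epsilon>" if x: "x \<in> unit_ival" for x
          using L(2)[OF u(2) v(2) h x] pos by (simp add: B_def algebra_simps)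
        have "wd n (0 + 1) (K * (B2 * \<epsilon>)) (\<lambda>x. deriv g (v x) * deriv (\<lambda>x. v x - u x) x)"
          unfolding K_def using wb_deriv[OF h] by (intro wd_mult B2 wb_Suc_imp[OF v(1)] v(2)) simp
        moreover have "wd n (0 + 1) (K * (L' * (2 * \<epsilon>) * M)) (\<lambda>x. (deriv g (v x) - deriv g (u x)) * deriv u x)"
          unfolding K_def using wb_deriv[OF u(1)]
          by (intro wd_mult L' wb_Suc_imp[OF u(1)] wb_Suc_imp[OF v(1)] wb_Suc_imp[OF h] u(2) v(2)) simp
        ultimately have "wd n (Suc 0) (2 * (K * (B2 * \<epsilon>) + K * (L' * (2 * \<epsilon>) * M))) (?D u v)"
          using pos by (intro wd_add) auto
        then show "wd n (Suc 0) (B * \<epsilon>) (?D u v)"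
          by (rule wd_mono) (use pos in \<open>auto simp: B_def algebra_simps\<close>)
        show "((\<lambda>x. g (v x) - g (u x)) has_real_derivative ?D u v x) (at x)"
          if "x \<in> unit_ival" "x \<notin> A" for x
          using u(2)[unfolded image_subset_iff] v(2)[unfolded image_subset_iff] that A(3,4) by (intro DERIV_compose_diff[OF Suc(2,3)]) auto
      qed
    qed
    moreover have "0 \<le> B" using L L' B2 K Suc(4) by (simp add: B_def)
    ultimately show ?case by blast
  qed
qed

text \<open>Regrouped so that each term is of second order: the Taylor remainder of
  \<open>deriv g\<close> times \<open>deriv u\<close>, and a product of two first-order
  differences.\<close>

lemma DERIV_compose_taylor:
  assumes g: "C_k_on (Suc (Suc n)) U g" "{\<alpha>..\<beta>} \<subseteq> U" and r: "u x \<in> {\<alpha>..\<beta>}" "v x \<in> {\<alpha>..\<beta>}"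
    and u: "(u has_real_derivative deriv u x) (at x)" and v: "(v has_real_derivative deriv v x) (at x)"
  shows "((\<lambda>x. g (v x) - g (u x) - deriv g (u x) * (v x - u x)) has_real_derivative
    (deriv g (v x) - deriv g (u x) - deriv (deriv g) (u x) * (v x - u x)) * deriv u x +
    (deriv g (v x) - deriv g (u x)) * deriv (\<lambda>x. v x - u x) x) (at x)"
proof -
  have "deriv (\<lambda>x. v x - u x) x = deriv v x - deriv u x"
    by (intro DERIV_imp_deriv DERIV_diff u v)
  moreover have "((\<lambda>x. g (v x) - g (u x) - deriv g (u x) * (v x - u x)) has_real_derivative
     deriv g (v x) * deriv v x - deriv g (u x) * deriv u x -
     (deriv (deriv g) (u x) * deriv u x * (v x - u x) + (deriv v x - deriv u x) * deriv g (u x))) (at x)"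
    by (intro DERIV_diff DERIV_mult DERIV_compose[OF g] DERIV_compose[OF C_k_on_Suc(1)[OF g(1)] g(2)] r u v)
  moreover have "deriv g (v x) * deriv v x - deriv g (u x) * deriv u x -
     (deriv (deriv g) (u x) * deriv u x * (v x - u x) + (deriv v x - deriv u x) * deriv g (u x)) =
    (deriv g (v x) - deriv g (u x) - deriv (deriv g) (u x) * (v x - u x)) * deriv u x +
    (deriv g (v x) - deriv g (u x)) * (deriv v x - deriv u x)"
    by (simp add: algebra_simps)
  ultimately show ?thesis by simp
qed

text \<open>The remainder of \<open>deriv g\<close> is covered by induction and the product of
  differences by \<open>wb_comp_diff\<close>. The second extra derivative of \<open>g\<close> pays
  for the quadratic rate already in the pointwise bound.\<close>

lemma wb_comp_taylor:
  assumes "C_k_on (Suc (Suc n)) U g" "{\<alpha>..\<beta>} \<subseteq> U" "0 \<le> M"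
  shows "\<exists>B\<ge>0. \<forall>u v \<epsilon>. wb n 0 M u \<longrightarrow> wb n 0 M v \<longrightarrow> u ` unit_ival \<subseteq> {\<alpha>..\<beta>} \<longrightarrow>
    v ` unit_ival \<subseteq> {\<alpha>..\<beta>} \<longrightarrow> wb n 0 \<epsilon> (\<lambda>x. v x - u x) \<longrightarrow>
    wb n 0 (B * \<epsilon>\<^sup>2) (\<lambda>x. g (v x) - g (u x) - deriv g (u x) * (v x - u x))"
proof -
  let ?G = "\<lambda>g u v x. g (v x) - g (u x) - deriv g (u x) * (v x - u x)"
  have sup: "\<exists>L\<ge>0. \<forall>n u v \<epsilon> x. u ` unit_ival \<subseteq> {\<alpha>..\<beta>} \<longrightarrow> v ` unit_ival \<subseteq> {\<alpha>..\<beta>} \<longrightarrow>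
      wb n 0 \<epsilon> (\<lambda>x. v x - u x) \<longrightarrow> x \<in> unit_ival \<longrightarrow> \<bar>?G g u v x\<bar> \<le> L * \<epsilon>\<^sup>2"
    if g: "C_k_on (Suc (Suc n)) U g" for n g
  proof -
    obtain L where L: "L \<ge> 0" "\<And>y z. y \<in> {\<alpha>..\<beta>} \<Longrightarrow> z \<in> {\<alpha>..\<beta>} \<Longrightarrow> \<bar>g z - g y - deriv g y * (z - y)\<bar> \<le> L * \<bar>z - y\<bar>\<^sup>2"
      using C_k_on_taylor[OF g assms(2)] by blast
    have "\<bar>?G g u v x\<bar> \<le> L * \<epsilon>\<^sup>2"
      if uv: "u ` unit_ival \<subseteq> {\<alpha>..\<beta>}" "v ` unit_ival \<subseteq> {\<alpha>..\<beta>}" and h: "wb n 0 \<epsilon> (\<lambda>x. v x - u x)"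
        and x: "x \<in> unit_ival" for n u v \<epsilon> x
    proof -
      have "\<bar>?G g u v x\<bar> \<le> L * \<bar>v x - u x\<bar>\<^sup>2" using uv x by (intro L) blast+
      also have "\<dots> \<le> L * \<epsilon>\<^sup>2" using L wb_sup[OF h x] by (intro mult_left_mono power_mono) auto
      finally show ?thesis .
    qed
    then show ?thesis using L(1) by blast
  qed
  show ?thesis
    using assms
  proof (induction n arbitrary: g M)
    case 0
    note g' = C_k_on_Suc(1)[OF 0(1)]
    obtain L where L: "L \<ge> 0" "\<And>u v \<epsilon> x. u ` unit_ival \<subseteq> {\<alpha>..\<beta>} \<Longrightarrow> v ` unit_ival \<subseteq> {\<alpha>..\<beta>} \<Longrightarrow>
        wb 0 0 \<epsilon> (\<lambda>x. v x - u x) \<Longrightarrow> x \<in> unit_ival \<Longrightarrow> \<bar>?G g u v x\<bar> \<le> L * \<epsilon>\<^sup>2"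
      using sup[OF 0(1)] by blast
    have "wb 0 0 (L * \<epsilon>\<^sup>2) (?G g u v)"
      if u: "wb 0 0 M u" "u ` unit_ival \<subseteq> {\<alpha>..\<beta>}" and v: "wb 0 0 M v" "v ` unit_ival \<subseteq> {\<alpha>..\<beta>}"
        and h: "wb 0 0 \<epsilon> (\<lambda>x. v x - u x)" for u v \<epsilon>
      using L(2)[OF u(2) v(2) h] wb_continuous[OF h] continuous_on_C_k_compose[OF g' 0(2) wb_continuous[OF u(1)] u(2)]
        continuous_on_C_k_compose[OF 0(1,2) wb_continuous[OF u(1)] u(2)]
        continuous_on_C_k_compose[OF 0(1,2) wb_continuous[OF v(1)] v(2)]
      by (auto intro!: continuous_on_diff[of _ "\<lambda>x. g (v x) - g (u x)"] continuous_on_diff continuous_on_mult)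
    then show ?case using L(1) by blast
  next
    case (Suc n)
    note g' = C_k_on_Suc(1)[OF Suc(2)]
    have M2: "0 \<le> 2 * M" using Suc(4) by simp
    obtain L where L: "L \<ge> 0" "\<And>u v \<epsilon> x. u ` unit_ival \<subseteq> {\<alpha>..\<beta>} \<Longrightarrow> v ` unit_ival \<subseteq> {\<alpha>..\<beta>} \<Longrightarrow>
        wb (Suc n) 0 \<epsilon> (\<lambda>x. v x - u x) \<Longrightarrow> x \<in> unit_ival \<Longrightarrow> \<bar>?G g u v x\<bar> \<le> L * \<epsilon>\<^sup>2"
      using sup[OF Suc(2)] by blast
    obtain L' where L': "L' \<ge> 0" "\<And>u v \<epsilon>. wb n 0 (2 * M) u \<Longrightarrow> wb n 0 (2 * M) v \<Longrightarrow> u ` unit_ival \<subseteq> {\<alpha>..\<beta>} \<Longrightarrow>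
      v ` unit_ival \<subseteq> {\<alpha>..\<beta>} \<Longrightarrow> wb n 0 \<epsilon> (\<lambda>x. v x - u x) \<Longrightarrow> wb n 0 (L' * \<epsilon>) (\<lambda>x. deriv g (v x) - deriv g (u x))"
      using wb_comp_diff[OF C_k_on_mono[OF g', of "Suc n"] Suc(3) M2] by auto
    obtain T where T: "T \<ge> 0" "\<And>u v \<epsilon>. wb n 0 (2 * M) u \<Longrightarrow> wb n 0 (2 * M) v \<Longrightarrow> u ` unit_ival \<subseteq> {\<alpha>..\<beta>} \<Longrightarrow>
      v ` unit_ival \<subseteq> {\<alpha>..\<beta>} \<Longrightarrow> wb n 0 \<epsilon> (\<lambda>x. v x - u x) \<Longrightarrow> wb n 0 (T * \<epsilon>\<^sup>2) (?G (deriv g) u v)"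
      using Suc(1)[OF g' Suc(3) M2] by blast
    define K :: real where "K = 8 ^ n"
    have K: "K \<ge> 0" by (simp add: K_def)
    \<comment> \<open>The 4 is the square of the factor 2 that \<open>v - u\<close> picks up when
      its order is lowered; the last 2 is this factor to the first power.\<close>
    define B where "B = L + 2 * (K * (T * 4 * M) + K * (L' * 2))"
    let ?D = "\<lambda>u v x. ?G (deriv g) u v x * deriv u x + (deriv g (v x) - deriv g (u x)) * deriv (\<lambda>x. v x - u x) x"
    have "wb (Suc n) 0 (B * \<epsilon>\<^sup>2) (?G g u v)"
      if u: "wb (Suc n) 0 M u" "u ` unit_ival \<subseteq> {\<alpha>..\<beta>}" and v: "wb (Suc n) 0 M v" "v ` unit_ival \<subseteq> {\<alpha>..\<beta>}"
        and h: "wb (Suc n) 0 \<epsilon> (\<lambda>x. v x - u x)" for u v \<epsilon>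
    proof -
      have e: "0 \<le> \<epsilon>" by (rule wb_nonneg[OF h])
      have pos: "0 \<le> L * \<epsilon>\<^sup>2" "0 \<le> K * (T * (2 * \<epsilon>)\<^sup>2 * M)" "0 \<le> K * (L' * (2 * \<epsilon>) * \<epsilon>)" using L L' T e K Suc(4) by auto
      obtain A where A: "negligible A" "0 < n \<longrightarrow> A = {}"
        "\<And>x. x \<in> unit_ival \<Longrightarrow> x \<notin> A \<Longrightarrow> (u has_real_derivative deriv u x) (at x)"
        "\<And>x. x \<in> unit_ival \<Longrightarrow> x \<notin> A \<Longrightarrow> (v has_real_derivative deriv v x) (at x)"
        using wb_DERIV2[OF u(1) v(1)] by blast
      show ?thesis
      proof (rule wb_SucI[OF _ _ A(1,2)])
        show "?G g u v \<in> AC_loc0"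
          by (intro AC_loc0_diff AC_loc0_mult AC_loc0_compose[OF Suc(2,3)] AC_loc0_compose[OF g' Suc(3)]
              u(2) v(2) wb_AC[OF u(1)] wb_AC[OF v(1)])
        show "rho x ^ 0 * \<bar>?G g u v x\<bar> \<le> B * \<epsilon>\<^sup>2" if x: "x \<in> unit_ival" for x
          using L(2)[OF u(2) v(2) h x] pos by (simp add: B_def algebra_simps power2_eq_square)
        have "wd n (0 + 1) (K * (T * (2 * \<epsilon>)\<^sup>2 * M)) (\<lambda>x. ?G (deriv g) u v x * deriv u x)"
          unfolding K_def using wb_deriv[OF u(1)]
          by (intro wd_mult T wb_Suc_imp[OF u(1)] wb_Suc_imp[OF v(1)] wb_Suc_imp[OF h] u(2) v(2)) simp
        moreover have "wd n (0 + 1) (K * (L' * (2 * \<epsilon>) * \<epsilon>)) (\<lambda>x. (deriv g (v x) - deriv g (u x)) * deriv (\<lambda>x. v x - u x) x)"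
          unfolding K_def using wb_deriv[OF h]
          by (intro wd_mult L' wb_Suc_imp[OF u(1)] wb_Suc_imp[OF v(1)] wb_Suc_imp[OF h] u(2) v(2)) simp
        ultimately have "wd n (Suc 0) (2 * (K * (T * (2 * \<epsilon>)\<^sup>2 * M) + K * (L' * (2 * \<epsilon>) * \<epsilon>))) (?D u v)"
          using pos by (intro wd_add) auto
        then show "wd n (Suc 0) (B * \<epsilon>\<^sup>2) (?D u v)"
          by (rule wd_mono) (use pos in \<open>auto simp: B_def algebra_simps power2_eq_square\<close>)
        show "(?G g u v has_real_derivative ?D u v x) (at x)" if "x \<in> unit_ival" "x \<notin> A" for x
          using u(2)[unfolded image_subset_iff] v(2)[unfolded image_subset_iff] that A(3,4) by (intro DERIV_compose_taylor[OF Suc(2,3)]) auto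
      qed
    qed
    moreover have "0 \<le> B" using L L' T K Suc(4) by (simp add: B_def)
    ultimately show ?case by blast
  qed
qed

section \<open>The Sobolev embedding\<close>

lemma AC_loc_iff:
  "u \<in> AC_loc n \<longleftrightarrow> (\<forall>i\<le>n. (deriv ^^ i) u \<in> AC_loc0) \<and>
    (\<forall>i<n. \<forall>x\<in>unit_ival. (deriv ^^ i) u differentiable (at x))"
proof (induction n)
  case (Suc n)
  then show ?case by (auto simp: le_Suc_eq less_Suc_eq simp del: funpow.simps)
qed simp

text \<open>The recursive form suits inductions along the product and chain rules; the unrolled form
  matches the summands of the Sobolev norm.\<close>

lemma wb_iff:
  "wb (Suc n) s M u \<longleftrightarrow> (\<forall>i\<le>n. (deriv ^^ i) u \<in> AC_loc0) \<and>
    (\<forall>i<n. \<forall>x\<in>unit_ival. (deriv ^^ i) u differentiable (at x)) \<and>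
    (\<forall>i\<le>n. \<forall>x\<in>unit_ival. rho x ^ (s + i) * \<bar>(deriv ^^ i) u x\<bar> \<le> M) \<and>
    wL2 (Suc (s + n)) M ((deriv ^^ Suc n) u)"
proof (induction n arbitrary: s u)
  case (Suc n)
  have le: "(\<forall>i\<le>Suc n. P i) \<longleftrightarrow> P 0 \<and> (\<forall>i\<le>n. P (Suc i))" for P
    by (metis Suc_le_mono le0 not0_implies_Suc)
  have lt: "(\<forall>i<Suc n. P i) \<longleftrightarrow> P 0 \<and> (\<forall>i<n. P (Suc i))" for P
    by (rule All_less_Suc2)
  have eq: "(deriv ^^ i) (deriv u) = (deriv ^^ Suc i) u" for i by (simp only: funpow_Suc_right o_apply)
  show ?case unfolding wb_Suc[of "Suc n"] wd_def Suc le lt eq by auto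
qed (simp add: wb_Suc wd_def)

lemma sob_sqnorm_wsq: "sob_sqnorm k u = (\<Sum>j=0..k. \<integral>\<^sup>+x. wsq j ((deriv ^^ j) u) x \<partial>lebesgue)"
  by (simp add: sob_sqnorm_def wsq_def)

lemma sob_norm_nonneg: "0 \<le> sob_norm k u"
  by (simp add: sob_norm_def)

lemma sob_wL2:
  assumes u: "u \<in> sob (Suc n)" and j: "j \<le> Suc n"
  shows "wL2 j (sob_norm (Suc n) u) ((deriv ^^ j) u)"
proof -
  have ac: "(deriv ^^ i) u \<in> AC_loc0" if "i \<le> n" for i
    using u that by (auto simp: sob_def AC_loc_iff)
  have "(deriv ^^ j) u \<in> ival_measurable"
  proof (cases "j = Suc n")
    case True
    then show ?thesis using AC_loc0_deriv_measurable[OF ac[of n]] by simp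
  next
    case False
    then show ?thesis using j by (intro AC_loc0_measurable ac) auto
  qed
  moreover have "(\<integral>\<^sup>+x. wsq j ((deriv ^^ j) u) x \<partial>lebesgue) \<le> sob_sqnorm (Suc n) u"
    unfolding sob_sqnorm_wsq using j by (intro member_le_sum) auto
  moreover have "sob_sqnorm (Suc n) u = ennreal ((sob_norm (Suc n) u)\<^sup>2)"
    using u by (simp add: sob_norm_def sob_def)
  ultimately show ?thesis by (simp add: wL2_def)
qed

text \<open>Each of the \<open>n + 2\<close> summands of the squared norm is at most
  \<open>(2 * M)\<^sup>2\<close>, below top order because pointwise bounds integrate over a bounded
  interval. Replacing \<open>n + 2\<close> by its square makes the root explicit.\<close>

lemma wb_imp_sob:
  assumes wb: "wb (Suc n) 0 M u" and z: "\<And>x. x \<notin> unit_ival \<Longrightarrow> u x = 0"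
  shows "u \<in> sob (Suc n)" and "sob_norm (Suc n) u \<le> 2 * (real n + 2) * M"
proof -
  note w = wb[unfolded wb_iff]
  have M: "0 \<le> M" by (rule wb_nonneg[OF wb])
  have t: "(\<integral>\<^sup>+x. wsq j ((deriv ^^ j) u) x \<partial>lebesgue) \<le> ennreal ((2 * M)\<^sup>2)" if "j \<le> Suc n" for j
  proof (cases "j = Suc n")
    case True
    have "wL2 (Suc n) M ((deriv ^^ Suc n) u)" using w by simp
    then have "wL2 (Suc n) (2 * M) ((deriv ^^ Suc n) u)" using M by (rule wL2_mono) (use M in simp)
    then show ?thesis unfolding True wL2_def by blast
  next
    case False
    then have "j \<le> n" using that by simp
    then have "wL2 j (2 * M) ((deriv ^^ j) u)"
      using w by (intro wL2_bounded AC_loc0_measurable) auto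
    then show ?thesis unfolding wL2_def by blast
  qed
  have "sob_sqnorm (Suc n) u \<le> (\<Sum>j=0..Suc n. ennreal ((2 * M)\<^sup>2))"
    unfolding sob_sqnorm_wsq by (intro sum_mono t) auto
  also have "\<dots> = ennreal (\<Sum>j=0..Suc n. (2 * M)\<^sup>2)" by (rule sum_ennreal) simp
  also have "(\<Sum>j=0..Suc n. (2 * M)\<^sup>2) = (real n + 2) * (2 * M)\<^sup>2" by simp
  finally have s: "sob_sqnorm (Suc n) u \<le> ennreal ((real n + 2) * (2 * M)\<^sup>2)" .
  then have "sob_sqnorm (Suc n) u < \<infinity>" by (rule order.strict_trans1) simp
  then show "u \<in> sob (Suc n)" using w z by (auto simp: sob_def AC_loc_iff)
  have "enn2real (sob_sqnorm (Suc n) u) \<le> (real n + 2) * (2 * M)\<^sup>2"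
    using s by (intro enn2real_leI) auto
  also have "\<dots> \<le> (real n + 2) * (real n + 2) * (2 * M)\<^sup>2"
    by (intro mult_right_mono) auto
  also have "\<dots> = (2 * (real n + 2) * M)\<^sup>2" by (simp add: power2_eq_square algebra_simps)
  finally show "sob_norm (Suc n) u \<le> 2 * (real n + 2) * M"
    unfolding sob_norm_def using M by (intro real_le_lsqrt) auto
qed

section \<open>Pointwise bounds from weighted square integrals\<close>

lemma AC_loc0_weight: "(\<lambda>x. (1 - x\<^sup>2) ^ i) \<in> AC_loc0"
proof (induction i)
  case 0
  then show ?case using AC_loc0_const[of 1] by simp
next
  case (Suc i)
  have "(\<lambda>x::real. x) \<in> AC_loc0"
  proof (rule AC_loc0I, rule abs_cont_onI)
    fix a b \<epsilon> :: real assume \<epsilon>: "\<epsilon> > 0"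
    have "(\<Sum>(p, q)\<in>P. \<bar>q - p\<bar>) = len_sum P" if "intervals_in {a..b} P" for P
      by (rule sum.cong) (use that in \<open>auto simp: intervals_in_def\<close>)
    then show "\<exists>\<delta>>0. \<forall>P. intervals_in {a..b} P \<longrightarrow> len_sum P < \<delta> \<longrightarrow> (\<Sum>(p, q)\<in>P. \<bar>q - p\<bar>) < \<epsilon>"
      using \<epsilon> by (intro exI[of _ \<epsilon>]) simp
  qed
  then have "(\<lambda>x::real. 1 - x * x) \<in> AC_loc0" by (intro AC_loc0_diff AC_loc0_mult AC_loc0_const)
  then have "(\<lambda>x. (1 - x * x) * (1 - x\<^sup>2) ^ i) \<in> AC_loc0" using Suc by (intro AC_loc0_mult)
  then show ?case by (simp add: power2_eq_square)
qed

text \<open>Translates the extended-valued Lebesgue integral over the open interval into gauge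
  integrals over compact subintervals, to which the fundamental theorem refers.\<close>

lemma wL2_integral_bound:
  assumes r: "wL2 s N r" and ab: "-1 < a" "b < 1"
  shows "(\<lambda>x. (1 - x\<^sup>2) ^ s * (r x)\<^sup>2) integrable_on {a..b}"
    and "integral {a..b} (\<lambda>x. (1 - x\<^sup>2) ^ s * (r x)\<^sup>2) \<le> N\<^sup>2"
proof -
  let ?h = "\<lambda>x. (1 - x\<^sup>2) ^ s * (r x)\<^sup>2"
  have sub: "{a..b} \<subseteq> unit_ival" using ab by auto
  have m: "(\<lambda>x. enn2real (wsq s r x)) \<in> borel_measurable (lebesgue_on {a..b})"
    using wsq_measurable[of r s] r by (intro measurable_restrict_space1 borel_measurable_enn2real) (auto simp: wL2_def)
  have eq: "enn2real (wsq s r x) = ?h x" if "x \<in> {a..b}" for x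
  proof -
    have "x \<in> unit_ival" using that sub by blast
    then show ?thesis using weight_nonneg[of x s] by (simp add: wsq_def)
  qed
  have m': "?h \<in> borel_measurable (lebesgue_on {a..b})"
    using m by (rule iffD1[OF measurable_cong, rotated]) (use eq in auto)
  have nn: "0 \<le> ?h x" if "x \<in> {a..b}" for x
    using weight_nonneg[of x s] that sub by auto
  have "(\<integral>\<^sup>+x. ennreal (?h x) \<partial>lebesgue_on {a..b}) = (\<integral>\<^sup>+x. ennreal (?h x) * indicator {a..b} x \<partial>lebesgue)"
    by (rule nn_integral_restrict_space) simp
  also have "\<dots> \<le> (\<integral>\<^sup>+x. wsq s r x \<partial>lebesgue)"
    using sub by (intro nn_integral_mono) (auto simp: wsq_def indicator_def)
  also have "\<dots> \<le> ennreal (N\<^sup>2)" using r by (simp add: wL2_def)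
  finally have le: "(\<integral>\<^sup>+x. ennreal (?h x) \<partial>lebesgue_on {a..b}) \<le> ennreal (N\<^sup>2)" .
  have AEnn: "AE x in lebesgue_on {a..b}. 0 \<le> ?h x" using nn by (intro AE_I2) simp
  have int: "integrable (lebesgue_on {a..b}) ?h"
    using m' AEnn le by (intro integrableI_nonneg) (auto intro: order.strict_trans1)
  then show "?h integrable_on {a..b}" by (rule integrable_on_lebesgue_on) simp
  have "ennreal (integral\<^sup>L (lebesgue_on {a..b}) ?h) \<le> ennreal (N\<^sup>2)"
    using nn_integral_eq_integral[OF int AEnn] le by simp
  then have "integral\<^sup>L (lebesgue_on {a..b}) ?h \<le> N\<^sup>2" by (simp add: ennreal_le_iff)
  then show "integral {a..b} ?h \<le> N\<^sup>2" using lebesgue_integral_eq_integral[OF int] by simp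
qed

lemma AC_loc0_increment_le:
  assumes q: "q \<in> AC_loc0" and ab: "-1 < a" "a \<le> b" "b < 1" and g: "g integrable_on {a..b}"
    and A: "negligible A" "\<And>x. x \<in> {a..b} \<Longrightarrow> x \<notin> A \<Longrightarrow> \<exists>d. (q has_real_derivative d) (at x) \<and> d \<le> g x"
  shows "q b - q a \<le> integral {a..b} g"
proof -
  \<comment> \<open>On the null set \<open>A\<close> the integrand is replaced by \<open>g\<close>,
    so that the comparison holds at every point without changing the integral.\<close>
  let ?f = "\<lambda>x. if x \<in> A then g x else deriv q x"
  have "(deriv q has_integral (q b - q a)) {a..b}"
    using AC_loc0D[OF q] ab by (intro abs_cont_on_ftc) auto
  then have "(?f has_integral (q b - q a)) {a..b}"
    by (rule has_integral_spike[OF A(1), rotated]) simp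
  moreover have "(g has_integral (integral {a..b} g)) {a..b}" using g by (rule integrable_integral)
  moreover have "?f x \<le> g x" if "x \<in> {a..b}" for x
    using A(2)[OF that] by (auto dest: DERIV_imp_deriv)
  ultimately show ?thesis by (rule has_integral_le)
qed

text \<open>On an interval of length 1 the minimum of a continuous function is at most its integral.
  The point found is the start from which growth towards the endpoints is estimated.\<close>

lemma small_value_near_0:
  assumes p: "p \<in> AC_loc0" "wL2 i N p"
  obtains y where "y \<in> {-1/2..1/2}" "(1 - y\<^sup>2) ^ i * (p y)\<^sup>2 \<le> N\<^sup>2"
proof -
  let ?q = "\<lambda>x. (1 - x\<^sup>2) ^ i * (p x)\<^sup>2"
  have "continuous_on {-1/2..1/2} p"
    using AC_loc0_continuous_on[OF p(1)] by (rule continuous_on_subset) auto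
  then have "continuous_on {-1/2..1/2} ?q" by (intro continuous_intros)
  then obtain y where y: "y \<in> {-1/2..1/2}" "\<And>x. x \<in> {-1/2..1/2} \<Longrightarrow> ?q y \<le> ?q x"
    using continuous_attains_inf[of "{-1/2..1/2::real}" ?q] by auto
  have "((\<lambda>x::real. ?q y) has_integral (measure lborel {-1/2..1/2::real} *\<^sub>R ?q y)) {-1/2..1/2}"
    by (rule has_integral_const_real)
  moreover have "(?q has_integral (integral {-1/2..1/2} ?q)) {-1/2..1/2}"
    by (intro integrable_integral wL2_integral_bound(1)[OF p(2)]) auto
  ultimately have "measure lborel {-1/2..1/2::real} *\<^sub>R ?q y \<le> integral {-1/2..1/2} ?q"
    using y(2) by (rule has_integral_le)
  also have "\<dots> \<le> N\<^sup>2" by (rule wL2_integral_bound(2)[OF p(2)]) auto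
  finally show thesis using y(1) by (intro that[of y]) auto
qed

text \<open>
  The derivative of \<open>(1 - x\<^sup>2)\<^sup>i p\<^sup>2\<close> is at most \<open>(1 - x\<^sup>2)\<^sup>i\<^sup>+\<^sup>1 p'\<^sup>2 + (1 - 2 i x) (1 - x\<^sup>2)\<^sup>i\<^sup>-\<^sup>1 p\<^sup>2\<close>: for \<open>i \<ge> 1\<close> the
  second term is negative when \<open>x \<ge> 1/2\<close>, and away from the endpoints the missing factor
  \<open>1 - x\<^sup>2\<close> is harmless.
\<close>

lemma weighted_square_derivative:
  assumes i: "i \<ge> 1" and x: "x \<in> unit_ival" and p: "(p has_real_derivative p') (at x)"
  shows "\<exists>d. ((\<lambda>x. (1 - x\<^sup>2) ^ i * (p x)\<^sup>2) has_real_derivative d) (at x) \<and>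
    (x \<ge> -1/2 \<longrightarrow> d \<le> (1 - x\<^sup>2) ^ Suc i * p'\<^sup>2 + 4 / 3 * (1 + real i) * ((1 - x\<^sup>2) ^ i * (p x)\<^sup>2)) \<and>
    (x \<le> 1/2 \<longrightarrow> - d \<le> (1 - x\<^sup>2) ^ Suc i * p'\<^sup>2 + 4 / 3 * (1 + real i) * ((1 - x\<^sup>2) ^ i * (p x)\<^sup>2))"
proof -
  define W where "W = 1 - x\<^sup>2"
  obtain j where j: "i = Suc j" using i by (cases i) auto
  define V where "V = W ^ j"
  have W: "W > 0" using x unfolding W_def by (auto simp: abs_square_less_1)
  then have V: "V \<ge> 0" by (simp add: V_def)
  have "x\<^sup>2 \<le> (1/2)\<^sup>2" if "\<bar>x\<bar> \<le> 1/2" using that by (metis abs_ge_zero power2_abs power_mono)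
  then have W34: "W \<ge> 3/4" if "\<bar>x\<bar> \<le> 1/2" using that by (simp add: W_def power2_eq_square)
  let ?d = "real i * V * (- 2 * x) * (p x)\<^sup>2 + W * V * (2 * p x * p')"
  have D: "((\<lambda>x. (1 - x\<^sup>2) ^ i * (p x)\<^sup>2) has_real_derivative ?d) (at x)"
    unfolding j V_def W_def
    by (rule derivative_eq_intros p refl | simp add: algebra_simps)+
  \<comment> \<open>The inequality \<open>2 a b <= a^2 + b^2\<close> with
    \<open>a = \<bar>p x\<bar>\<close> and \<open>b = W * \<bar>p'\<bar>\<close>, which puts the
    higher weight on the derivative.\<close>
  have key: "W * V * \<bar>2 * p x * p'\<bar> \<le> W * W * V * p'\<^sup>2 + V * (p x)\<^sup>2"
  proof -
    have "W * \<bar>2 * p x * p'\<bar> \<le> W * W * p'\<^sup>2 + (p x)\<^sup>2"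
      using sum_squares_bound[of "\<bar>p x\<bar>" "W * \<bar>p'\<bar>"] W by (simp add: abs_mult power2_eq_square algebra_simps)
    from mult_left_mono[OF this V] show ?thesis by (simp add: algebra_simps)
  qed
  \<comment> \<open>\<open>t\<close> covers both directions of growth. For
    \<open>\<bar>x\<bar> \<le> 1/2\<close> the missing factor \<open>W\<close> is supplied by
    \<open>4 / 3 * W \<ge> 1\<close>; beyond that, moving outwards, \<open>t\<close> is at most
    \<open>- i\<close>, hence at most -1.\<close>
  have rest: "(1 + t) * V * (p x)\<^sup>2 \<le> 4 / 3 * (1 + real i) * (W * V * (p x)\<^sup>2)"
    if t: "t = - 2 * real i * x \<and> x \<ge> -1/2 \<or> t = 2 * real i * x \<and> x \<le> 1/2" for t
  proof (cases "\<bar>x\<bar> \<le> 1/2")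
    case True
    have "real i * (2 * x) \<le> real i * 1" "real i * (- 2 * x) \<le> real i * 1"
      using True by (intro mult_left_mono; auto)+
    then have "1 + t \<le> 1 + real i" using t by auto
    also have "\<dots> \<le> 4 / 3 * (1 + real i) * W"
      using mult_left_mono[OF W34[OF True], of "4 / 3 * (1 + real i)"] by simp
    finally have "(1 + t) * (V * (p x)\<^sup>2) \<le> (4 / 3 * (1 + real i) * W) * (V * (p x)\<^sup>2)"
      using V by (intro mult_right_mono) auto
    then show ?thesis by (simp add: algebra_simps)
  next
    case False
    have "real i * 1 \<le> real i * \<bar>2 * x\<bar>" using False by (intro mult_left_mono) auto
    moreover have "1 \<le> real i" using i by simp
    moreover have "t = - (real i * \<bar>2 * x\<bar>)" using t False by (auto simp: abs_if)
    ultimately have "1 + t \<le> 0" by linarith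
    then have "(1 + t) * (V * (p x)\<^sup>2) \<le> 0" using V by (intro mult_nonpos_nonneg) auto
    moreover have "0 \<le> 4 / 3 * (1 + real i) * (W * V * (p x)\<^sup>2)" using W V by auto
    ultimately show ?thesis by (simp add: algebra_simps)
  qed
  have e: "(1 - x\<^sup>2) ^ i = W * V" "(1 - x\<^sup>2) ^ Suc i = W * W * V" by (auto simp: j V_def W_def)
  have WV: "0 \<le> W * V" using W V by simp
  have ab: "W * V * (2 * p x * p') \<le> W * V * \<bar>2 * p x * p'\<bar>"
    "- (W * V * (2 * p x * p')) \<le> W * V * \<bar>2 * p x * p'\<bar>"
    using mult_left_mono[OF abs_ge_self WV] mult_left_mono[OF abs_ge_minus_self WV, of "2 * p x * p'"]
    by (simp_all only: mult_minus_right)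
  show ?thesis
  proof (rule exI[of _ ?d], intro conjI impI D, unfold e)
    assume "x \<ge> -1/2"
    then have "(1 + (- 2 * real i * x)) * V * (p x)\<^sup>2 \<le> 4 / 3 * (1 + real i) * (W * V * (p x)\<^sup>2)" by (intro rest) auto
    moreover have "(1 + (- 2 * real i * x)) * V * (p x)\<^sup>2 = V * (p x)\<^sup>2 + real i * V * (- 2 * x) * (p x)\<^sup>2"
      by (simp add: algebra_simps)
    ultimately show "?d \<le> W * W * V * p'\<^sup>2 + 4 / 3 * (1 + real i) * (W * V * (p x)\<^sup>2)"
      using key ab by linarith
  next
    assume "x \<le> 1/2"
    then have "(1 + 2 * real i * x) * V * (p x)\<^sup>2 \<le> 4 / 3 * (1 + real i) * (W * V * (p x)\<^sup>2)" by (intro rest) auto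
    moreover have "(1 + 2 * real i * x) * V * (p x)\<^sup>2 = V * (p x)\<^sup>2 - real i * V * (- 2 * x) * (p x)\<^sup>2"
      by (simp add: algebra_simps)
    ultimately show "- ?d \<le> W * W * V * p'\<^sup>2 + 4 / 3 * (1 + real i) * (W * V * (p x)\<^sup>2)"
      using key ab by linarith
  qed
qed

text \<open>The weighted square \<open>q\<close> is at most \<open>N\<^sup>2\<close> at some
  \<open>y\<close> in the middle half, and its growth from \<open>y\<close> outwards is at most the
  integral of \<open>g\<close>, bounded by the two square integrals. The path to the right stays
  above -1/2 and the path to the left below 1/2, as the derivative bound demands.\<close>

lemma weighted_sup_bound:
  assumes i: "i \<ge> 1" and p: "p \<in> AC_loc0" "wL2 i N p" "wL2 (Suc i) N (deriv p)" and N: "0 \<le> N"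
    and x: "x \<in> unit_ival"
  shows "rho x ^ i * \<bar>p x\<bar> \<le> (3 + 2 * real i) * N"
proof -
  define q where "q = (\<lambda>x. (1 - x\<^sup>2) ^ i * (p x)\<^sup>2)"
  define g where "g = (\<lambda>x. (1 - x\<^sup>2) ^ Suc i * (deriv p x)\<^sup>2 + 4 / 3 * (1 + real i) * ((1 - x\<^sup>2) ^ i * (p x)\<^sup>2))"
  define c where "c = (1 + 4 / 3 * (1 + real i)) * N\<^sup>2"
  define A where "A = {x \<in> unit_ival. \<not> p differentiable (at x)}"
  have A: "negligible A" unfolding A_def by (rule AC_loc0_differentiable_ae[OF p(1)])
  have q: "q \<in> AC_loc0"
    unfolding q_def power2_eq_square[of "p _"] using p by (intro AC_loc0_mult AC_loc0_weight)
  have g: "g integrable_on {a..b}" "integral {a..b} g \<le> c" if "-1 < a" "b < 1" for a b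
  proof -
    note b1 = wL2_integral_bound[OF p(2) that] and b2 = wL2_integral_bound[OF p(3) that]
    have b1': "(\<lambda>x. 4 / 3 * (1 + real i) * ((1 - x\<^sup>2) ^ i * (p x)\<^sup>2)) integrable_on {a..b}"
      by (intro integrable_on_mult_right b1)
    show "g integrable_on {a..b}" unfolding g_def by (intro integrable_add b1' b2)
    have "integral {a..b} g = integral {a..b} (\<lambda>x. (1 - x\<^sup>2) ^ Suc i * (deriv p x)\<^sup>2) +
        4 / 3 * (1 + real i) * integral {a..b} (\<lambda>x. (1 - x\<^sup>2) ^ i * (p x)\<^sup>2)"
      unfolding g_def integral_add[OF b2(1) b1'] integral_mult_right by simp
    also have "\<dots> \<le> N\<^sup>2 + 4 / 3 * (1 + real i) * N\<^sup>2"
      by (intro add_mono mult_left_mono b1 b2) auto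
    finally show "integral {a..b} g \<le> c" by (simp add: c_def algebra_simps)
  qed
  have D: "(p has_real_derivative deriv p x) (at x)" if "x \<in> unit_ival" "x \<notin> A" for x
    using that by (simp add: A_def DERIV_deriv_iff_real_differentiable)
  obtain y where y: "y \<in> {-1/2..1/2}" "q y \<le> N\<^sup>2"
    using small_value_near_0[OF p(1,2)] unfolding q_def by blast
  have yI: "-1 < y" "y < 1" using y by auto
  have "q x - q y \<le> c"
  proof (cases "y \<le> x")
    case True
    have "q x - q y \<le> integral {y..x} g"
    proof (rule AC_loc0_increment_le[OF q yI(1) True _ _ A])
      show "\<exists>d. (q has_real_derivative d) (at z) \<and> d \<le> g z" if "z \<in> {y..x}" "z \<notin> A" for z
      proof -
        have z: "z \<in> unit_ival" "z \<ge> -1/2" using that x y by auto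
        show ?thesis
          using weighted_square_derivative[OF i z(1) D[OF z(1) that(2)]] z(2) unfolding q_def g_def by blast
      qed
    qed (use x yI in \<open>auto intro: g\<close>)
    then show ?thesis using g(2)[of y x] x yI by auto
  next
    case False
    have "(- 1) * q y - (- 1) * q x \<le> integral {x..y} g"
    proof (rule AC_loc0_increment_le[where q = "\<lambda>x. (- 1) * q x", OF _ _ _ _ _ A])
      show "(\<lambda>x. (- 1) * q x) \<in> AC_loc0" using q by (intro AC_loc0_mult AC_loc0_const)
      show "\<exists>d. ((\<lambda>x. (- 1) * q x) has_real_derivative d) (at z) \<and> d \<le> g z" if "z \<in> {x..y}" "z \<notin> A" for z
      proof -
        have z: "z \<in> unit_ival" "z \<le> 1/2" "z \<notin> A" using that x y by auto
        obtain d where d: "(q has_real_derivative d) (at z)" "- d \<le> g z"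
          using weighted_square_derivative[OF i z(1) D[OF z(1,3)]] z(2) unfolding q_def g_def by blast
        then show ?thesis using DERIV_cmult[OF d(1), of "- 1"] by (intro exI[of _ "- d"]) simp
      qed
    qed (use x yI False in \<open>auto intro: g\<close>)
    then show ?thesis using g(2)[of x y] x yI by auto
  qed
  then have "q x \<le> (2 + 4 / 3 * (1 + real i)) * N\<^sup>2" using y(2) by (simp add: c_def algebra_simps)
  \<comment> \<open>Enlarged to a perfect square so that the root can be taken.\<close>
  also have "\<dots> \<le> (3 + 2 * real i)\<^sup>2 * N\<^sup>2"
    by (intro mult_right_mono) (auto simp: power2_eq_square algebra_simps)
  also have "\<dots> = ((3 + 2 * real i) * N)\<^sup>2" by (simp add: power_mult_distrib)
  also have "q x = (rho x ^ i * \<bar>p x\<bar>)\<^sup>2" using rho_power[OF x, of i] by (simp add: q_def power_mult_distrib)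
  finally show ?thesis by (rule power2_le_imp_le) (use N in simp)
qed

text \<open>\<open>arcsin\<close> is an antiderivative of 1 / rho, so
  \<open>C * arcsin z - u z\<close> is nondecreasing.\<close>

lemma DERIV_bounded_by_rho_increment:
  assumes d: "\<And>z. z \<in> unit_ival \<Longrightarrow> (u has_real_derivative u' z) (at z)"
    and b: "\<And>z. z \<in> unit_ival \<Longrightarrow> rho z * \<bar>u' z\<bar> \<le> C"
    and xy: "-1 < y" "y \<le> x" "x < 1"
  shows "u x - u y \<le> C * (arcsin x - arcsin y)"
proof -
  have "C * arcsin y - u y \<le> C * arcsin x - u x"
  proof (rule DERIV_nonneg_imp_nondecreasing[of y x "\<lambda>z. C * arcsin z - u z"])
    fix z assume "y \<le> z" "z \<le> x"
    then have z: "z \<in> unit_ival" using xy by auto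
    have "((\<lambda>z. C * arcsin z - u z) has_real_derivative C * inverse (sqrt (1 - z\<^sup>2)) - u' z) (at z)"
      using z by (intro DERIV_diff DERIV_cmult DERIV_arcsin d) auto
    moreover have "u' z \<le> C * inverse (sqrt (1 - z\<^sup>2))"
    proof -
      have "rho z * u' z \<le> rho z * \<bar>u' z\<bar>" using rho_bounds[OF z] by (intro mult_left_mono) auto
      also have "\<dots> \<le> C" by (rule b[OF z])
      finally have "u' z \<le> C / rho z" using rho_bounds[OF z] by (simp add: field_simps)
      then show ?thesis by (simp add: rho_def divide_inverse)
    qed
    ultimately show "\<exists>d. ((\<lambda>z. C * arcsin z - u z) has_real_derivative d) (at z) \<and> 0 \<le> d"
      by (intro exI[of _ "C * inverse (sqrt (1 - z\<^sup>2)) - u' z"]) auto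
  qed (use xy in auto)
  then show ?thesis by (simp add: algebra_simps)
qed

text \<open>The weighted square argument relies on the decay of the weight at the endpoints, absent
  at order 0. Here the pointwise bound on the first derivative takes over: \<open>arcsin\<close>
  varies by at most \<open>pi\<close>, which is less than 4, and \<open>u\<close> is at most
  \<open>N\<close> in modulus at some middle point.\<close>

lemma unweighted_sup_bound:
  assumes u: "u \<in> AC_loc0" "wL2 0 N u" and N: "0 \<le> N"
    and d: "\<And>z. z \<in> unit_ival \<Longrightarrow> (u has_real_derivative u' z) (at z)"
    and b: "\<And>z. z \<in> unit_ival \<Longrightarrow> rho z * \<bar>u' z\<bar> \<le> C"
    and x: "x \<in> unit_ival"
  shows "\<bar>u x\<bar> \<le> N + 4 * C"
proof -
  have C: "0 \<le> C" using b[of 0] by (simp add: rho_def)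
  obtain y where y: "y \<in> {-1/2..1/2}" "(u y)\<^sup>2 \<le> N\<^sup>2"
    using small_value_near_0[OF u] by auto
  then have uy: "\<bar>u y\<bar> \<le> N" using N by (metis abs_le_square_iff abs_of_nonneg)
  have inc: "\<bar>u t - u s\<bar> \<le> 4 * C" if "-1 < s" "s \<le> t" "t < 1" for s t
  proof -
    have "u t - u s \<le> C * (arcsin t - arcsin s)"
      using that by (intro DERIV_bounded_by_rho_increment[OF d b]) auto
    moreover have "- u t - - u s \<le> C * (arcsin t - arcsin s)"
      using that d b by (intro DERIV_bounded_by_rho_increment[of "\<lambda>z. - u z" "\<lambda>z. - u' z"] DERIV_minus) auto
    moreover have "arcsin t \<le> pi / 2" "- (pi / 2) \<le> arcsin s"
      using that by (intro arcsin_ubound arcsin_lbound; simp)+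
    then have "arcsin t - arcsin s \<le> 4" using pi_less_4 by linarith
    then have "C * (arcsin t - arcsin s) \<le> C * 4" using C by (intro mult_left_mono)
    ultimately show ?thesis by (auto simp: abs_le_iff)
  qed
  have "\<bar>u x - u y\<bar> \<le> 4 * C"
  proof (cases "y \<le> x")
    case True
    then show ?thesis using inc[of y x] x y by auto
  next
    case False
    then show ?thesis using inc[of x y] x y by (auto simp: abs_minus_commute)
  qed
  then show ?thesis using uy by linarith
qed

text \<open>The bound \<open>N + 4 * C\<close> of \<open>unweighted_sup_bound\<close>, where
  \<open>C\<close> is the constant of \<open>weighted_sup_bound\<close> at index
  \<open>n + 1\<close> times \<open>N\<close>; it dominates the constants of all orders.\<close>

definition emb_const :: "nat \<Rightarrow> real" where
  "emb_const n = 1 + 4 * (3 + 2 * (real n + 1))"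

lemma emb_const_pos: "0 < emb_const n"
  by (simp add: emb_const_def add_pos_nonneg)

text \<open>Orders 1 to \<open>n\<close> get pointwise bounds from the square integrals of two
  consecutive derivatives, and order 0 from the bound at order 1. The latter requires
  \<open>n \<ge> 1\<close>, that is, at least two derivatives.\<close>

lemma sob_imp_wb:
  assumes u: "u \<in> sob (Suc n)" and n: "n \<ge> 1"
  shows "wb (Suc n) 0 (emb_const n * sob_norm (Suc n) u) u"
proof -
  define N where "N = sob_norm (Suc n) u"
  have N: "0 \<le> N" by (simp add: N_def sob_norm_nonneg)
  have ac: "\<And>i. i \<le> n \<Longrightarrow> (deriv ^^ i) u \<in> AC_loc0"
    and df: "\<And>i x. i < n \<Longrightarrow> x \<in> unit_ival \<Longrightarrow> (deriv ^^ i) u differentiable (at x)"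
    using u by (auto simp: sob_def AC_loc_iff)
  have w: "wL2 j N ((deriv ^^ j) u)" if "j \<le> Suc n" for j
    using sob_wL2[OF u that] by (simp add: N_def)
  have s1: "rho x ^ i * \<bar>(deriv ^^ i) u x\<bar> \<le> (3 + 2 * (real n + 1)) * N" if "1 \<le> i" "i \<le> n" "x \<in> unit_ival" for i x
  proof -
    have "rho x ^ i * \<bar>(deriv ^^ i) u x\<bar> \<le> (3 + 2 * real i) * N"
      using that w[of i] w[of "Suc i"] by (intro weighted_sup_bound ac N) auto
    also have "\<dots> \<le> (3 + 2 * (real n + 1)) * N" using that N by (intro mult_right_mono) auto
    finally show ?thesis .
  qed
  have e: "emb_const n * N = N + 4 * ((3 + 2 * (real n + 1)) * N)" by (simp add: emb_const_def algebra_simps)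
  have s0: "\<bar>u x\<bar> \<le> emb_const n * N" if "x \<in> unit_ival" for x
    unfolding e
  proof (rule unweighted_sup_bound[OF _ _ N _ _ that])
    show "u \<in> AC_loc0" "wL2 0 N u" using ac[of 0] w[of 0] by auto
    show "(u has_real_derivative deriv u z) (at z)" if "z \<in> unit_ival" for z
      using df[of 0 z] n that by (simp add: DERIV_deriv_iff_real_differentiable)
    show "rho z * \<bar>deriv u z\<bar> \<le> (3 + 2 * (real n + 1)) * N" if "z \<in> unit_ival" for z
      using s1[of 1 z] n that by simp
  qed
  have "rho x ^ (0 + i) * \<bar>(deriv ^^ i) u x\<bar> \<le> emb_const n * N" if "i \<le> n" "x \<in> unit_ival" for i x
  proof (cases "i = 0")
    case True
    then show ?thesis using s0[OF that(2)] by simp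
  next
    case False
    then have "rho x ^ i * \<bar>(deriv ^^ i) u x\<bar> \<le> (3 + 2 * (real n + 1)) * N" using that by (intro s1) auto
    moreover have "0 \<le> (3 + 2 * (real n + 1)) * N" using N by simp
    ultimately show ?thesis unfolding add_0 using e N by linarith
  qed
  moreover have "wL2 (Suc (0 + n)) (emb_const n * N) ((deriv ^^ Suc n) u)"
  proof (rule wL2_mono)
    show "wL2 (Suc (0 + n)) N ((deriv ^^ Suc n) u)" using w[of "Suc n"] by simp
    have "0 \<le> (3 + 2 * (real n + 1)) * N" using N by simp
    then show "N \<le> emb_const n * N" using e by linarith
  qed (rule N)
  ultimately show ?thesis unfolding wb_iff N_def[symmetric] using ac df by blast
qed

section \<open>Uniqueness of higher derivatives\<close>

text \<open>
  Up to a constant, the axioms of a norm are easily checked for \<open>sob_norm\<close> through \<open>wb\<close>, and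
  they suffice for the uniqueness of derivatives.
\<close>

locale quasi_normed =
  fixes X :: "'a::real_vector set" and nX :: "'a \<Rightarrow> real" and C :: real
  assumes add_in: "x \<in> X \<Longrightarrow> y \<in> X \<Longrightarrow> x + y \<in> X"
    and scaleR_in: "x \<in> X \<Longrightarrow> c *\<^sub>R x \<in> X"
    and zero_in: "0 \<in> X"
    and nonneg: "0 \<le> nX x"
    and C_nonneg: "0 \<le> C"
    and diff_le: "x \<in> X \<Longrightarrow> y \<in> X \<Longrightarrow> nX (x - y) \<le> C * (nX x + nX y)"
    and scaleR_le: "x \<in> X \<Longrightarrow> nX (c *\<^sub>R x) \<le> C * \<bar>c\<bar> * nX x"
    and eq_zero: "x \<in> X \<Longrightarrow> nX x = 0 \<Longrightarrow> x = 0"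
begin

lemma diff_in: "x \<in> X \<Longrightarrow> y \<in> X \<Longrightarrow> x - y \<in> X"
  using add_in[OF _ scaleR_in[of y "- 1"]] by simp

definition unit_args :: "nat \<Rightarrow> 'a list set" where
  "unit_args j = {ws \<in> args X j. \<forall>w\<in>set ws. nX w \<le> 1}"

lemma prod_unit_args_le_1: "ws \<in> unit_args j \<Longrightarrow> (\<Prod>w\<leftarrow>ws. nX w) \<le> 1"
proof -
  have "(\<forall>w\<in>set ws. nX w \<le> 1) \<Longrightarrow> 0 \<le> (\<Prod>w\<leftarrow>ws. nX w) \<and> (\<Prod>w\<leftarrow>ws. nX w) \<le> 1" for ws
    by (induction ws) (auto simp: nonneg intro: mult_le_one)
  then show "ws \<in> unit_args j \<Longrightarrow> (\<Prod>w\<leftarrow>ws. nX w) \<le> 1" by (auto simp: unit_args_def)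
qed

lemma replicate_zero_in_unit_args: "replicate j 0 \<in> unit_args j"
  using scaleR_le[OF zero_in, of 0] zero_in by (auto simp: unit_args_def args_def)

lemma multilinear_norm_le:
  assumes "\<And>ws. ws \<in> unit_args j \<Longrightarrow> nX (A ws) \<le> b"
  shows "multilinear_norm X nX nX j A \<le> b"
  unfolding multilinear_norm_def unit_args_def[symmetric]
  by (rule cSUP_least) (use assms replicate_zero_in_unit_args in auto)

text \<open>A supremum of reals dominates its members only if they are bounded above;
  \<open>b\<close> witnesses this and does not reappear in the conclusion.\<close>

lemma le_multilinear_norm:
  assumes "\<And>ws. ws \<in> unit_args j \<Longrightarrow> nX (A ws) \<le> b" and "ws \<in> unit_args j"
  shows "nX (A ws) \<le> multilinear_norm X nX nX j A"
  unfolding multilinear_norm_def unit_args_def[symmetric]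
  by (rule cSUP_upper[OF assms(2)]) (use assms(1) in \<open>auto simp: bdd_above_def\<close>)

lemma multilinear_in: "A \<in> bounded_multilinear X nX X nX j \<Longrightarrow> ws \<in> args X j \<Longrightarrow> A ws \<in> X"
  by (auto simp: bounded_multilinear_def)

lemma multilinear_bounded:
  assumes "A \<in> bounded_multilinear X nX X nX j"
  obtains b where "0 \<le> b" "\<And>ws. ws \<in> args X j \<Longrightarrow> nX (A ws) \<le> b * (\<Prod>w\<leftarrow>ws. nX w)"
proof -
  obtain b where b: "\<forall>ws\<in>args X j. nX (A ws) \<le> b * (\<Prod>w\<leftarrow>ws. nX w)"
    using assms by (auto simp: bounded_multilinear_def)
  have "0 \<le> (\<Prod>w\<leftarrow>ws. nX w)" for ws by (induction ws) (auto simp: nonneg)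
  then have "b * (\<Prod>w\<leftarrow>ws. nX w) \<le> \<bar>b\<bar> * (\<Prod>w\<leftarrow>ws. nX w)" for ws by (intro mult_right_mono) auto
  then show thesis using b by (intro that[of "\<bar>b\<bar>"]) (auto intro: order_trans)
qed

text \<open>Homogeneity is applied to one argument at a time, with the first \<open>i\<close>
  entries already scaled.\<close>

lemma multilinear_scale:
  assumes A: "A \<in> bounded_multilinear X nX X nX j" and ws: "ws \<in> args X j"
  shows "A (map (scaleR c) ws) = c ^ j *\<^sub>R A ws"
proof -
  have len: "length ws = j" and sub: "set ws \<subseteq> X" using ws by (auto simp: args_def)
  have "A (map (scaleR c) (take i ws) @ drop i ws) = c ^ i *\<^sub>R A ws" if "i \<le> j" for i
    using that
  proof (induction i)
    case (Suc i)
    let ?L = "map (scaleR c) (take i ws) @ drop i ws"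
    have i: "i < j" "i < length ws" using Suc len by auto
    have wi: "ws ! i \<in> X" using i sub by auto
    have L: "?L \<in> args X j"
      using len sub i by (auto simp: args_def dest!: in_set_takeD in_set_dropD intro!: scaleR_in)
    have nth: "?L ! i = ws ! i" using i by (simp add: nth_append)
    have "map (scaleR c) (take (Suc i) ws) @ drop (Suc i) ws = ?L[i := c *\<^sub>R (ws ! i)]"
      using i by (simp add: take_Suc_conv_app_nth list_update_append Cons_nth_drop_Suc[symmetric])
    also have "A \<dots> = c *\<^sub>R A (?L[i := ws ! i])"
      using A L i wi unfolding bounded_multilinear_def by blast
    also have "?L[i := ws ! i] = ?L" using nth by (metis list_update_id)
    finally show ?case using Suc by simp
  qed simp
  from this[of j] show ?thesis using len by simp
qed

text \<open>One common factor for all entries, so that by homogeneity identities on unit arguments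
  extend to all arguments. The sum \<open>s\<close> bounds every entry, and adding 1 avoids division
  by zero.\<close>

lemma scale_into_unit_args:
  assumes "ws \<in> args X j"
  obtains c where "c > 0" "map (scaleR c) ws \<in> unit_args j"
proof -
  define s where "s = (\<Sum>w\<leftarrow>ws. C * nX w)"
  have le: "C * nX w \<le> s" if "w \<in> set ws" for w
    unfolding s_def using that C_nonneg nonneg by (intro member_le_sum_list) auto
  have s: "0 \<le> s" unfolding s_def using C_nonneg nonneg by (intro sum_list_nonneg) auto
  define c where "c = 1 / (s + 1)"
  have c: "c > 0" using s by (simp add: c_def)
  have "nX (c *\<^sub>R w) \<le> 1" if "w \<in> set ws" for w
  proof -
    have "nX (c *\<^sub>R w) \<le> C * \<bar>c\<bar> * nX w" using that assms by (intro scaleR_le) (auto simp: args_def)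
    also have "\<dots> = c * (C * nX w)" using c by simp
    also have "\<dots> \<le> c * (s + 1)" using c le[OF that] by (intro mult_left_mono) auto
    also have "\<dots> = 1" using s by (simp add: c_def)
    finally show ?thesis .
  qed
  then show thesis using assms c by (intro that[of c]) (auto simp: unit_args_def args_def scaleR_in)
qed

lemma frechet_derivs_multilinear:
  assumes "frechet_derivs X nX X nX S m \<Phi> D" "j \<le> m" "u \<in> S"
  shows "D j u \<in> bounded_multilinear X nX X nX j"
  using assms by (simp add: frechet_derivs_def)

text \<open>Extracts pointwise estimates from the operator norm. The three bounds \<open>b1\<close>,
  \<open>b2\<close>, \<open>b3\<close> show that the remainder is bounded on unit arguments, without
  which the supremum would say nothing.\<close>

lemma frechet_derivsD:
  assumes D: "frechet_derivs X nX X nX S m \<Phi> D" and j: "j < m" and u: "u \<in> S" and SX: "S \<subseteq> X" and \<epsilon>: "\<epsilon> > 0"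
  obtains \<delta> where "\<delta> > 0" "\<And>v ws. v \<in> S \<Longrightarrow> nX (v - u) < \<delta> \<Longrightarrow> ws \<in> unit_args j \<Longrightarrow>
    nX (D j v ws - D j u ws - D (Suc j) u ((v - u) # ws)) \<le> \<epsilon> * nX (v - u)"
proof -
  have "\<exists>\<delta>>0. \<forall>v\<in>S. nX (v - u) < \<delta> \<longrightarrow>
        multilinear_norm X nX nX j (\<lambda>ws. D j v ws - D j u ws - D (Suc j) u ((v - u) # ws)) \<le> \<epsilon> * nX (v - u)"
    using D j u \<epsilon> by (simp add: frechet_derivs_def)
  then obtain \<delta> where \<delta>: "\<delta> > 0" "\<And>v. v \<in> S \<Longrightarrow> nX (v - u) < \<delta> \<Longrightarrow>
        multilinear_norm X nX nX j (\<lambda>ws. D j v ws - D j u ws - D (Suc j) u ((v - u) # ws)) \<le> \<epsilon> * nX (v - u)"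
    by blast
  have ml: "D i v \<in> bounded_multilinear X nX X nX i" if "v \<in> S" "i \<le> m" for v i
    by (rule frechet_derivs_multilinear[OF D that(2,1)])
  have "nX (D j v ws - D j u ws - D (Suc j) u ((v - u) # ws)) \<le> \<epsilon> * nX (v - u)"
    if v: "v \<in> S" "nX (v - u) < \<delta>" and ws: "ws \<in> unit_args j" for v ws
  proof -
    have vu: "v - u \<in> X" using v u SX by (intro diff_in) auto
    obtain b1 where b1: "0 \<le> b1" "\<And>ws. ws \<in> args X j \<Longrightarrow> nX (D j v ws) \<le> b1 * (\<Prod>w\<leftarrow>ws. nX w)"
      using multilinear_bounded[OF ml[OF v(1)]] j by (metis less_imp_le)
    obtain b2 where b2: "0 \<le> b2" "\<And>ws. ws \<in> args X j \<Longrightarrow> nX (D j u ws) \<le> b2 * (\<Prod>w\<leftarrow>ws. nX w)"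
      using multilinear_bounded[OF ml[OF u]] j by (metis less_imp_le)
    obtain b3 where b3: "0 \<le> b3" "\<And>ws. ws \<in> args X (Suc j) \<Longrightarrow> nX (D (Suc j) u ws) \<le> b3 * (\<Prod>w\<leftarrow>ws. nX w)"
      using multilinear_bounded[OF ml[OF u]] j by (metis Suc_leI)
    have "nX (D j v zs - D j u zs - D (Suc j) u ((v - u) # zs)) \<le> C * (C * (b1 + b2) + b3 * nX (v - u))"
      if zs: "zs \<in> unit_args j" for zs
    proof -
      have za: "zs \<in> args X j" "(v - u) # zs \<in> args X (Suc j)" using zs vu by (auto simp: unit_args_def args_def)
      note p1 = prod_unit_args_le_1[OF zs]
      have X: "D j v zs \<in> X" "D j u zs \<in> X" "D (Suc j) u ((v - u) # zs) \<in> X"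
        using ml u v j za by (auto intro!: multilinear_in)
      have "nX (D j v zs) \<le> b1" using b1(2)[OF za(1)] mult_left_mono[OF p1 b1(1)] by simp
      moreover have "nX (D j u zs) \<le> b2" using b2(2)[OF za(1)] mult_left_mono[OF p1 b2(1)] by simp
      moreover have "nX (D (Suc j) u ((v - u) # zs)) \<le> b3 * nX (v - u)"
        using b3(2)[OF za(2)] mult_left_mono[OF p1, of "b3 * nX (v - u)"] b3(1) nonneg by (simp add: mult.assoc)
      moreover have "nX (D j v zs - D j u zs) \<le> C * (nX (D j v zs) + nX (D j u zs))" by (rule diff_le[OF X(1,2)])
      moreover have "C * (nX (D j v zs) + nX (D j u zs)) \<le> C * (b1 + b2)"
        using calculation C_nonneg by (intro mult_left_mono) auto
      ultimately have "nX (D j v zs - D j u zs) + nX (D (Suc j) u ((v - u) # zs)) \<le> C * (b1 + b2) + b3 * nX (v - u)"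
        by linarith
      from mult_left_mono[OF this C_nonneg]
      show ?thesis using diff_le[OF diff_in[OF X(1,2)] X(3)] by linarith
    qed
    from le_multilinear_norm[where A = "\<lambda>ws. D j v ws - D j u ws - D (Suc j) u ((v - u) # ws)", OF this ws]
    show ?thesis using \<delta>(2)[OF v] by linarith
  qed
  then show thesis using \<delta>(1) that by blast
qed

text \<open>By induction the two \<open>j\<close>-th derivatives have the same increments, so both
  derivatives of order \<open>j + 1\<close> approximate the same quantity along
  \<open>u + t *\<^sub>R h\<close>. Dividing by \<open>t\<close>, their difference is at most a
  constant times \<open>\<epsilon>\<close> for every \<open>\<epsilon> > 0\<close>.\<close>

theorem frechet_derivs_unique:
  assumes S: "open_in_normed X nX S"
    and D: "frechet_derivs X nX X nX S m \<Phi> D" and E: "frechet_derivs X nX X nX S m \<Phi> E"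
  shows "j \<le> m \<Longrightarrow> u \<in> S \<Longrightarrow> ws \<in> args X j \<Longrightarrow> D j u ws = E j u ws"
proof (induction j arbitrary: u ws)
  case 0
  then show ?case using D E by (simp add: frechet_derivs_def args_def)
next
  case (Suc j)
  have SX: "S \<subseteq> X" using S by (simp add: open_in_normed_def)
  have j: "j < m" and u: "u \<in> S" using Suc by auto
  have mlD: "D (Suc j) u \<in> bounded_multilinear X nX X nX (Suc j)"
    and mlE: "E (Suc j) u \<in> bounded_multilinear X nX X nX (Suc j)"
    by (rule frechet_derivs_multilinear[OF _ Suc(2) u], fact)+
  have unit: "D (Suc j) u (h # zs) = E (Suc j) u (h # zs)" if h: "h \<in> X" and zs: "zs \<in> unit_args j" for h zs
  proof -
    have za: "zs \<in> args X j" "h # zs \<in> args X (Suc j)" using zs h by (auto simp: unit_args_def args_def)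
    define d where "d = D (Suc j) u (h # zs) - E (Suc j) u (h # zs)"
    have dX: "d \<in> X" unfolding d_def by (intro diff_in multilinear_in[OF mlD] multilinear_in[OF mlE] za)
    have "nX d \<le> C * (C * (C * nX h * \<epsilon> + C * nX h * \<epsilon>))" if \<epsilon>: "\<epsilon> > 0" for \<epsilon>
    proof -
      obtain d1 where d1: "d1 > 0" "\<And>v ws. v \<in> S \<Longrightarrow> nX (v - u) < d1 \<Longrightarrow> ws \<in> unit_args j \<Longrightarrow>
          nX (D j v ws - D j u ws - D (Suc j) u ((v - u) # ws)) \<le> \<epsilon> * nX (v - u)"
        using frechet_derivsD[OF D j u SX \<epsilon>] by blast
      obtain d2 where d2: "d2 > 0" "\<And>v ws. v \<in> S \<Longrightarrow> nX (v - u) < d2 \<Longrightarrow> ws \<in> unit_args j \<Longrightarrow>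
          nX (E j v ws - E j u ws - E (Suc j) u ((v - u) # ws)) \<le> \<epsilon> * nX (v - u)"
        using frechet_derivsD[OF E j u SX \<epsilon>] by blast
      obtain d3 where d3: "d3 > 0" "\<And>v. v \<in> X \<Longrightarrow> nX (v - u) < d3 \<Longrightarrow> v \<in> S"
        using S u unfolding open_in_normed_def by blast
      \<comment> \<open>Small enough that the increment, of size at most
        \<open>C * t * nX h\<close>, stays within all three radii; the 1 makes the inequality strict
        and covers \<open>nX h = 0\<close>.\<close>
      define t where "t = min d1 (min d2 d3) / (C * nX h + 1)"
      have den: "C * nX h + 1 > 0" using C_nonneg nonneg[of h] by (intro add_nonneg_pos mult_nonneg_nonneg) auto
      have t: "t > 0" using d1 d2 d3 den by (simp add: t_def)
      define v where "v = u + t *\<^sub>R h"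
      have vu: "v - u = t *\<^sub>R h" by (simp add: v_def)
      have nvu: "nX (v - u) \<le> C * t * nX h" unfolding vu using scaleR_le[OF h, of t] t by simp
      also have "\<dots> < t * (C * nX h + 1)" using t by (simp add: algebra_simps)
      also have "\<dots> = min d1 (min d2 d3)" using den by (simp add: t_def)
      finally have small: "nX (v - u) < d1" "nX (v - u) < d2" "nX (v - u) < d3" by auto
      have "v \<in> X" unfolding v_def using u SX h by (intro add_in scaleR_in) auto
      then have v: "v \<in> S" using small d3 by blast
      let ?a = "D j v zs - D j u zs"
      have eq: "E j v zs - E j u zs = ?a"
        using Suc.IH[OF less_imp_le[OF j] v za(1)] Suc.IH[OF less_imp_le[OF j] u za(1)] by simp
      have sc: "A (t *\<^sub>R h # zs) = t *\<^sub>R A (h # zs)" if "A \<in> bounded_multilinear X nX X nX (Suc j)" for A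
      proof -
        have "A ((h # zs)[0 := t *\<^sub>R h]) = t *\<^sub>R A ((h # zs)[0 := h])"
          using that za h unfolding bounded_multilinear_def by blast
        then show ?thesis by simp
      qed
      let ?x = "D (Suc j) u (h # zs)" and ?y = "E (Suc j) u (h # zs)"
      have "D j w \<in> bounded_multilinear X nX X nX j" if "w \<in> S" for w
        by (rule frechet_derivs_multilinear[OF D less_imp_le[OF j] that])
      then have xyX: "?x \<in> X" "?y \<in> X" "?a \<in> X"
        using multilinear_in[OF mlD za(2)] multilinear_in[OF mlE za(2)] u v za(1)
        by (simp_all add: diff_in multilinear_in[of _ j])
      have 1: "nX (?a - t *\<^sub>R ?x) \<le> \<epsilon> * (C * t * nX h)"
        using d1(2)[OF v small(1) zs] mult_left_mono[OF nvu less_imp_le[OF \<epsilon>]] unfolding vu sc[OF mlD] by linarith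
      have 2: "nX (?a - t *\<^sub>R ?y) \<le> \<epsilon> * (C * t * nX h)"
        using d2(2)[OF v small(2) zs] mult_left_mono[OF nvu less_imp_le[OF \<epsilon>]] unfolding vu sc[OF mlE] eq by linarith
      have "nX ((?a - t *\<^sub>R ?y) - (?a - t *\<^sub>R ?x)) \<le> C * (nX (?a - t *\<^sub>R ?y) + nX (?a - t *\<^sub>R ?x))"
        by (intro diff_le diff_in[OF xyX(3)] scaleR_in xyX)
      also have "\<dots> \<le> C * (\<epsilon> * (C * t * nX h) + \<epsilon> * (C * t * nX h))"
        using 1 2 C_nonneg by (intro mult_left_mono add_mono)
      also have "(?a - t *\<^sub>R ?y) - (?a - t *\<^sub>R ?x) = t *\<^sub>R d" by (simp add: d_def algebra_simps)
      finally have td: "nX (t *\<^sub>R d) \<le> C * (\<epsilon> * (C * t * nX h) + \<epsilon> * (C * t * nX h))" .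
      have "nX d = nX ((1 / t) *\<^sub>R (t *\<^sub>R d))" using t by simp
      also have "\<dots> \<le> C * \<bar>1 / t\<bar> * nX (t *\<^sub>R d)" using dX by (intro scaleR_le scaleR_in)
      also have "\<dots> \<le> C * \<bar>1 / t\<bar> * (C * (\<epsilon> * (C * t * nX h) + \<epsilon> * (C * t * nX h)))"
        using td C_nonneg by (intro mult_left_mono) auto
      also have "\<dots> = C * (C * (C * nX h * \<epsilon> + C * nX h * \<epsilon>))"
        using t by (simp add: field_simps)
      finally show ?thesis .
    qed
    then have "\<forall>\<^sub>F \<epsilon> in at_right 0. nX d \<le> C * (C * (C * nX h * \<epsilon> + C * nX h * \<epsilon>))"
      by (intro eventually_at_rightI[of 0 1]) auto
    moreover have "((\<lambda>\<epsilon>. C * (C * (C * nX h * \<epsilon> + C * nX h * \<epsilon>))) \<longlongrightarrow> C * (C * (C * nX h * 0 + C * nX h * 0))) (at_right 0)"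
      by (intro tendsto_intros)
    ultimately have "nX d \<le> C * (C * (C * nX h * 0 + C * nX h * 0))"
      by (intro tendsto_lowerbound) auto
    then have "nX d = 0" using nonneg[of d] by simp
    then show ?thesis using eq_zero[OF dX] by (simp add: d_def)
  qed
  \<comment> \<open>Equality is known for arguments whose tail lies in the unit ball; scaling all
    arguments and cancelling \<open>c ^ Suc j\<close> removes the restriction.\<close>
  obtain c where c: "c > 0" "map (scaleR c) ws \<in> unit_args (Suc j)"
    using scale_into_unit_args[OF Suc(4)] by blast
  obtain h zs where hz: "map (scaleR c) ws = h # zs" "h \<in> X" "zs \<in> unit_args j"
    using c(2) by (cases "map (scaleR c) ws") (auto simp: unit_args_def args_def)
  have "c ^ Suc j *\<^sub>R D (Suc j) u ws = c ^ Suc j *\<^sub>R E (Suc j) u ws"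
    using unit[OF hz(2,3)] multilinear_scale[OF mlD Suc(4), of c] multilinear_scale[OF mlE Suc(4), of c] hz(1) by simp
  then show ?case using c(1) by simp
qed

end

section \<open>Differentiability of the superposition operator\<close>

lemma sob_outside: "u \<in> sob k \<Longrightarrow> x \<notin> unit_ival \<Longrightarrow> u x = 0"
  by (auto simp: sob_def)

lemma wb_diff:
  assumes "wb n s M p" "wb n s N q"
  shows "wb n s (2 * (M + N)) (\<lambda>x. p x - q x)"
  using wb_add[OF assms(1) wb_cmult[OF assms(2), of "- 1"]] by simp

text \<open>The factor \<open>2 * (real n + 2)\<close> for returning from \<open>wb\<close> to the
  norm, times \<open>2 * emb_const n\<close> for embedding two elements and subtracting
  them.\<close>

definition sob_const :: "nat \<Rightarrow> real" where
  "sob_const n = 4 * (real n + 2) * emb_const n"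

lemma quasi_normed_sob:
  assumes n: "n \<ge> 1"
  shows "quasi_normed (sob (Suc n)) (sob_norm (Suc n)) (sob_const n)"
proof
  have e: "0 \<le> emb_const n" using emb_const_pos[of n] by simp
  show "0 \<le> sob_const n" using e by (simp add: sob_const_def)
  show "0 \<le> sob_norm (Suc n) u" for u by (rule sob_norm_nonneg)
  have zero: "wb n s 0 (\<lambda>x. 0)" for n s
  proof (induction n arbitrary: s)
    case (Suc n)
    have "wd n (Suc s) 0 (\<lambda>x. 0)" using Suc by (simp add: wd_def wL2_def wsq_def)
    then show ?case by (intro wb_SucI[OF AC_loc0_const, of _ _ _ "{}"]) auto
  qed simp
  show "0 \<in> sob (Suc n)" using wb_imp_sob(1)[OF zero] by (simp add: zero_fun_def)
  fix u v :: "real \<Rightarrow> real" and c :: real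
  assume u: "u \<in> sob (Suc n)"
  note wu = sob_imp_wb[OF u n]
  have cu: "wb (Suc n) 0 (\<bar>c\<bar> * (emb_const n * sob_norm (Suc n) u)) (c *\<^sub>R u)"
    using wb_cmult[OF wu, of c] by (simp add: scaleR_fun_def)
  have "(c *\<^sub>R u) x = 0" if "x \<notin> unit_ival" for x
    using sob_outside[OF u that] by (simp add: scaleR_fun_def)
  note 1 = wb_imp_sob[OF cu this]
  show "c *\<^sub>R u \<in> sob (Suc n)" by (rule 1)
  have "2 * (real n + 2) * (\<bar>c\<bar> * (emb_const n * sob_norm (Suc n) u)) \<le> 4 * (real n + 2) * (\<bar>c\<bar> * (emb_const n * sob_norm (Suc n) u))"
    using e sob_norm_nonneg by (intro mult_right_mono mult_nonneg_nonneg) auto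
  then show "sob_norm (Suc n) (c *\<^sub>R u) \<le> sob_const n * \<bar>c\<bar> * sob_norm (Suc n) u"
    using 1(2) by (simp add: sob_const_def algebra_simps)
  \<comment> \<open>Norm zero forces \<open>u\<close> to vanish on the interval by the pointwise
    bound; outside it vanishes by convention, so the norm is definite on total functions.\<close>
  show "u = 0" if "sob_norm (Suc n) u = 0"
  proof
    fix x :: real
    show "u x = 0 x"
      using wb_sup[OF wu, of x] sob_outside[OF u, of x] that by (cases "x \<in> unit_ival") auto
  qed
  assume v: "v \<in> sob (Suc n)"
  note wv = sob_imp_wb[OF v n]
  have "wb (Suc n) 0 (2 * (emb_const n * sob_norm (Suc n) u + emb_const n * sob_norm (Suc n) v)) (u - v)"
    using wb_diff[OF wu wv] by (simp add: fun_diff_def)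
  moreover have "(u - v) x = 0" if "x \<notin> unit_ival" for x
    using sob_outside[OF u that] sob_outside[OF v that] by simp
  ultimately have "sob_norm (Suc n) (u - v) \<le>
      2 * (real n + 2) * (2 * (emb_const n * sob_norm (Suc n) u + emb_const n * sob_norm (Suc n) v))"
    by (rule wb_imp_sob)
  then show "sob_norm (Suc n) (u - v) \<le> sob_const n * (sob_norm (Suc n) u + sob_norm (Suc n) v)"
    by (simp add: sob_const_def algebra_simps)
  have "wb (Suc n) 0 (2 * (emb_const n * sob_norm (Suc n) u + emb_const n * sob_norm (Suc n) v)) (u + v)"
    using wb_add[OF wu wv] by (simp add: plus_fun_def)
  then show "u + v \<in> sob (Suc n)"
    by (rule wb_imp_sob) (use sob_outside[OF u] sob_outside[OF v] in simp)
qed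

section \<open>Openness of the domain and local uniform bounds\<close>

lemma wb_lower_order: "wb n s M p \<Longrightarrow> m \<le> n \<Longrightarrow> \<exists>M'. wb m s M' p"
proof (induction "n - m" arbitrary: n M)
  case (Suc d)
  then obtain n' where n': "n = Suc n'" "d = n' - m" "m \<le> n'" by (cases n) auto
  then show ?case using Suc(1)[OF n'(2) wb_Suc_imp n'(3)] Suc(3) by blast
qed auto

text \<open>Lowering the order of \<open>wb\<close> gives the inclusion; it lets elements of
  \<open>sob k\<close> near \<open>u\<close> be recognised as members of
  \<open>sob2_in U\<close>.\<close>

lemma sob_subset_sob_2:
  assumes "n \<ge> 1"
  shows "sob (Suc n) \<subseteq> sob 2"
proof
  fix u assume u: "u \<in> sob (Suc n)"
  obtain M where "wb (Suc 1) 0 M u" using wb_lower_order[OF sob_imp_wb[OF u assms], of "Suc 1"] assms by auto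
  then have "u \<in> sob (Suc 1)" using sob_outside[OF u] by (rule wb_imp_sob)
  then show "u \<in> sob 2" by (simp add: numeral_2_eq_2)
qed

text \<open>Collects what the composition estimates require of a neighbour \<open>v\<close> of
  \<open>u\<close>: a common bound \<open>M\<close>, a common range \<open>K\<close>, and an
  increment measured by its Sobolev norm.\<close>

definition controlled_near :: "nat \<Rightarrow> real \<Rightarrow> real set \<Rightarrow> (real \<Rightarrow> real) \<Rightarrow> real \<Rightarrow> bool" where
  "controlled_near n M K u \<delta> \<longleftrightarrow> (\<forall>v\<in>sob (Suc n). sob_norm (Suc n) (v - u) < \<delta> \<longrightarrow>
     wb (Suc n) 0 M v \<and> v ` unit_ival \<subseteq> K \<and> wb (Suc n) 0 (emb_const n * sob_norm (Suc n) (v - u)) (\<lambda>x. v x - u x))"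

text \<open>The range of \<open>u\<close> is bounded and connected, so its closure is a compact
  interval inside \<open>U\<close>, and a slightly larger interval still lies in \<open>U\<close>.
  By the embedding, Sobolev-close functions are uniformly close and take their values there. An
  interval is needed because the mean value estimates use convexity.\<close>

lemma sob_local_bounds:
  assumes n: "n \<ge> 1" and U: "open U" and u: "u \<in> sob (Suc n)" "closure (u ` unit_ival) \<subseteq> U"
  obtains \<alpha> \<beta> M \<delta> where "\<delta> > 0" "0 \<le> M" "{\<alpha>..\<beta>} \<subseteq> U" "wb (Suc n) 0 M u" "u ` unit_ival \<subseteq> {\<alpha>..\<beta>}"
    "controlled_near n M {\<alpha>..\<beta>} u \<delta>"
proof -
  interpret quasi_normed "sob (Suc n)" "sob_norm (Suc n)" "sob_const n" by (rule quasi_normed_sob[OF n])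
  define N where "N = emb_const n * sob_norm (Suc n) u"
  have wu: "wb (Suc n) 0 N u" unfolding N_def by (rule sob_imp_wb[OF u(1) n])
  have bdd: "bounded (u ` unit_ival)" using wb_sup[OF wu] unfolding bounded_iff by (intro exI[of _ N]) auto
  have "connected (u ` unit_ival)"
    using AC_loc0_continuous_on[OF wb_AC[OF wu]] by (intro connected_continuous_image) auto
  then have "connected (closure (u ` unit_ival))" "compact (closure (u ` unit_ival))"
    using bdd by (auto intro: connected_imp_connected_closure simp: compact_closure)
  then obtain a b where ab: "closure (u ` unit_ival) = {a..b}"
    using connected_compact_interval_1 by blast
  have rng: "u x \<in> {a..b}" if "x \<in> unit_ival" for x
    using that ab closure_subset[of "u ` unit_ival"] by blast
  have le: "a \<le> b" using rng[of 0] by auto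
  then have "a \<in> U" "b \<in> U" using u(2) ab by auto
  then obtain r1 r2 where r: "r1 > 0" "ball a r1 \<subseteq> U" "r2 > 0" "ball b r2 \<subseteq> U"
    using U open_contains_ball by metis
  \<comment> \<open>Strictly below both radii, as a closed enlargement has to fit into open
    balls.\<close>
  define r where "r = min r1 r2 / 2"
  have r0: "r > 0" "r < r1" "r < r2" using r by (auto simp: r_def)
  have sub: "{a - r..b + r} \<subseteq> U"
  proof
    fix y assume y: "y \<in> {a - r..b + r}"
    consider "y < a" | "y \<in> {a..b}" | "b < y" by fastforce
    then show "y \<in> U"
    proof cases
      case 1
      then have "y \<in> ball a r1" using y r0 by (auto simp: dist_real_def)
      then show ?thesis using r by blast
    next
      case 2
      then show ?thesis using u(2) ab by blast
    next
      case 3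
      then have "y \<in> ball b r2" using y r0 by (auto simp: dist_real_def)
      then show ?thesis using r by blast
    qed
  qed
  note e = emb_const_pos[of n]
  define \<delta> where "\<delta> = r / emb_const n"
  have near: "wb (Suc n) 0 (2 * (N + r)) v \<and> v ` unit_ival \<subseteq> {a - r..b + r} \<and>
      wb (Suc n) 0 (emb_const n * sob_norm (Suc n) (v - u)) (\<lambda>x. v x - u x)"
    if v: "v \<in> sob (Suc n)" "sob_norm (Suc n) (v - u) < \<delta>" for v
  proof -
    have small: "emb_const n * sob_norm (Suc n) (v - u) \<le> r"
      using v(2) e by (simp add: \<delta>_def field_simps)
    have h: "wb (Suc n) 0 (emb_const n * sob_norm (Suc n) (v - u)) (\<lambda>x. v x - u x)"
      using sob_imp_wb[OF diff_in[OF v(1) u(1)] n] by (simp add: fun_diff_def)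
    have "wb (Suc n) 0 (2 * (N + r)) (\<lambda>x. u x + (v x - u x))" by (intro wb_add wu wb_mono[OF h small])
    moreover have "v x \<in> {a - r..b + r}" if "x \<in> unit_ival" for x
      using wb_sup[OF h that] small rng[OF that] by (auto simp: abs_le_iff)
    ultimately show ?thesis using h by (simp add: image_subset_iff)
  qed
  show thesis
  proof (rule that)
    show "\<delta> > 0" using e r0 by (simp add: \<delta>_def)
    have "N \<ge> 0" by (rule wb_nonneg[OF wu])
    then show "0 \<le> 2 * (N + r)" "wb (Suc n) 0 (2 * (N + r)) u" using r0 by (auto intro: wb_mono[OF wu])
    show "u ` unit_ival \<subseteq> {a - r..b + r}" using rng r0 by (fastforce simp: image_subset_iff)
    show "controlled_near n (2 * (N + r)) {a - r..b + r} u \<delta>" unfolding controlled_near_def using near by blast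
  qed (rule sub)
qed

text \<open>Neighbours of \<open>u\<close> have their range in one fixed closed interval inside
  \<open>U\<close>, hence so does the closure of that range.\<close>

lemma open_in_normed_sob2_in:
  assumes n: "n \<ge> 1" and U: "open U"
  shows "open_in_normed (sob (Suc n)) (sob_norm (Suc n)) (sob (Suc n) \<inter> sob2_in U)"
  unfolding open_in_normed_def
proof (intro conjI ballI)
  fix u assume "u \<in> sob (Suc n) \<inter> sob2_in U"
  then have u: "u \<in> sob (Suc n)" "closure (u ` unit_ival) \<subseteq> U" by (auto simp: sob2_in_def)
  obtain \<alpha> \<beta> M \<delta> where b: "\<delta> > 0" "0 \<le> M" "{\<alpha>..\<beta>} \<subseteq> U" "wb (Suc n) 0 M u" "u ` unit_ival \<subseteq> {\<alpha>..\<beta>}"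
    "controlled_near n M {\<alpha>..\<beta>} u \<delta>"
    by (rule sob_local_bounds[OF n U u])
  have "v \<in> sob (Suc n) \<inter> sob2_in U" if v: "v \<in> sob (Suc n)" "sob_norm (Suc n) (v - u) < \<delta>" for v
  proof -
    have "v ` unit_ival \<subseteq> {\<alpha>..\<beta>}" using b(6) v by (auto simp: controlled_near_def)
    then have "closure (v ` unit_ival) \<subseteq> {\<alpha>..\<beta>}" by (intro closure_minimal) auto
    then show ?thesis using v(1) b(3) sob_subset_sob_2[OF n] by (auto simp: sob2_in_def)
  qed
  then show "\<exists>\<delta>>0. \<forall>v\<in>sob (Suc n). sob_norm (Suc n) (v - u) < \<delta> \<longrightarrow> v \<in> sob (Suc n) \<inter> sob2_in U"
    using b(1) by blast
qed auto

text \<open>The claimed formula, used as the candidate for the derivatives. The factor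
  \<open>superpos\<close> vanishes outside the interval, which matters for \<open>j = 0\<close>,
  where the product over the empty list is 1 everywhere.\<close>

definition superpos_deriv :: "(real \<Rightarrow> real) \<Rightarrow> nat \<Rightarrow> (real \<Rightarrow> real) \<Rightarrow> (real \<Rightarrow> real) list \<Rightarrow> real \<Rightarrow> real" where
  "superpos_deriv f j u ws = (\<lambda>x. superpos ((deriv ^^ j) f) u x * (\<Prod>w\<leftarrow>ws. w x))"

text \<open>Each argument costs \<open>emb_const n\<close> for the embedding and
  \<open>8 ^ Suc n\<close> for the multiplication; the first factor returns from \<open>wb\<close>
  to the norm.\<close>

definition prod_const :: "nat \<Rightarrow> nat \<Rightarrow> real" where
  "prod_const n j = 2 * (real n + 2) * (8 ^ Suc n * emb_const n) ^ j"

lemma prod_const_nonneg: "0 \<le> prod_const n j"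
  using emb_const_pos[of n] by (simp add: prod_const_def)

lemma wb_prod_list:
  assumes "wb (Suc n) 0 B g" "\<forall>w\<in>set ws. wb (Suc n) 0 (\<nu> w) w"
  shows "wb (Suc n) 0 (B * (\<Prod>w\<leftarrow>ws. 8 ^ Suc n * \<nu> w)) (\<lambda>x. g x * (\<Prod>w\<leftarrow>ws. w x))"
  using assms
proof (induction ws arbitrary: B g)
  case (Cons w ws)
  have "wb (Suc n) (0 + 0) (8 ^ Suc n * (B * \<nu> w)) (\<lambda>x. g x * w x)" using Cons by (intro wb_mult) auto
  then have "wb (Suc n) 0 (B * (8 ^ Suc n * \<nu> w)) (\<lambda>x. g x * w x)" by (simp add: mult_ac)
  from Cons.IH[OF this] Cons(3) show ?case by (simp add: mult.assoc)
qed simp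

text \<open>In the derivatives and in all remainders the arguments factor out, leaving a coefficient
  \<open>g\<close> that does not depend on them. Operator norm estimates thus reduce to estimates of
  compositions.\<close>

lemma sob_prod_bound:
  assumes n: "n \<ge> 1" and g: "wb (Suc n) 0 B g" and ws: "ws \<in> args (sob (Suc n)) j"
    and F: "\<And>x. x \<in> unit_ival \<Longrightarrow> F x = g x * (\<Prod>w\<leftarrow>ws. w x)" "\<And>x. x \<notin> unit_ival \<Longrightarrow> F x = 0"
  shows "F \<in> sob (Suc n)" and "sob_norm (Suc n) F \<le> prod_const n j * B * (\<Prod>w\<leftarrow>ws. sob_norm (Suc n) w)"
proof -
  let ?e = "emb_const n" and ?N = "sob_norm (Suc n)"
  have len: "length ws = j" and sub: "set ws \<subseteq> sob (Suc n)" using ws by (auto simp: args_def)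
  have p: "(\<Prod>w\<leftarrow>ws. 8 ^ Suc n * (?e * ?N w)) = (8 ^ Suc n * ?e) ^ length ws * (\<Prod>w\<leftarrow>ws. ?N w)"
    by (induction ws) auto
  have "wb (Suc n) 0 (B * (\<Prod>w\<leftarrow>ws. 8 ^ Suc n * (?e * ?N w))) (\<lambda>x. g x * (\<Prod>w\<leftarrow>ws. w x))"
    using sub by (intro wb_prod_list g) (auto intro!: sob_imp_wb n)
  then have wF: "wb (Suc n) 0 (B * (\<Prod>w\<leftarrow>ws. 8 ^ Suc n * (?e * ?N w))) F"
    using wb_cong[of F "\<lambda>x. g x * (\<Prod>w\<leftarrow>ws. w x)"] F(1) by blast
  show "F \<in> sob (Suc n)" using wb_imp_sob(1)[OF wF F(2)] .
  show "sob_norm (Suc n) F \<le> prod_const n j * B * (\<Prod>w\<leftarrow>ws. ?N w)"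
    using wb_imp_sob(2)[OF wF F(2)] unfolding p len prod_const_def by (simp add: mult_ac)
qed

lemma superpos_deriv_multilinear:
  assumes n: "n \<ge> 1" and U: "open U" and f: "C_k_on (Suc n + j) U f"
    and u: "u \<in> sob (Suc n)" "closure (u ` unit_ival) \<subseteq> U"
  shows "superpos_deriv f j u \<in> bounded_multilinear (sob (Suc n)) (sob_norm (Suc n)) (sob (Suc n)) (sob_norm (Suc n)) j"
proof -
  let ?X = "sob (Suc n)" and ?N = "sob_norm (Suc n)" and ?g = "(deriv ^^ j) f"
  obtain \<alpha> \<beta> M \<delta> where b: "\<delta> > 0" "0 \<le> M" "{\<alpha>..\<beta>} \<subseteq> U" "wb (Suc n) 0 M u" "u ` unit_ival \<subseteq> {\<alpha>..\<beta>}"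
    "controlled_near n M {\<alpha>..\<beta>} u \<delta>"
    by (rule sob_local_bounds[OF n U u])
  obtain B where B: "wb (Suc n) 0 B (\<lambda>x. ?g (u x))"
    using wb_comp[OF C_k_on_funpow_deriv[OF f] b(3,2)] b(4,5) by blast
  have in1: "superpos_deriv f j u ws x = ?g (u x) * (\<Prod>w\<leftarrow>ws. w x)" if "x \<in> unit_ival" for ws x
    using that by (simp add: superpos_deriv_def superpos_def)
  have out: "superpos_deriv f j u ws x = 0" if "x \<notin> unit_ival" for ws x
    using that by (simp only: superpos_deriv_def superpos_def if_False mult_zero_left)
  have bd: "superpos_deriv f j u ws \<in> ?X"
    "?N (superpos_deriv f j u ws) \<le> prod_const n j * B * (\<Prod>w\<leftarrow>ws. ?N w)" if "ws \<in> args ?X j" for ws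
    by (rule sob_prod_bound[OF n B that in1 out], assumption+)+
  have upd: "(\<Prod>w\<leftarrow>ws[i := z]. w x) = (\<Prod>w\<leftarrow>take i ws. w x) * z x * (\<Prod>w\<leftarrow>drop (Suc i) ws. w x)"
    if "i < length ws" for ws :: "(real \<Rightarrow> real) list" and i z x
    using that by (simp add: upd_conv_take_nth_drop mult.assoc)
  show ?thesis
    unfolding bounded_multilinear_def
  proof (intro CollectI conjI ballI allI impI)
    fix ws :: "(real \<Rightarrow> real) list" and i :: nat assume "ws \<in> args ?X j" "i < j"
    then have i: "i < length ws" by (simp add: args_def)
    show "superpos_deriv f j u (ws[i := v + w]) = superpos_deriv f j u (ws[i := v]) + superpos_deriv f j u (ws[i := w])" for v w
      by (simp add: superpos_deriv_def upd[OF i] fun_eq_iff algebra_simps)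
    show "superpos_deriv f j u (ws[i := c *\<^sub>R w]) = c *\<^sub>R superpos_deriv f j u (ws[i := w])" for c w
      by (simp add: superpos_deriv_def upd[OF i] fun_eq_iff scaleR_fun_def algebra_simps)
  qed (use bd in blast)+
qed

text \<open>The remainder at order \<open>j\<close> is the Taylor remainder of
  \<open>(deriv ^^ j) f\<close> times the product of the arguments, hence quadratic in the norm of
  \<open>v - u\<close>; continuity follows likewise from the Lipschitz estimate.\<close>

lemma superpos_frechet_derivs:
  assumes n: "n \<ge> 1" and U: "open U" and f: "C_k_on (Suc (Suc n) + m) U f"
  shows "frechet_derivs (sob (Suc n)) (sob_norm (Suc n)) (sob (Suc n)) (sob_norm (Suc n))
    (sob (Suc n) \<inter> sob2_in U) m (superpos f) (superpos_deriv f)"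
proof -
  let ?X = "sob (Suc n)" and ?N = "sob_norm (Suc n)" and ?e = "emb_const n"
  let ?S = "?X \<inter> sob2_in U"
  interpret quasi_normed ?X ?N "sob_const n" by (rule quasi_normed_sob[OF n])
  have S: "u \<in> ?X" "closure (u ` unit_ival) \<subseteq> U" if "u \<in> ?S" for u
    using that by (auto simp: sob2_in_def)
  \<comment> \<open>Applied to \<open>d = sob_norm (Suc n) (v - u)\<close>: for the Taylor part,
    \<open>P * d < \<epsilon>\<close> turns the quadratic bound into \<open>\<epsilon>\<close> times
    the norm. The quotient by \<open>P + 1\<close> covers \<open>P = 0\<close>.\<close>
  have small: "\<exists>\<delta>>0. \<delta> \<le> \<delta>0 \<and> (\<forall>d. d < \<delta> \<longrightarrow> P * d < \<epsilon>)" if "\<epsilon> > 0" "\<delta>0 > 0" "0 \<le> P" for \<epsilon> \<delta>0 P :: real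
  proof (intro exI[of _ "min \<delta>0 (\<epsilon> / (P + 1))"] conjI allI impI)
    show "0 < min \<delta>0 (\<epsilon> / (P + 1))" using that by simp
    fix d assume "d < min \<delta>0 (\<epsilon> / (P + 1))"
    then have "P * d \<le> P * (\<epsilon> / (P + 1))" using that by (intro mult_left_mono) auto
    also have "\<dots> < \<epsilon>" using that by (simp add: field_simps)
    finally show "P * d < \<epsilon>" .
  qed simp
  have args: "ws \<in> args ?X j" if "ws \<in> unit_args j" for ws j using that by (simp add: unit_args_def)
  have prod: "a * (\<Prod>w\<leftarrow>ws. ?N w) \<le> a" if "ws \<in> unit_args j" "0 \<le> a" for ws j a
    using mult_left_mono[OF prod_unit_args_le_1[OF that(1)] that(2)] by simp
  show ?thesis
    unfolding frechet_derivs_def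
  proof (intro conjI allI impI ballI)
    fix u assume "u \<in> ?S"
    show "superpos_deriv f 0 u [] = superpos f u" by (simp add: superpos_deriv_def)
  next
    fix j u assume "j \<le> m" "u \<in> ?S"
    then show "superpos_deriv f j u \<in> bounded_multilinear ?X ?N ?X ?N j"
      by (intro superpos_deriv_multilinear[OF n U] S C_k_on_mono[OF f]) auto
  next
    fix j u \<epsilon> assume j: "j < m" and u: "u \<in> ?S" and \<epsilon>: "(0::real) < \<epsilon>"
    let ?g = "(deriv ^^ j) f"
    \<comment> \<open>As \<open>j < m\<close>, at least \<open>n + 3\<close> derivatives of
      \<open>?g\<close> remain, exactly what the Taylor estimate at order \<open>Suc n\<close>
      demands.\<close>
    have g: "C_k_on (Suc (Suc (Suc n))) U ?g" using j by (intro C_k_on_funpow_deriv C_k_on_mono[OF f]) auto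
    obtain \<alpha> \<beta> M \<delta>0 where b: "\<delta>0 > 0" "0 \<le> M" "{\<alpha>..\<beta>} \<subseteq> U" "wb (Suc n) 0 M u" "u ` unit_ival \<subseteq> {\<alpha>..\<beta>}"
      "controlled_near n M {\<alpha>..\<beta>} u \<delta>0"
      by (rule sob_local_bounds[OF n U S[OF u]])
    obtain B where B: "B \<ge> 0" "\<And>v \<epsilon>. wb (Suc n) 0 M v \<Longrightarrow> v ` unit_ival \<subseteq> {\<alpha>..\<beta>} \<Longrightarrow> wb (Suc n) 0 \<epsilon> (\<lambda>x. v x - u x) \<Longrightarrow>
        wb (Suc n) 0 (B * \<epsilon>\<^sup>2) (\<lambda>x. ?g (v x) - ?g (u x) - deriv ?g (u x) * (v x - u x))"
      using wb_comp_taylor[OF g b(3,2)] b(4,5) by blast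
    define P where "P = prod_const n j * B * ?e\<^sup>2"
    have P: "0 \<le> P" using B prod_const_nonneg by (simp add: P_def)
    obtain \<delta> where \<delta>: "\<delta> > 0" "\<delta> \<le> \<delta>0" "\<And>d. d < \<delta> \<Longrightarrow> P * d < \<epsilon>" using small[OF \<epsilon> b(1) P] by blast
    have "multilinear_norm ?X ?N ?N j
        (\<lambda>ws. superpos_deriv f j v ws - superpos_deriv f j u ws - superpos_deriv f (Suc j) u ((v - u) # ws)) \<le> \<epsilon> * ?N (v - u)"
      if v: "v \<in> ?S" "?N (v - u) < \<delta>" for v
    proof (rule multilinear_norm_le)
      fix ws assume ws: "ws \<in> unit_args j"
      have bv: "wb (Suc n) 0 M v" "v ` unit_ival \<subseteq> {\<alpha>..\<beta>}" "wb (Suc n) 0 (?e * ?N (v - u)) (\<lambda>x. v x - u x)"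
        using b(6) v \<delta>(2) by (auto simp: controlled_near_def)
      let ?F = "superpos_deriv f j v ws - superpos_deriv f j u ws - superpos_deriv f (Suc j) u ((v - u) # ws)"
      have "?N ?F \<le> prod_const n j * (B * (?e * ?N (v - u))\<^sup>2) * (\<Prod>w\<leftarrow>ws. ?N w)"
        by (rule sob_prod_bound(2)[OF n B(2)[OF bv] args[OF ws]])
          (auto simp: superpos_deriv_def superpos_def algebra_simps)
      also have "\<dots> \<le> prod_const n j * (B * (?e * ?N (v - u))\<^sup>2)"
        using B prod_const_nonneg by (intro prod[OF ws] mult_nonneg_nonneg) auto
      also have "\<dots> = (P * ?N (v - u)) * ?N (v - u)"
        by (simp add: P_def power2_eq_square mult_ac)
      also have "\<dots> \<le> \<epsilon> * ?N (v - u)" using \<delta>(3)[OF v(2)] nonneg by (intro mult_right_mono) auto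
      finally show "?N ?F \<le> \<epsilon> * ?N (v - u)" .
    qed
    then show "\<exists>\<delta>>0. \<forall>v\<in>?S. ?N (v - u) < \<delta> \<longrightarrow> multilinear_norm ?X ?N ?N j
        (\<lambda>ws. superpos_deriv f j v ws - superpos_deriv f j u ws - superpos_deriv f (Suc j) u ((v - u) # ws)) \<le> \<epsilon> * ?N (v - u)"
      using \<delta>(1) by blast
  next
    fix j u \<epsilon> assume j: "j \<le> m" and u: "u \<in> ?S" and \<epsilon>: "(0::real) < \<epsilon>"
    let ?g = "(deriv ^^ j) f"
    \<comment> \<open>For \<open>j = m\<close> only \<open>n + 2\<close> derivatives remain, still
      enough for the difference estimate at order \<open>Suc n\<close>.\<close>
    have g: "C_k_on (Suc (Suc n)) U ?g" using j by (intro C_k_on_funpow_deriv C_k_on_mono[OF f]) auto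
    obtain \<alpha> \<beta> M \<delta>0 where b: "\<delta>0 > 0" "0 \<le> M" "{\<alpha>..\<beta>} \<subseteq> U" "wb (Suc n) 0 M u" "u ` unit_ival \<subseteq> {\<alpha>..\<beta>}"
      "controlled_near n M {\<alpha>..\<beta>} u \<delta>0"
      by (rule sob_local_bounds[OF n U S[OF u]])
    obtain B where B: "B \<ge> 0" "\<And>v \<epsilon>. wb (Suc n) 0 M v \<Longrightarrow> v ` unit_ival \<subseteq> {\<alpha>..\<beta>} \<Longrightarrow> wb (Suc n) 0 \<epsilon> (\<lambda>x. v x - u x) \<Longrightarrow>
        wb (Suc n) 0 (B * \<epsilon>) (\<lambda>x. ?g (v x) - ?g (u x))"
      using wb_comp_diff[OF g b(3,2)] b(4,5) by blast
    define P where "P = prod_const n j * B * ?e"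
    have P: "0 \<le> P" using B prod_const_nonneg emb_const_pos[of n] by (simp add: P_def)
    obtain \<delta> where \<delta>: "\<delta> > 0" "\<delta> \<le> \<delta>0" "\<And>d. d < \<delta> \<Longrightarrow> P * d < \<epsilon>" using small[OF \<epsilon> b(1) P] by blast
    have "multilinear_norm ?X ?N ?N j (\<lambda>ws. superpos_deriv f j v ws - superpos_deriv f j u ws) < \<epsilon>"
      if v: "v \<in> ?S" "?N (v - u) < \<delta>" for v
    proof -
      have "multilinear_norm ?X ?N ?N j (\<lambda>ws. superpos_deriv f j v ws - superpos_deriv f j u ws) \<le> P * ?N (v - u)"
      proof (rule multilinear_norm_le)
        fix ws assume ws: "ws \<in> unit_args j"
        have bv: "wb (Suc n) 0 M v" "v ` unit_ival \<subseteq> {\<alpha>..\<beta>}" "wb (Suc n) 0 (?e * ?N (v - u)) (\<lambda>x. v x - u x)"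
          using b(6) v \<delta>(2) by (auto simp: controlled_near_def)
        let ?F = "superpos_deriv f j v ws - superpos_deriv f j u ws"
        have "?N ?F \<le> prod_const n j * (B * (?e * ?N (v - u))) * (\<Prod>w\<leftarrow>ws. ?N w)"
          by (rule sob_prod_bound(2)[OF n B(2)[OF bv] args[OF ws]])
            (auto simp: superpos_deriv_def superpos_def algebra_simps)
        also have "\<dots> \<le> prod_const n j * (B * (?e * ?N (v - u)))"
          using B prod_const_nonneg nonneg emb_const_pos[of n] by (intro prod[OF ws] mult_nonneg_nonneg) auto
        also have "\<dots> = P * ?N (v - u)" by (simp add: P_def mult_ac)
        finally show "?N ?F \<le> P * ?N (v - u)" .
      qed
      then show ?thesis using \<delta>(3)[OF v(2)] by linarith
    qed
    then show "\<exists>\<delta>>0. \<forall>v\<in>?S. ?N (v - u) < \<delta> \<longrightarrow>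
        multilinear_norm ?X ?N ?N j (\<lambda>ws. superpos_deriv f j v ws - superpos_deriv f j u ws) < \<epsilon>"
      using \<delta>(1) by blast
  qed
qed

theorem theorem2p11:
  fixes k m :: nat and U :: "real set" and f :: "real \<Rightarrow> real"
  assumes "k \<ge> 2"
    and "open U" and "U \<noteq> {}"
    and "C_k_on (k + m + 1) U f"
  shows "open_in_normed (sob 2) (sob_norm 2) (sob2_in U) \<and>
    (\<forall>u \<in> sob k \<inter> sob2_in U. superpos f u \<in> sob k) \<and>
    C_m_map (sob k) (sob_norm k) (sob k) (sob_norm k) (sob k \<inter> sob2_in U) m (superpos f) \<and>
    (m \<ge> 1 \<longrightarrow>
      (\<forall>D. frechet_derivs (sob k) (sob_norm k) (sob k) (sob_norm k)
              (sob k \<inter> sob2_in U) m (superpos f) D \<longrightarrow>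
        (\<forall>u \<in> sob k \<inter> sob2_in U. \<forall>j \<in> {1..m}. \<forall>ws \<in> args (sob k) j.
           D j u ws = (\<lambda>x. superpos ((deriv ^^ j) f) u x * (\<Prod>w\<leftarrow>ws. w x)))))"
proof -
  obtain n where k: "k = Suc n" and n: "n \<ge> 1" using assms(1) by (cases k) auto
  let ?S = "sob k \<inter> sob2_in U"
  interpret quasi_normed "sob k" "sob_norm k" "sob_const n" unfolding k by (rule quasi_normed_sob[OF n])
  have E: "frechet_derivs (sob k) (sob_norm k) (sob k) (sob_norm k) ?S m (superpos f) (superpos_deriv f)"
    unfolding k using assms(4) by (intro superpos_frechet_derivs n assms(2)) (simp add: k)
  have S: "open_in_normed (sob k) (sob_norm k) ?S"
    unfolding k by (rule open_in_normed_sob2_in[OF n assms(2)])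
  \<comment> \<open>Openness of \<open>sob2_in U\<close> in \<open>sob 2\<close> is the case
    \<open>k = 2\<close> of the same lemma.\<close>
  have "open_in_normed (sob (Suc 1)) (sob_norm (Suc 1)) (sob (Suc 1) \<inter> sob2_in U)"
    by (rule open_in_normed_sob2_in[OF _ assms(2)]) simp
  moreover have "sob (Suc 1) \<inter> sob2_in U = sob2_in U" by (auto simp: sob2_in_def numeral_2_eq_2)
  ultimately have S2: "open_in_normed (sob 2) (sob_norm 2) (sob2_in U)" by (simp add: numeral_2_eq_2)
  have "superpos f u \<in> sob k" if u: "u \<in> ?S" for u
  proof -
    \<comment> \<open>Well-definedness is the case \<open>j = 0\<close>: a 0-linear map takes the
      empty list to an element of the space.\<close>
    have "superpos_deriv f 0 u [] \<in> sob k"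
      by (rule multilinear_in[OF frechet_derivs_multilinear[OF E _ u]]) (auto simp: args_def)
    then show ?thesis by (simp add: superpos_deriv_def)
  qed
  moreover have "D j u ws = superpos_deriv f j u ws"
    if "frechet_derivs (sob k) (sob_norm k) (sob k) (sob_norm k) ?S m (superpos f) D"
      "u \<in> ?S" "j \<in> {1..m}" "ws \<in> args (sob k) j" for D j u ws
    using that by (intro frechet_derivs_unique[OF S that(1) E]) auto
  ultimately show ?thesis using S S2 E unfolding C_m_map_def superpos_deriv_def by blast
qed

end
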